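(* Let $\mathcal{H}$ be (the area-one locus of) a connected component of a stratum of translation surfaces. Let $\lambda$ be an $SL(2,\mathbb{R})$-invariant measure on $\mathcal{H}$ such that $\widehat f\in L^2(\mathcal{H},\lambda)$ for every $f\in B_c(\mathbb{R}^2)$. Let $\kappa$ denote (normalized) Haar measure on $SL(2,\mathbb{R})$. Then there exist measures $\nu=\nu(\lambda)$ on $\mathbb{R}\setminus\{0\}$ and $\eta=\eta(\lambda)$ on $\mathbb{P}^1(\mathbb{R})=\mathbb{R}\cup\{\infty\}$ such that for every $h\in B_c(\mathbb{R}^4)=B_c(\mathbb{R}^2\times\mathbb{R}^2)$, $$\int_{\mathcal{H}}\widehat h(\omega)\,d\lambda(\omega)=\int_{\mathbb{R}\setminus\{0\}}\left(\int_{SL(2,\mathbb{R})}h(tx,y)\,d\kappa(x,y)\right)d\nu(t)+\int_{\mathbb{P}^1(\mathbb{R})}\left(\int_{\mathbb{R}^2}h(x,sx)\,dx\right)d\eta(s).$$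
   Context: $B_c(\mathbb{R}^n)$ denotes the space of Borel measurable, bounded, compactly supported functions on $\mathbb{R}^n$. A translation surface is a pair $(X,\omega)$ (often written just $\omega$), where $X$ is a compact Riemann surface of genus $g$ and $\omega$ is a nonzero holomorphic 1-form on $X$. Integrating $\omega$ away from its zeros gives charts to $\mathbb{C}\cong\mathbb{R}^2$ with translation transition maps, hence a flat metric with cone singularities at the zeros. A saddle connection $\gamma$ is a geodesic segment joining two (possibly equal) zeros of $\omega$ with no zero in its interior; its holonomy vector (for a choice of orientation) is $\int_\gamma\omega\in\mathbb{C}\cong\mathbb{R}^2$. $\Lambda_\omega\subset\mathbb{R}^2$ denotes the (discrete) set of holonomy vectors of all (oriented) saddle connections of $(X,\omega)$. The moduli space of genus $g$ translation surfaces decomposes into strata according to the orders of the zeros of $\omega$ (an integer partition of $2g-2$). $\mathcal{H}$ denotes the subset of surfaces of area $1$ in a connected component of a stratum. The group $SL(2,\mathbb{R})$ acts on $\mathcal{H}$ by linear post-composition with the charts. Siegel--Veech transforms: for $f\in B_c(\mathbb{R}^2)$, $\widehat f(\omega)=\sum_{v\in\Lambda_\omega}f(v)$; for $h\in B_c(\mathbb{R}^2\times\mathbb{R}^2)$, $\widehat h(\omega)=\sum_{v_1,v_2\in\Lambda_\omega}h(v_1,v_2)$. $SL(2,\mathbb{R})$ is viewed as the subset of pairs $(x,y)\in\mathbb{R}^2\times\mathbb{R}^2$ with $\det(x,y)=1$ ($x,y$ being the columns of the matrix), and $\kappa$ is Haar measure with some fixed normalization. For $s=\infty$, the inner integral $\int_{\mathbb{R}^2}h(x,sx)\,dx$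 is understood as $\int_{\mathbb{R}^2}h(0,y)\,dy$. *)

theory Defs
  imports "HOL-Complex_Analysis.Complex_Analysis" "HOL-Homology.Homology"
begin

section \<open>Borel sets and test functions\<close>

definition borel_of :: "'a topology \<Rightarrow> 'a measure" where
  "borel_of X = sigma (topspace X) {U. openin X U}"

definition B\<^sub>c :: "('a::euclidean_space \<Rightarrow> real) set" where
  "B\<^sub>c = {f. f \<in> borel_measurable borel \<and> bounded (range f) \<and> compact (closure {x. f x \<noteq> 0})}"


section \<open>Compact Riemann surfaces with a holomorphic 1-form\<close>

text \<open>
  A chart is a pair of a domain and a function; the function is arbitrary outside the domain.
  A 1-form is given by its coefficient with respect to each chart, i.e. it is
  \<open>form S c z dz\<close> in the coordinate \<open>z\<close> of the chart \<open>c\<close>; the coefficient is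
  arbitrary outside the image of the chart.
\<close>

type_synonym 'a chart = "'a set \<times> ('a \<Rightarrow> complex)"

record 'a surface_with_form =
  surf_top :: "'a topology"
  atlas :: "'a chart set"
  form :: "'a chart \<Rightarrow> complex \<Rightarrow> complex"

definition is_chart :: "'a topology \<Rightarrow> 'a chart \<Rightarrow> bool" where
  "is_chart X c \<longleftrightarrow> openin X (fst c) \<and> open (snd c ` fst c) \<and>
     homeomorphic_map (subtopology X (fst c)) (top_of_set (snd c ` fst c)) (snd c)"

definition chart_inv :: "'a chart \<Rightarrow> complex \<Rightarrow> 'a" where
  "chart_inv c = inv_into (fst c) (snd c)"

definition compact_riemann_surface :: "'a topology \<Rightarrow> 'a chart set \<Rightarrow> bool" where
  "compact_riemann_surface X A \<longleftrightarrow>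
     Hausdorff_space X \<and> compact_space X \<and> connected_space X \<and>
     (\<forall>c\<in>A. is_chart X c) \<and> (\<Union>c\<in>A. fst c) = topspace X \<and>
     (\<forall>c\<in>A. \<forall>d\<in>A. (snd d \<circ> chart_inv c) holomorphic_on (snd c ` (fst c \<inter> fst d)))"

definition holomorphic_one_form :: "'a chart set \<Rightarrow> ('a chart \<Rightarrow> complex \<Rightarrow> complex) \<Rightarrow> bool" where
  "holomorphic_one_form A \<omega> \<longleftrightarrow>
     (\<forall>c\<in>A. \<omega> c holomorphic_on (snd c ` fst c)) \<and>
     (\<forall>c\<in>A. \<forall>d\<in>A. \<forall>p \<in> fst c \<inter> fst d.
        \<omega> c (snd c p) = \<omega> d (snd d p) * deriv (snd d \<circ> chart_inv c) (snd c p))"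

definition translation_surface :: "'a surface_with_form \<Rightarrow> bool" where
  "translation_surface S \<longleftrightarrow>
     compact_riemann_surface (surf_top S) (atlas S) \<and>
     holomorphic_one_form (atlas S) (form S) \<and>
     (\<exists>c\<in>atlas S. \<exists>p\<in>fst c. form S c (snd c p) \<noteq> 0)"

definition zeros :: "'a surface_with_form \<Rightarrow> 'a set" where
  "zeros S = {p. \<exists>c\<in>atlas S. p \<in> fst c \<and> form S c (snd c p) = 0}"

definition zero_order :: "'a surface_with_form \<Rightarrow> 'a \<Rightarrow> nat" where
  "zero_order S p = (THE n. \<exists>c\<in>atlas S. p \<in> fst c \<and> zorder (form S c) (snd c p) = int n)"

definition zero_orders :: "'a surface_with_form \<Rightarrow> nat multiset" where
  "zero_orders S = image_mset (zero_order S) (mset_set (zeros S))"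

definition has_genus :: "'a surface_with_form \<Rightarrow> nat \<Rightarrow> bool" where
  "has_genus S g \<longleftrightarrow> homology_group 1 (surf_top S) \<cong> free_Abelian_group {..<2 * g}"

text \<open>
  The flat area is the total mass of the area form \<open>(\<i>/2) \<omega> \<and> cnj \<omega>\<close>, which is
  \<open>\<bar>f(z)\<bar>\<^sup>2 dx dy\<close> where \<open>\<omega> = f(z) dz\<close>.
\<close>

definition is_area_measure :: "'a surface_with_form \<Rightarrow> 'a measure \<Rightarrow> bool" where
  "is_area_measure S M \<longleftrightarrow> sets M = sets (borel_of (surf_top S)) \<and>
     (\<forall>c\<in>atlas S. \<forall>A\<in>sets M. A \<subseteq> fst c \<longrightarrow>
        emeasure M A = (\<integral>\<^sup>+z\<in>snd c ` A. ennreal ((norm (form S c z))\<^sup>2) \<partial>lborel))"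

definition area :: "'a surface_with_form \<Rightarrow> ennreal" where
  "area S = (THE a. \<exists>M. is_area_measure S M \<and> a = emeasure M (topspace (surf_top S)))"


section \<open>Translation charts, saddle connections and holonomy vectors\<close>

text \<open>
  Translation charts are the injective local primitives of the 1-form away from its zeros.
\<close>

definition translation_charts :: "'a surface_with_form \<Rightarrow> 'a chart set" where
  "translation_charts S = {(U, z). is_chart (surf_top S) (U, z) \<and> U \<inter> zeros S = {} \<and>
     (\<forall>c\<in>atlas S. \<forall>p \<in> U \<inter> fst c.
        ((z \<circ> chart_inv c) has_field_derivative form S c (snd c p)) (at (snd c p)))}"

text \<open>
  A geodesic away from the zeros is locally a straight line, traversed at constant nonzero speed,
  in the translation charts. Saddle connections are oriented and parametrized by \<open>[0,1]\<close>.
\<close>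

definition saddle_connection :: "'a surface_with_form \<Rightarrow> (real \<Rightarrow> 'a) \<Rightarrow> bool" where
  "saddle_connection S \<gamma> \<longleftrightarrow>
     pathin (surf_top S) \<gamma> \<and> \<gamma> 0 \<in> zeros S \<and> \<gamma> 1 \<in> zeros S \<and>
     (\<forall>t\<in>{0<..<1}. \<gamma> t \<notin> zeros S) \<and>
     (\<forall>t\<in>{0<..<1}. \<exists>(U, z) \<in> translation_charts S. \<exists>a v.
        \<gamma> t \<in> U \<and> v \<noteq> 0 \<and> (\<forall>\<^sub>F s in nhds t. \<gamma> s \<in> U \<and> z (\<gamma> s) = a + s *\<^sub>R v))"

text \<open>The value of the 1-form on the velocity of a path.\<close>

definition form_velocity :: "'a surface_with_form \<Rightarrow> (real \<Rightarrow> 'a) \<Rightarrow> real \<Rightarrow> complex" where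
  "form_velocity S \<gamma> t = (THE w. \<exists>c\<in>atlas S. \<exists>u. \<gamma> t \<in> fst c \<and>
     ((snd c \<circ> \<gamma>) has_vector_derivative u) (at t) \<and> w = form S c (snd c (\<gamma> t)) * u)"

definition path_holonomy :: "'a surface_with_form \<Rightarrow> (real \<Rightarrow> 'a) \<Rightarrow> complex" where
  "path_holonomy S \<gamma> = integral {0..1} (form_velocity S \<gamma>)"

definition to_R2 :: "complex \<Rightarrow> real^2" where
  "to_R2 w = vector [Re w, Im w]"

definition of_R2 :: "real^2 \<Rightarrow> complex" where
  "of_R2 x = Complex (vec_nth x 1) (vec_nth x 2)"

definition surface_holonomies :: "'a surface_with_form \<Rightarrow> (real^2) set" where
  "surface_holonomies S = {to_R2 (path_holonomy S \<gamma>) | \<gamma>. saddle_connection S \<gamma>}"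


section \<open>Moduli space and strata\<close>

definition isomorphic_surfaces :: "'a surface_with_form \<Rightarrow> 'b surface_with_form \<Rightarrow> bool" where
  "isomorphic_surfaces S T \<longleftrightarrow>
     (\<exists>F. homeomorphic_map (surf_top S) (surf_top T) F \<and>
        (\<forall>c\<in>atlas S. \<forall>d\<in>atlas T.
           (snd d \<circ> F \<circ> chart_inv c) holomorphic_on (snd c ` {p \<in> fst c. F p \<in> fst d}) \<and>
           (\<forall>p\<in>fst c. F p \<in> fst d \<longrightarrow>
              form S c (snd c p) =
                form T d (snd d (F p)) * deriv (snd d \<circ> F \<circ> chart_inv c) (snd c p))))"

text \<open>
  Points of the moduli space are isomorphism classes. The points of the surfaces are taken from
  \<^typ>\<open>real\<close>; as compact Riemann surfaces have the cardinality of the continuum, every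
  translation surface has an isomorphic copy of this kind.
\<close>

type_synonym tsurf = "real surface_with_form"

definition iso_rel :: "tsurf rel" where
  "iso_rel = {(S, T). translation_surface S \<and> translation_surface T \<and> isomorphic_surfaces S T}"

definition moduli_space :: "nat \<Rightarrow> tsurf set set" where
  "moduli_space g = {S. translation_surface S \<and> has_genus S g} // iso_rel"

definition stratum :: "nat \<Rightarrow> nat multiset \<Rightarrow> tsurf set set" where
  "stratum g \<alpha> = {c \<in> moduli_space g. \<exists>S\<in>c. zero_orders S = \<alpha>}"

text \<open>
  The topology of a stratum, i.e. the one for which period coordinates are local coordinates:
  \<open>T\<close> is close to \<open>S\<close> if there is a homeomorphism \<open>S \<rightarrow> T\<close> that matches the zeros
  and whose difference from a translation is, in translation charts, locally Lipschitz with a small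
  constant. If the periods of \<open>T\<close> are close to those of \<open>S\<close>, such a map is obtained
  by mapping the triangles of a geodesic triangulation of \<open>S\<close> affinely; conversely such a map
  changes the period of a path of length \<open>L\<close> by at most \<open>\<epsilon> L\<close> and has small
  quasiconformal distortion.
\<close>

definition eps_close :: "real \<Rightarrow> 'a surface_with_form \<Rightarrow> 'b surface_with_form \<Rightarrow> bool" where
  "eps_close \<epsilon> S T \<longleftrightarrow>
     (\<exists>F. homeomorphic_map (surf_top S) (surf_top T) F \<and> F ` zeros S = zeros T \<and>
        (\<forall>U z V w p. (U, z) \<in> translation_charts S \<longrightarrow> (V, w) \<in> translation_charts T \<longrightarrow>
           p \<in> U \<longrightarrow> F p \<in> V \<longrightarrow>
             (\<exists>N. openin (surf_top S) N \<and> p \<in> N \<and> N \<subseteq> U \<and> F ` N \<subseteq> V \<and>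
                (\<forall>q\<in>N. norm ((w (F q) - w (F p)) - (z q - z p)) \<le> \<epsilon> * norm (z q - z p)))))"

definition stratum_topology :: "nat \<Rightarrow> nat multiset \<Rightarrow> tsurf set topology" where
  "stratum_topology g \<alpha> = topology (\<lambda>W. W \<subseteq> stratum g \<alpha> \<and>
     (\<forall>c\<in>W. \<forall>S\<in>c. \<exists>\<epsilon>>0. \<forall>d\<in>stratum g \<alpha>. \<forall>T\<in>d. eps_close \<epsilon> S T \<longrightarrow> d \<in> W))"

lemma eps_close_mono:
  assumes "eps_close \<epsilon> S T" "\<epsilon> \<le> \<delta>"
  shows "eps_close \<delta> S T"
proof -
  have le: "r \<le> \<delta> * norm x" if "r \<le> \<epsilon> * norm x" for r and x :: complex
    using that assms(2) by (meson mult_right_mono norm_ge_zero order_trans)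
  obtain F where F: "homeomorphic_map (surf_top S) (surf_top T) F" "F ` zeros S = zeros T"
    and near: "\<forall>U z V w p. (U, z) \<in> translation_charts S \<longrightarrow> (V, w) \<in> translation_charts T \<longrightarrow>
      p \<in> U \<longrightarrow> F p \<in> V \<longrightarrow>
      (\<exists>N. openin (surf_top S) N \<and> p \<in> N \<and> N \<subseteq> U \<and> F ` N \<subseteq> V \<and>
        (\<forall>q\<in>N. norm ((w (F q) - w (F p)) - (z q - z p)) \<le> \<epsilon> * norm (z q - z p)))"
    using assms(1) unfolding eps_close_def by (elim exE conjE)
  show ?thesis
    unfolding eps_close_def
  proof (intro exI[of _ F] conjI F allI impI)
    fix U z V w p
    assume "(U, z) \<in> translation_charts S" "(V, w) \<in> translation_charts T" "p \<in> U" "F p \<in> V"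
    from near[rule_format, OF this] obtain N
      where N: "openin (surf_top S) N" "p \<in> N" "N \<subseteq> U" "F ` N \<subseteq> V"
        and "\<forall>q\<in>N. norm ((w (F q) - w (F p)) - (z q - z p)) \<le> \<epsilon> * norm (z q - z p)"
      by (elim exE conjE)
    then show "\<exists>N. openin (surf_top S) N \<and> p \<in> N \<and> N \<subseteq> U \<and> F ` N \<subseteq> V \<and>
        (\<forall>q\<in>N. norm ((w (F q) - w (F p)) - (z q - z p)) \<le> \<delta> * norm (z q - z p))"
      by (intro exI[of _ N] conjI N ballI le) (rule bspec)
  qed
qed

lemma openin_stratum_topology:
  "openin (stratum_topology g \<alpha>) W \<longleftrightarrow> W \<subseteq> stratum g \<alpha> \<and>
     (\<forall>c\<in>W. \<forall>S\<in>c. \<exists>\<epsilon>>0. \<forall>d\<in>stratum g \<alpha>. \<forall>T\<in>d. eps_close \<epsilon> S T \<longrightarrow> d \<in> W)"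
proof -
  define P where "P W S \<epsilon> \<longleftrightarrow> (\<forall>d\<in>stratum g \<alpha>. \<forall>T\<in>d. eps_close \<epsilon> S T \<longrightarrow> d \<in> W)"
    for W and S :: tsurf and \<epsilon>
  define L where "L W \<longleftrightarrow> W \<subseteq> stratum g \<alpha> \<and> (\<forall>c\<in>W. \<forall>S\<in>c. \<exists>\<epsilon>>0. P W S \<epsilon>)" for W
  have mono: "P W' S \<delta>" if "P W S \<epsilon>" "W \<subseteq> W'" "\<delta> \<le> \<epsilon>" for W W' S \<delta> \<epsilon>
    using that eps_close_mono unfolding P_def by (meson subsetD)
  have P_int: "P (W \<inter> W') S \<epsilon>" if "P W S \<epsilon>" "P W' S \<epsilon>" for W W' S \<epsilon>
    using that unfolding P_def by simp
  have inter: "L (W \<inter> W')" if W: "L W" and W': "L W'" for W W'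
    unfolding L_def
  proof (intro conjI ballI)
    show "W \<inter> W' \<subseteq> stratum g \<alpha>" using W unfolding L_def by (simp add: le_infI1)
    fix c S assume c: "c \<in> W \<inter> W'" and S: "S \<in> c"
    obtain e where e: "e > 0" "P W S e" using W c S unfolding L_def by (meson IntD1)
    obtain e' where e': "e' > 0" "P W' S e'" using W' c S unfolding L_def by (meson IntD2)
    have "P (W \<inter> W') S (min e e')"
      by (intro P_int mono[OF e(2)] mono[OF e'(2)]) simp_all
    moreover have "min e e' > 0" using e e' by simp
    ultimately show "\<exists>\<epsilon>>0. P (W \<inter> W') S \<epsilon>" by (intro exI[of _ "min e e'"] conjI)
  qed
  have union: "L (\<Union>K)" if K: "\<forall>W\<in>K. L W" for K
    unfolding L_def
  proof (intro conjI ballI)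
    show "\<Union>K \<subseteq> stratum g \<alpha>" using K unfolding L_def by (simp add: Sup_le_iff)
    fix c S assume "c \<in> \<Union>K" and S: "S \<in> c"
    then obtain W where W: "W \<in> K" "c \<in> W" by (elim UnionE)
    with K S obtain e where e: "e > 0" "P W S e" unfolding L_def by meson
    have "P (\<Union>K) S e" by (rule mono[OF e(2) Union_upper[OF W(1)] order_refl])
    with e(1) show "\<exists>\<epsilon>>0. P (\<Union>K) S \<epsilon>" by (intro exI[of _ e] conjI)
  qed
  have "istopology L"
    unfolding istopology_def using inter union by simp
  moreover have "stratum_topology g \<alpha> = topology L"
    unfolding stratum_topology_def L_def P_def ..
  ultimately have "openin (stratum_topology g \<alpha>) W \<longleftrightarrow> L W"
    by (simp only: topology_inverse')
  then show ?thesis unfolding L_def P_def .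
qed

definition area_one_locus :: "tsurf set set \<Rightarrow> tsurf set set" where
  "area_one_locus C = {c \<in> C. \<exists>S\<in>c. area S = 1}"

definition \<Lambda> :: "tsurf set \<Rightarrow> (real^2) set" where
  "\<Lambda> c = (\<Union>S\<in>c. surface_holonomies S)" \<comment> \<open>isomorphic surfaces have the same holonomy vectors\<close>


section \<open>The action of the special linear group and its Haar measure\<close>

definition SL2 :: "(real^2^2) set" where
  "SL2 = {A. det A = 1}"

definition lin_map :: "real^2^2 \<Rightarrow> complex \<Rightarrow> complex" where
  "lin_map A w = of_R2 (A *v to_R2 w)"

text \<open>
  \<open>A \<cdot> S\<close> has the same underlying space and zeros as \<open>S\<close>, and its translation charts
  are those of \<open>S\<close> followed by \<open>A\<close>; this determines it up to isomorphism.
\<close>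

definition SL2_act :: "real^2^2 \<Rightarrow> tsurf set \<Rightarrow> tsurf set" where
  "SL2_act A c = {T. translation_surface T \<and> (\<exists>S\<in>c. surf_top T = surf_top S \<and> zeros T = zeros S \<and>
     translation_charts T = (\<lambda>(U, z). (U, lin_map A \<circ> z)) ` translation_charts S)}"

definition SL2_invariant :: "tsurf set measure \<Rightarrow> bool" where
  "SL2_invariant M \<longleftrightarrow>
     (\<forall>A\<in>SL2. SL2_act A \<in> M \<rightarrow>\<^sub>M M \<and> distr M M (SL2_act A) = M)"

definition is_haar_SL2 :: "(real^2^2) measure \<Rightarrow> bool" where
  "is_haar_SL2 \<kappa> \<longleftrightarrow>
     sets \<kappa> = sets (borel_of (top_of_set SL2)) \<and>
     (\<forall>A\<in>SL2. distr \<kappa> \<kappa> ((**) A) = \<kappa>) \<and>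
     (\<forall>K. compact K \<and> K \<subseteq> SL2 \<longrightarrow> emeasure \<kappa> K < \<infinity>) \<and>
     emeasure \<kappa> SL2 \<noteq> 0"


section \<open>Siegel--Veech transforms\<close>

definition siegel_veech :: "(real^2 \<Rightarrow> real) \<Rightarrow> tsurf set \<Rightarrow> real" where
  "siegel_veech f c = (\<Sum>\<^sub>\<infinity>v\<in>\<Lambda> c. f v)"

definition siegel_veech2 :: "((real^2) \<times> (real^2) \<Rightarrow> real) \<Rightarrow> tsurf set \<Rightarrow> real" where
  "siegel_veech2 h c = (\<Sum>\<^sub>\<infinity>(v\<^sub>1, v\<^sub>2)\<in>\<Lambda> c \<times> \<Lambda> c. h (v\<^sub>1, v\<^sub>2))"

text \<open>The projective line; \<^term>\<open>None\<close> is the point at infinity.\<close>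

definition P1 :: "real option topology" where
  "P1 = Alexandroff_compactification euclideanreal"

definition slope_slice :: "((real^2) \<times> (real^2) \<Rightarrow> real) \<Rightarrow> real option \<Rightarrow> real^2 \<Rightarrow> real" where
  "slope_slice h s x = (case s of Some r \<Rightarrow> h (x, r *\<^sub>R x) | None \<Rightarrow> h (0, x))"

end

theory Submission
  imports Defs
begin

text \<open>
  The set of holonomy vectors is locally finite, avoids \<open>0\<close> and is equivariant under the linear action.
  Hence \<open>m(E) = \<integral> #(E \<inter> \<Lambda> \<times> \<Lambda>) d\<lambda>\<close> is an \<open>SL(2,\<real>)\<close>-invariant measure on pairs \<open>(x, y)\<close> with
  \<open>x \<noteq> 0\<close>; it is finite on compact sets because Siegel--Veech transforms are square integrable.

  It remains to disintegrate \<open>m\<close> over the orbits. Where \<open>det \<noteq> 0\<close>, every orbit is a copy of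
  \<open>SL(2,\<real>)\<close>: insert \<open>1 = \<integral> g(a(X)\<^sup>-\<^sup>1 A) dA\<close> with \<open>a(X)\<close> the unimodular part of \<open>X\<close>, exchange the integrals
  and use invariance. Where \<open>det = 0\<close>, the pair is \<open>(x, s x)\<close> and the same averaging over the
  upper triangular matrices moving \<open>x\<close> yields Lebesgue measure on the plane.

  For local finiteness, cover the surface by finitely many discs with primitives \<open>f\<^sub>i\<close> of the form that
  vanish at the zeros. A saddle connection of length at most \<open>R\<close> crosses a bounded number of discs, so its
  holonomy is a bounded sum of values of \<open>f\<^sub>i - f\<^sub>j\<close>, which is locally constant and thus takes finitely
  many values on compact sets.
\<close>

text \<open>The disintegration shifts a Haar integral from both sides, whereas
  \<open>is_haar_SL2\<close> grants left invariance only. Hence everything is computed with the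
  concrete measure \<open>cone_haar\<close>, which inherits invariance on both sides from Lebesgue
  measure on matrices. The given \<kappa> is compared with it afterwards, by disintegrating \<kappa>
  itself: it sits on the single orbit det = 1. On degenerate pairs averaging over the whole group is
  useless, because the stabilizer of a vector is not compact. The triangular matrices act simply
  transitively off the horizontal axis, but they are not unimodular, which accounts for the factor 1
  / x_2^2 in the weight there. Measurability is assumed for transforms of functions on the plane;
  for functions of pairs it has to be derived, from rectangles, on which the transform is a product.
  The measure \<eta> comes out without mass at infinity: a pair on that slope has first vector 0,
  and 0 is not a holonomy vector.\<close>

no_notation fps_nth (infixl \<open>$\<close> 75)

section \<open>Haar measure on the special linear group\<close>

lemma vector2_eq: "(vector [a, b] :: 'a::zero^2) = (\<chi> i. if i = 1 then a else b)"
  by (simp add: vec_eq_iff forall_2)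

lemma continuous_on_vector2 [continuous_intros]:
  fixes f g :: "'c::topological_space \<Rightarrow> 'a::{real_normed_vector}"
  assumes "continuous_on S f" "continuous_on S g"
  shows "continuous_on S (\<lambda>x. vector [f x, g x] :: 'a^2)"
  unfolding vector2_eq
proof (intro continuous_on_vec_lambda)
  show "continuous_on S (\<lambda>x. if i = 1 then f x else g x)" for i :: 2
    using assms by (cases "i = 1") simp_all
qed

lemma measurable_vector2 [measurable]:
  fixes f g :: "'c \<Rightarrow> 'a::{real_normed_vector, second_countable_topology}"
  assumes [measurable]: "f \<in> borel_measurable M" "g \<in> borel_measurable M"
  shows "(\<lambda>x. vector [f x, g x] :: 'a^2) \<in> borel_measurable M"
proof -
  have "(\<lambda>p. vector [fst p, snd p] :: 'a^2) \<in> borel_measurable borel"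
    by (intro borel_measurable_continuous_onI continuous_intros)
  from measurable_compose[OF borel_measurable_Pair[OF assms] this] show ?thesis by simp
qed

lemma measurable_vec_nth [measurable (raw)]:
  fixes f :: "'c \<Rightarrow> 'a::{real_normed_vector, second_countable_topology}^'n"
  assumes "f \<in> borel_measurable M"
  shows "(\<lambda>x. f x $ i) \<in> borel_measurable M"
  by (rule measurable_compose[OF assms]) (intro borel_measurable_continuous_onI continuous_intros)

text \<open>Boxes determine Lebesgue measure, and a box of \<open>real^2\<close> is a product of
  intervals. This makes the plane accessible to integration one coordinate at a time.\<close>

lemma lborel_real2:
  "(lborel :: (real^2) measure) = distr (lborel \<Otimes>\<^sub>M lborel) borel (\<lambda>p. vector [fst p, snd p])"
proof (rule lborel_eqI)
  fix l u :: "real^2" assume lu: "\<And>b. b \<in> Basis \<Longrightarrow> l \<bullet> b \<le> u \<bullet> b"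
  have le: "l $ i \<le> u $ i" for i
    using lu[of "axis i 1"] by (simp add: cart_eq_inner_axis axis_in_Basis_iff)
  have "(\<lambda>p. vector [fst p, snd p] :: real^2) -` box l u \<inter> space (lborel \<Otimes>\<^sub>M lborel)
      = {l $ 1 <..< u $ 1} \<times> {l $ 2 <..< u $ 2}"
    by (auto simp: mem_box_cart forall_2 space_pair_measure)
  moreover have "(\<Prod>b\<in>Basis. (u - l) \<bullet> b) = (u $ 1 - l $ 1) * (u $ 2 - l $ 2)"
  proof -
    have B: "(Basis :: (real^2) set) = (\<lambda>i. axis i 1) ` UNIV"
      by (auto simp: Basis_vec_def)
    show ?thesis
      unfolding B by (subst prod.reindex)
        (auto simp: inj_on_def axis_eq_axis UNIV_2 cart_eq_inner_axis[symmetric])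
  qed
  ultimately show "emeasure (distr (lborel \<Otimes>\<^sub>M lborel) borel (\<lambda>p. vector [fst p, snd p])) (box l u)
      = (\<Prod>b\<in>Basis. (u - l) \<bullet> b)"
    using le by (subst emeasure_distr)
      (auto simp: lborel.emeasure_pair_measure_Times ennreal_mult)
qed simp

lemma nn_integral_lborel_real2:
  fixes f :: "real^2 \<Rightarrow> ennreal"
  assumes [measurable]: "f \<in> borel_measurable borel"
  shows "(\<integral>\<^sup>+x. f x \<partial>lborel) = (\<integral>\<^sup>+a. \<integral>\<^sup>+b. f (vector [a, b]) \<partial>lborel \<partial>lborel)"
    and "(\<integral>\<^sup>+x. f x \<partial>lborel) = (\<integral>\<^sup>+b. \<integral>\<^sup>+a. f (vector [a, b]) \<partial>lborel \<partial>lborel)"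
proof -
  have 1: "(\<integral>\<^sup>+x. f x \<partial>lborel) = (\<integral>\<^sup>+p. f (vector [fst p, snd p]) \<partial>(lborel \<Otimes>\<^sub>M lborel))"
    by (subst lborel_real2) (simp add: nn_integral_distr)
  show 2: "(\<integral>\<^sup>+x. f x \<partial>lborel) = (\<integral>\<^sup>+a. \<integral>\<^sup>+b. f (vector [a, b]) \<partial>lborel \<partial>lborel)"
    unfolding 1 by (subst lborel.nn_integral_fst[symmetric]) auto
  show "(\<integral>\<^sup>+x. f x \<partial>lborel) = (\<integral>\<^sup>+b. \<integral>\<^sup>+a. f (vector [a, b]) \<partial>lborel \<partial>lborel)"
    unfolding 2 by (rule lborel_pair.Fubini') simp
qed

lemma measurable_matrix_vector_mult [measurable]:
  fixes A :: "'c \<Rightarrow> real^'n^'m"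
  assumes "A \<in> borel_measurable M" "x \<in> borel_measurable M"
  shows "(\<lambda>w. A w *v x w) \<in> borel_measurable M"
proof -
  have "continuous_on UNIV (\<lambda>p. (fst p :: real^'n^'m) *v snd p)"
    unfolding matrix_vector_mult_def
    by (intro continuous_on_vec_lambda continuous_intros)
  from measurable_compose[OF borel_measurable_Pair[OF assms] borel_measurable_continuous_onI[OF this]]
  show ?thesis by simp
qed

lemma measurable_matrix_matrix_mult [measurable]:
  fixes A :: "'c \<Rightarrow> real^'n^'m" and B :: "'c \<Rightarrow> real^'k^'n"
  assumes "A \<in> borel_measurable M" "B \<in> borel_measurable M"
  shows "(\<lambda>w. A w ** B w) \<in> borel_measurable M"
proof -
  have "continuous_on UNIV (\<lambda>p. (fst p :: real^'n^'m) ** (snd p :: real^'k^'n))"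
    unfolding matrix_matrix_mult_def
    by (intro continuous_on_vec_lambda continuous_intros)
  from measurable_compose[OF borel_measurable_Pair[OF assms] borel_measurable_continuous_onI[OF this]]
  show ?thesis by simp
qed

text \<open>The preimage of a box under A is its image under the inverse B, and a linear image
  changes volume by the factor |det B| = 1.\<close>

lemma lborel_distr_det1:
  fixes A :: "real^2^2"
  assumes "det A = 1"
  shows "distr lborel borel ((*v) A) = lborel"
proof (rule lborel_eqI[symmetric])
  fix l u :: "real^2" assume lu: "\<And>b. b \<in> Basis \<Longrightarrow> l \<bullet> b \<le> u \<bullet> b"
  obtain B where B: "A ** B = mat 1" "B ** A = mat 1"
    using assms invertible_det_nz[of A] by (auto simp: invertible_def)
  have dB: "det B = 1" using det_mul[of A B] assms B by simp
  have eq: "(*v) A -` box l u = (*v) B ` box l u"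
  proof (intro Set.set_eqI iffI)
    fix x assume "x \<in> (*v) A -` box l u"
    then show "x \<in> (*v) B ` box l u"
      by (intro image_eqI[of _ _ "A *v x"]) (auto simp: matrix_vector_mul_assoc B)
  qed (auto simp: matrix_vector_mul_assoc B)
  have "measure lebesgue ((*v) B ` box l u) = measure lebesgue (box l u)"
    and m: "(*v) B ` box l u \<in> lmeasurable"
    using measure_linear_image[of "(*v) B" "box l u"] dB
      measurable_linear_image[of "(*v) B" "box l u"] by auto
  moreover have b: "(*v) B ` box l u \<in> sets borel"
    unfolding eq[symmetric] by (rule measurable_sets_borel[OF _ borel_open]) auto
  \<comment> \<open>\<open>measure_linear_image\<close> concerns real-valued measure on Lebesgue
    sets; finite measure together with Borel measurability carries it over to
    \<open>lborel\<close>.\<close>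
  moreover have "emeasure lborel S = ennreal (measure lebesgue S)"
    if "S \<in> lmeasurable" "S \<in> sets borel" for S :: "(real^2) set"
    using emeasure_eq_measure2[OF that(1)] that(2) by simp
  ultimately have "emeasure lborel ((*v) B ` box l u) = emeasure lborel (box l u)"
    by simp
  moreover have "emeasure (distr lborel borel ((*v) A)) (box l u) = emeasure lborel ((*v) B ` box l u)"
    by (subst emeasure_distr) (auto simp: eq)
  ultimately show "emeasure (distr lborel borel ((*v) A)) (box l u) = (\<Prod>b\<in>Basis. (u - l) \<bullet> b)"
    using lu by simp
qed simp

lemma mat_mult_2x2:
  "(vector [vector [a, b], vector [c, d]] :: real^2^2) ** (vector [vector [a', b'], vector [c', d']] :: real^2^2)
    = vector [vector [a * a' + b * c', a * b' + b * d'], vector [c * a' + d * c', c * b' + d * d']]"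
  by (simp add: vec_eq_iff forall_2 matrix_matrix_mult_def sum_2)

lemma measurable_det2 [measurable]:
  fixes f :: "'c \<Rightarrow> real^2^2"
  assumes [measurable]: "f \<in> borel_measurable M"
  shows "(\<lambda>x. det (f x)) \<in> borel_measurable M"
  unfolding det_2 by measurable

lemma measurable_transpose [measurable]:
  fixes f :: "'c \<Rightarrow> real^2^2"
  assumes [measurable]: "f \<in> borel_measurable M"
  shows "(\<lambda>x. transpose (f x)) \<in> borel_measurable M"
proof -
  have "transpose X = vector [vector [X $ 1 $ 1, X $ 2 $ 1], vector [X $ 1 $ 2, X $ 2 $ 2]]" for X :: "real^2^2"
    by (simp add: vec_eq_iff forall_2 transpose_def)
  then show ?thesis by simp
qed

text \<open>The adjugate is the inverse where det = 1. Being polynomial in the entries, it is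
  measurable on all matrices, and it reverses products without any condition on the
  determinant.\<close>

definition adj2 :: "real^2^2 \<Rightarrow> real^2^2" where
  "adj2 A = vector [vector [A $ 2 $ 2, - A $ 1 $ 2], vector [- A $ 2 $ 1, A $ 1 $ 1]]"

lemma measurable_adj2 [measurable]: "f \<in> borel_measurable M \<Longrightarrow> (\<lambda>x. adj2 (f x)) \<in> borel_measurable M"
  unfolding adj2_def by measurable

lemma adj2_mult:
  assumes "det A = 1"
  shows "A ** adj2 A = mat 1" "adj2 A ** A = mat 1"
  using assms by (simp_all add: vec_eq_iff forall_2 adj2_def matrix_matrix_mult_def sum_2 det_2 mat_def algebra_simps)

lemma det_adj2: "det (adj2 A) = det A"
  by (simp add: adj2_def det_2 algebra_simps)

lemma adj2_matrix_mult: "adj2 (A ** B) = adj2 B ** adj2 A"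
  by (simp add: vec_eq_iff forall_2 adj2_def matrix_matrix_mult_def sum_2 algebra_simps)

section \<open>Lebesgue measure on matrices\<close>

definition lborel_mat :: "(real^2^2) measure" where
  "lborel_mat = distr (lborel \<Otimes>\<^sub>M lborel) borel (\<lambda>(x, y). transpose (vector [x, y]))"

lemma sets_lborel_mat [simp, measurable_cong]: "sets lborel_mat = sets borel"
  and space_lborel_mat [simp]: "space lborel_mat = UNIV"
  by (simp_all add: lborel_mat_def)

lemma nn_integral_lborel_mat_columns:
  assumes [measurable]: "f \<in> borel_measurable borel"
  shows "(\<integral>\<^sup>+X. f X \<partial>lborel_mat) = (\<integral>\<^sup>+x. \<integral>\<^sup>+y. f (transpose (vector [x, y])) \<partial>lborel \<partial>lborel)"
  unfolding lborel_mat_def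
  by (subst nn_integral_distr) (auto simp: case_prod_beta lborel.nn_integral_fst[symmetric])

text \<open>Exchanging the two middle coordinates turns integration by columns into integration by
  rows. Left multiplication acts on each column and right multiplication on each row, so the two
  forms yield the two invariances.\<close>

lemma nn_integral_lborel_mat_rows:
  assumes f [measurable]: "f \<in> borel_measurable borel"
  shows "(\<integral>\<^sup>+X. f X \<partial>lborel_mat) = (\<integral>\<^sup>+x. \<integral>\<^sup>+y. f (vector [x, y]) \<partial>lborel \<partial>lborel)"
proof -
  have tr: "transpose (vector [vector [a, c], vector [b, d]]) = (vector [vector [a, b], vector [c, d]] :: real^2^2)" for a b c d
    by (simp add: vec_eq_iff forall_2 transpose_def)
  have "(\<integral>\<^sup>+X. f X \<partial>lborel_mat) = (\<integral>\<^sup>+a. \<integral>\<^sup>+c. \<integral>\<^sup>+b. \<integral>\<^sup>+d. f (vector [vector [a, b], vector [c, d]]) \<partial>lborel \<partial>lborel \<partial>lborel \<partial>lborel)"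
    by (simp add: nn_integral_lborel_mat_columns nn_integral_lborel_real2(1) tr)
  also have "\<dots> = (\<integral>\<^sup>+a. \<integral>\<^sup>+b. \<integral>\<^sup>+c. \<integral>\<^sup>+d. f (vector [vector [a, b], vector [c, d]]) \<partial>lborel \<partial>lborel \<partial>lborel \<partial>lborel)"
    by (intro nn_integral_cong lborel_pair.Fubini') measurable
  also have "\<dots> = (\<integral>\<^sup>+x. \<integral>\<^sup>+y. f (vector [x, y]) \<partial>lborel \<partial>lborel)"
    by (simp add: nn_integral_lborel_real2(1))
  finally show ?thesis .
qed

lemma nn_integral_lborel_det1:
  fixes A :: "real^2^2"
  assumes "det A = 1" and [measurable]: "f \<in> borel_measurable borel"
  shows "(\<integral>\<^sup>+x. f (A *v x) \<partial>lborel) = (\<integral>\<^sup>+x. f x \<partial>lborel)"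
  using nn_integral_distr[of "(*v) A" lborel borel f] by (simp add: lborel_distr_det1[OF assms(1)])

lemma nn_integral_lborel_mat_left:
  assumes A: "det A = 1" and [measurable]: "f \<in> borel_measurable borel"
  shows "(\<integral>\<^sup>+X. f (A ** X) \<partial>lborel_mat) = (\<integral>\<^sup>+X. f X \<partial>lborel_mat)"
proof -
  have eq: "A ** transpose (vector [x, y] :: real^2^2) = transpose (vector [A *v x, A *v y])" for x y
    by (simp add: vec_eq_iff forall_2 matrix_matrix_mult_def matrix_vector_mult_def transpose_def sum_2)
  show ?thesis
    by (simp add: nn_integral_lborel_mat_columns eq nn_integral_lborel_det1[OF A, of "\<lambda>y. f (transpose (vector [_, y]))"]
       nn_integral_lborel_det1[OF A, of "\<lambda>x. \<integral>\<^sup>+y. f (transpose (vector [x, y])) \<partial>lborel"])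
qed

lemma nn_integral_lborel_mat_right:
  assumes A: "det A = 1" and [measurable]: "f \<in> borel_measurable borel"
  shows "(\<integral>\<^sup>+X. f (X ** A) \<partial>lborel_mat) = (\<integral>\<^sup>+X. f X \<partial>lborel_mat)"
proof -
  let ?B = "transpose A"
  have B: "det ?B = 1" using A by simp
  have eq: "(vector [x, y] :: real^2^2) ** A = vector [?B *v x, ?B *v y]" for x y
    by (simp add: vec_eq_iff forall_2 matrix_matrix_mult_def matrix_vector_mult_def transpose_def sum_2 mult.commute)
  show ?thesis
    by (simp add: nn_integral_lborel_mat_rows eq del: transpose_matrix_vector) (simp del: transpose_matrix_vector add: nn_integral_lborel_det1[OF B, of "\<lambda>y. f (vector [_, y])"]
       nn_integral_lborel_det1[OF B, of "\<lambda>x. \<integral>\<^sup>+y. f (vector [x, y]) \<partial>lborel"])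
qed

text \<open>
  The Haar measure of \<open>A \<subseteq> SL2\<close> is the Lebesgue measure of the cone \<open>{r A | 0 < r < 1}\<close>.
\<close>

definition cone_haar :: "(real^2^2) measure" where
  "cone_haar = distr (density lborel_mat (indicator {X. 0 < det X \<and> det X < 1})) borel
     (\<lambda>X. (1 / sqrt (det X)) *\<^sub>R X)"

lemma sets_cone_haar [simp, measurable_cong]: "sets cone_haar = sets borel"
  and space_cone_haar [simp]: "space cone_haar = UNIV"
  by (simp_all add: cone_haar_def)

lemma nn_integral_cone_haar:
  assumes [measurable]: "f \<in> borel_measurable borel"
  shows "(\<integral>\<^sup>+A. f A \<partial>cone_haar) =
    (\<integral>\<^sup>+X. indicator {X. 0 < det X \<and> det X < 1} X * f ((1 / sqrt (det X)) *\<^sub>R X) \<partial>lborel_mat)"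
  unfolding cone_haar_def by (simp add: nn_integral_distr nn_integral_density)

lemma scaleR_matrix_mult: "(c *\<^sub>R X) ** (A :: real^2^2) = c *\<^sub>R (X ** A)"
  by (simp add: vec_eq_iff forall_2 matrix_matrix_mult_def sum_2 algebra_simps)

lemma matrix_mult_scaleR: "(X :: real^2^2) ** (c *\<^sub>R A) = c *\<^sub>R (X ** A)"
  by (simp add: vec_eq_iff forall_2 matrix_matrix_mult_def sum_2 algebra_simps)

text \<open>Multiplication by A keeps det X, hence the cone and the factor 1 / sqrt(det X) as well;
  only the invariance of Lebesgue measure remains. The same works on the right, which shows the
  group to be unimodular.\<close>

lemma nn_integral_cone_haar_left:
  assumes A: "det A = 1" and [measurable]: "f \<in> borel_measurable borel"
  shows "(\<integral>\<^sup>+X. f (A ** X) \<partial>cone_haar) = (\<integral>\<^sup>+X. f X \<partial>cone_haar)"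
proof -
  let ?g = "\<lambda>X. indicator {X. 0 < det X \<and> det X < 1} X * f ((1 / sqrt (det X)) *\<^sub>R X)"
  have "(\<integral>\<^sup>+X. f (A ** X) \<partial>cone_haar) = (\<integral>\<^sup>+X. ?g (A ** X) \<partial>lborel_mat)"
    by (simp add: nn_integral_cone_haar det_mul A matrix_mult_scaleR indicator_def)
  then show ?thesis
    by (simp add: nn_integral_lborel_mat_left[OF A, of ?g] nn_integral_cone_haar)
qed

lemma nn_integral_cone_haar_right:
  assumes A: "det A = 1" and [measurable]: "f \<in> borel_measurable borel"
  shows "(\<integral>\<^sup>+X. f (X ** A) \<partial>cone_haar) = (\<integral>\<^sup>+X. f X \<partial>cone_haar)"
proof -
  let ?g = "\<lambda>X. indicator {X. 0 < det X \<and> det X < 1} X * f ((1 / sqrt (det X)) *\<^sub>R X)"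
  have "(\<integral>\<^sup>+X. f (X ** A) \<partial>cone_haar) = (\<integral>\<^sup>+X. ?g (X ** A) \<partial>lborel_mat)"
    by (simp add: nn_integral_cone_haar det_mul A scaleR_matrix_mult indicator_def)
  then show ?thesis
    by (simp add: nn_integral_lborel_mat_right[OF A, of ?g] nn_integral_cone_haar)
qed

lemma AE_cone_haar: "AE A in cone_haar. det A = 1"
proof -
  have d: "det (c *\<^sub>R X) = c^2 * det X" for c and X :: "real^2^2"
    by (simp add: det_2 algebra_simps power2_eq_square)
  have "(\<integral>\<^sup>+A. indicator {A. det A \<noteq> 1} A \<partial>cone_haar) = (\<integral>\<^sup>+X. 0 \<partial>lborel_mat)"
    by (subst nn_integral_cone_haar)
      (auto intro!: nn_integral_cong simp: indicator_def d power_divide simp del: nn_integral_0_iff nn_integral_const mult_eq_0_iff)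
  then show ?thesis
    by (intro AE_I[of _ _ "{A. det A \<noteq> 1}"]) auto
qed

text \<open>For 0 < det X < 1 the rescaling to determinant 1 lengthens X. So the cone over a ball
  stays inside that ball, where both rows lie in a disc of finite area.\<close>

lemma emeasure_cone_haar_cball: "emeasure cone_haar (cball 0 r) < \<infinity>"
proof -
  let ?S = "{x :: real^2. norm x \<le> \<bar>r\<bar>}"
  have fin: "emeasure lborel ?S < \<infinity>"
    using emeasure_lborel_cball_finite[of "0::real^2" "\<bar>r\<bar>"] by (simp add: cball_def)
  have [measurable]: "?S \<in> sets borel" by measurable
  have [measurable]: "cball (0 :: real^2^2) r \<in> sets borel" by simp
  have "emeasure cone_haar (cball 0 r) = (\<integral>\<^sup>+A. indicator (cball 0 r) A \<partial>cone_haar)"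
    by simp
  also have "\<dots> = (\<integral>\<^sup>+X. indicator {X. 0 < det X \<and> det X < 1} X * indicator (cball 0 r) ((1 / sqrt (det X)) *\<^sub>R X) \<partial>lborel_mat)"
    by (rule nn_integral_cone_haar) measurable
  also have "\<dots> \<le> (\<integral>\<^sup>+X. indicator ?S (X $ 1) * indicator ?S (X $ 2) \<partial>lborel_mat)"
  proof (intro nn_integral_mono)
    fix X :: "real^2^2"
    show "indicator {X. 0 < det X \<and> det X < 1} X * indicator (cball 0 r) ((1 / sqrt (det X)) *\<^sub>R X)
       \<le> (indicator ?S (X $ 1) * indicator ?S (X $ 2) :: ennreal)"
    proof (cases "0 < det X \<and> det X < 1 \<and> norm X / sqrt (det X) \<le> r")
      case True
      have "norm X = sqrt (det X) * (norm X / sqrt (det X))" using True by simp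
      also have "\<dots> \<le> 1 * r"
        by (intro mult_mono) (use True in \<open>auto intro: order_trans[of 0 "norm X / sqrt (det X)"]\<close>)
      finally have "norm X \<le> \<bar>r\<bar>" by simp
      then show ?thesis
        using Finite_Cartesian_Product.norm_nth_le[of X 1] Finite_Cartesian_Product.norm_nth_le[of X 2] True by (auto simp: indicator_def)
    qed (auto simp: indicator_def)
  qed
  also have "\<dots> = (\<integral>\<^sup>+x. \<integral>\<^sup>+y. indicator ?S x * indicator ?S y \<partial>lborel \<partial>lborel)"
    by (subst nn_integral_lborel_mat_rows) auto
  also have "\<dots> = emeasure lborel ?S * emeasure lborel ?S"
    by (simp add: nn_integral_cmult nn_integral_multc)
  also have "\<dots> < \<infinity>" using fin by (simp add: ennreal_mult_less_top)
  finally show ?thesis .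
qed

lemma sigma_finite_measure_cballI:
  fixes M :: "'a::euclidean_space measure"
  assumes sets: "sets M = sets borel" and fin: "\<And>r. emeasure M (cball 0 r) < \<infinity>"
  shows "sigma_finite_measure M"
proof
  show "\<exists>A. countable A \<and> A \<subseteq> sets M \<and> \<Union> A = space M \<and> (\<forall>a\<in>A. emeasure M a \<noteq> \<infinity>)"
  proof (intro exI conjI)
    show "\<Union> (range (\<lambda>n. cball (0 :: 'a) (real n))) = space M"
      using real_arch_simple sets_eq_imp_space_eq[OF sets] by auto
  qed (use fin sets in \<open>auto simp: less_top\<close>)
qed

lemma sigma_finite_cone_haar: "sigma_finite_measure cone_haar"
  using emeasure_cone_haar_cball by (intro sigma_finite_measure_cballI) simp_all

text \<open>With diagonal entries in (3/4, 1) and off-diagonal entries in (0, 1/2), the product of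
  the former lies in [9/16, 1] and that of the latter in (0, 1/4]. Hence 0 < det < 1 on a nonempty
  open box, which has positive volume.\<close>

lemma cone_haar_nonzero: "emeasure cone_haar UNIV \<noteq> 0"
proof
  let ?S = "box (vector [vector [3/4, 0], vector [0, 3/4]]) (vector [vector [1, 1/2], vector [1/2, 1]]) :: (real^2^2) set"
  let ?S1 = "box (vector [3/4, 0]) (vector [1, 1/2]) :: (real^2) set"
  let ?S2 = "box (vector [0, 3/4]) (vector [1/2, 1]) :: (real^2) set"
  assume "emeasure cone_haar UNIV = 0"
  then have "(\<integral>\<^sup>+A. 1 \<partial>cone_haar) = 0" by simp
  then have 0: "(\<integral>\<^sup>+X. indicator {X. 0 < det X \<and> det X < 1} X * 1 \<partial>lborel_mat) = 0"
    by (subst (asm) nn_integral_cone_haar) auto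
  have "emeasure lborel ?S1 * emeasure lborel ?S2 = (\<integral>\<^sup>+x. \<integral>\<^sup>+y. indicator ?S1 x * indicator ?S2 y \<partial>lborel \<partial>lborel)"
    by (simp add: nn_integral_cmult nn_integral_multc)
  also have "\<dots> = (\<integral>\<^sup>+X. indicator ?S1 (X $ 1) * indicator ?S2 (X $ 2) \<partial>lborel_mat)"
    by (subst nn_integral_lborel_mat_rows) auto
  also have "\<dots> \<le> (\<integral>\<^sup>+X. indicator {X. 0 < det X \<and> det X < 1} X * 1 \<partial>lborel_mat)"
  proof (intro nn_integral_mono)
    fix X :: "real^2^2"
    have "0 < det X \<and> det X < 1" if "X $ 1 \<in> ?S1" "X $ 2 \<in> ?S2"
    proof -
      have e: "3/4 < X$1$1" "X$1$1 < 1" "0 < X$1$2" "X$1$2 < 1/2" "0 < X$2$1" "X$2$1 < 1/2" "3/4 < X$2$2" "X$2$2 < 1"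
        using that by (auto simp: mem_box_cart forall_2)
      have "X$1$2 * X$2$1 \<le> 1/2 * (1/2)" "0 < X$1$2 * X$2$1"
        using e by (intro mult_mono; simp) (use e in simp)
      moreover have "3/4 * (3/4) \<le> X$1$1 * X$2$2" "X$1$1 * X$2$2 \<le> 1 * 1"
        using e by (intro mult_mono; simp)+
      ultimately show ?thesis by (simp add: det_2)
    qed
    then show "indicator ?S1 (X $ 1) * indicator ?S2 (X $ 2) \<le> (indicator {X. 0 < det X \<and> det X < 1} X * 1 :: ennreal)"
      by (auto simp: indicator_def)
  qed
  finally have "emeasure lborel ?S1 * emeasure lborel ?S2 = 0" using 0 by simp
  moreover have "emeasure lborel ?S1 \<noteq> 0" "emeasure lborel ?S2 \<noteq> 0"
  proof -
    have "?S1 \<noteq> {}" "?S2 \<noteq> {}"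
      by (auto simp: box_ne_empty Basis_vec_def inner_axis forall_2)
    then show "emeasure lborel ?S1 \<noteq> 0" "emeasure lborel ?S2 \<noteq> 0"
      using open_not_negligible[of ?S1] open_not_negligible[of ?S2]
      by (auto simp: negligible_iff_emeasure0)
  qed
  ultimately show False by simp
qed

text \<open>Balls exhaust the space, so one of them has positive measure; its measure is finite, and
  dividing its indicator by it gives integral 1. This is the function g of the averaging
  argument.\<close>

lemma cone_haar_weight:
  obtains g :: "real^2^2 \<Rightarrow> ennreal" where "g \<in> borel_measurable borel" "(\<integral>\<^sup>+A. g A \<partial>cone_haar) = 1"
proof -
  have "\<exists>n. emeasure cone_haar (cball 0 (real n)) \<noteq> 0"
  proof (rule ccontr)
    assume *: "\<not> ?thesis"
    have "emeasure cone_haar (\<Union>n. cball 0 (real n)) \<le> suminf (\<lambda>n. emeasure cone_haar (cball 0 (real n)))"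
      by (rule emeasure_subadditive_countably) auto
    also have "\<dots> = 0" using * by simp
    also have "(\<Union>n. cball (0 :: real^2^2) (real n)) = UNIV"
      using real_arch_simple by auto
    finally show False using cone_haar_nonzero by simp
  qed
  then obtain n where n: "emeasure cone_haar (cball 0 (real n)) \<noteq> 0" by blast
  let ?c = "emeasure cone_haar (cball 0 (real n))"
  have [measurable]: "cball (0 :: real^2^2) (real n) \<in> sets borel" by simp
  have "(\<integral>\<^sup>+A. indicator (cball 0 (real n)) A / ?c \<partial>cone_haar) = ?c / ?c"
    by (subst nn_integral_divide) auto
  also have "\<dots> = 1"
    using n emeasure_cone_haar_cball[of "real n"] by (intro ennreal_divide_self) (auto simp: less_top)
  finally show ?thesis by (intro that[of "\<lambda>A. indicator (cball 0 (real n)) A / ?c"]) auto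
qed

section \<open>Matrices of nonzero determinant\<close>

definition diag1 :: "real \<Rightarrow> real^2^2" where
  "diag1 t = vector [vector [t, 0], vector [0, 1]]"

lemma measurable_diag1 [measurable]: "f \<in> borel_measurable M \<Longrightarrow> (\<lambda>x. diag1 (f x)) \<in> borel_measurable M"
  unfolding diag1_def by measurable

lemma det_diag1 [simp]: "det (diag1 t) = t"
  by (simp add: diag1_def det_2)

lemma diag1_mult_diag1: "t \<noteq> 0 \<Longrightarrow> X ** diag1 (1 / t) ** diag1 t = X"
  by (simp add: diag1_def matrix_mul_assoc[symmetric] mat_mult_2x2)
     (simp add: vec_eq_iff forall_2 matrix_matrix_mult_def sum_2)

text \<open>The orbits are the level sets of det, with X = a(X) diag1(det X), where
  \<open>diag1 t\<close> scales the first column by t. Three invariances are used in turn: that of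
  the Haar measure on the left, to shift g; that of M, to move X along its orbit; that of the Haar
  measure on the right, to remove a(X). The measure \<nu> is the image under det of M weighted by
  g(a(X)^-1).\<close>

lemma det_nonzero_disintegration:
  fixes M :: "(real^2^2) measure"
  assumes sets_M [measurable_cong, simp]: "sets M = sets borel" and "sigma_finite_measure M"
    and inv: "\<And>A f. det A = 1 \<Longrightarrow> f \<in> borel_measurable borel \<Longrightarrow> (\<integral>\<^sup>+X. f (A ** X) \<partial>M) = (\<integral>\<^sup>+X. f X \<partial>M)"
  shows "\<exists>\<nu> :: real measure. sets \<nu> = sets borel \<and> (AE t in \<nu>. t \<noteq> 0) \<and>
    (\<forall>f \<in> borel_measurable borel.
      (\<integral>\<^sup>+X. f X * indicator {X. det X \<noteq> 0} X \<partial>M) = (\<integral>\<^sup>+t. \<integral>\<^sup>+A. f (A ** diag1 t) \<partial>cone_haar \<partial>\<nu>))"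
proof -
  obtain g :: "real^2^2 \<Rightarrow> ennreal" where g [measurable]: "g \<in> borel_measurable borel"
    and g1: "(\<integral>\<^sup>+A. g A \<partial>cone_haar) = 1" by (rule cone_haar_weight)
  interpret H: sigma_finite_measure cone_haar by (rule sigma_finite_cone_haar)
  interpret M: sigma_finite_measure M by fact
  interpret MH: pair_sigma_finite M cone_haar ..
  define D :: "real^2^2 \<Rightarrow> ennreal" where "D = indicator {X. det X \<noteq> 0}"
  have D [measurable]: "D \<in> borel_measurable borel" unfolding D_def by measurable
  define a where "a X = X ** diag1 (1 / det X)" for X :: "real^2^2"
  have a [measurable]: "a \<in> borel_measurable borel" unfolding a_def by measurable
  have det_a: "det (a X) = 1" if "det X \<noteq> 0" for X
    using that by (simp add: a_def det_mul)
  have a_mult: "a (A ** X) = A ** a X" if "det A = 1" for A X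
    using that by (simp add: a_def det_mul matrix_mul_assoc)
  \<comment> \<open>What becomes of the shifted weight under X -> A X: as a(A X) = A a(X), the
    argument a(A X)^-1 A is a(X)^-1, free of A.\<close>
  define w where "w X = D X * g (adj2 (a X))" for X
  have w [measurable]: "w \<in> borel_measurable borel" unfolding w_def by measurable
  define \<nu> where "\<nu> = distr (density M w) borel det"
  have main: "(\<integral>\<^sup>+X. f X * D X \<partial>M) = (\<integral>\<^sup>+t. \<integral>\<^sup>+A. f (A ** diag1 t) \<partial>cone_haar \<partial>\<nu>)"
    if f [measurable]: "f \<in> borel_measurable borel" for f
  proof -
    have "(\<integral>\<^sup>+X. f X * D X \<partial>M) = (\<integral>\<^sup>+X. f X * D X * (\<integral>\<^sup>+A. g A \<partial>cone_haar) \<partial>M)"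
      by (simp add: g1)
    \<comment> \<open>Left invariance shifts the argument of g by a(X)^-1. Where det X = 0 the
      matrix a(X) is meaningless, and D makes both sides 0.\<close>
    also have "\<dots> = (\<integral>\<^sup>+X. f X * D X * (\<integral>\<^sup>+A. g (adj2 (a X) ** A) \<partial>cone_haar) \<partial>M)"
    proof (intro nn_integral_cong)
      fix X
      show "f X * D X * (\<integral>\<^sup>+A. g A \<partial>cone_haar) = f X * D X * (\<integral>\<^sup>+A. g (adj2 (a X) ** A) \<partial>cone_haar)"
        by (cases "det X = 0") (simp_all add: D_def nn_integral_cone_haar_left[of "adj2 (a X)" g] det_adj2 det_a)
    qed
    also have "\<dots> = (\<integral>\<^sup>+X. (\<integral>\<^sup>+A. f X * D X * g (adj2 (a X) ** A) \<partial>cone_haar) \<partial>M)"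
      by (simp add: nn_integral_cmult)
    also have "\<dots> = (\<integral>\<^sup>+A. (\<integral>\<^sup>+X. f X * D X * g (adj2 (a X) ** A) \<partial>M) \<partial>cone_haar)"
      by (rule MH.Fubini'[symmetric]) measurable
    also have "\<dots> = (\<integral>\<^sup>+A. (\<integral>\<^sup>+X. f (A ** X) * w X \<partial>M) \<partial>cone_haar)"
    proof (rule nn_integral_cong_AE, use AE_cone_haar in eventually_elim)
      fix A :: "real^2^2" assume A: "det A = 1"
      have "(\<integral>\<^sup>+X. f X * D X * g (adj2 (a X) ** A) \<partial>M)
          = (\<integral>\<^sup>+X. f (A ** X) * D (A ** X) * g (adj2 (a (A ** X)) ** A) \<partial>M)"
        by (rule inv[OF A, symmetric]) measurable
      also have "\<dots> = (\<integral>\<^sup>+X. f (A ** X) * w X \<partial>M)"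
      proof (intro nn_integral_cong)
        fix X
        have "adj2 (a (A ** X)) ** A = adj2 (a X)"
          by (simp add: a_mult[OF A] adj2_matrix_mult matrix_mul_assoc[symmetric] adj2_mult[OF A])
        moreover have "D (A ** X) = D X" by (simp add: D_def det_mul A indicator_def)
        ultimately show "f (A ** X) * D (A ** X) * g (adj2 (a (A ** X)) ** A) = f (A ** X) * w X"
          by (simp add: w_def mult.assoc)
      qed
      finally show "(\<integral>\<^sup>+X. f X * D X * g (adj2 (a X) ** A) \<partial>M) = (\<integral>\<^sup>+X. f (A ** X) * w X \<partial>M)" .
    qed
    also have "\<dots> = (\<integral>\<^sup>+X. (\<integral>\<^sup>+A. f (A ** X) * w X \<partial>cone_haar) \<partial>M)"
      by (rule MH.Fubini') measurable
    also have "\<dots> = (\<integral>\<^sup>+X. w X * (\<integral>\<^sup>+A. f (A ** diag1 (det X)) \<partial>cone_haar) \<partial>M)"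
    proof (intro nn_integral_cong)
      fix X
      show "(\<integral>\<^sup>+A. f (A ** X) * w X \<partial>cone_haar) = w X * (\<integral>\<^sup>+A. f (A ** diag1 (det X)) \<partial>cone_haar)"
      proof (cases "det X = 0")
        \<comment> \<open>Right invariance absorbs a(X), so that the inner integral depends on X
          through det X alone.\<close>
        case False
        have "(\<integral>\<^sup>+A. f (A ** diag1 (det X)) \<partial>cone_haar) = (\<integral>\<^sup>+A. f ((A ** a X) ** diag1 (det X)) \<partial>cone_haar)"
          by (rule nn_integral_cone_haar_right[OF det_a[OF False], symmetric]) measurable
        also have "\<dots> = (\<integral>\<^sup>+A. f (A ** X) \<partial>cone_haar)"
          using diag1_mult_diag1[OF False, of X] by (simp add: a_def matrix_mul_assoc[symmetric])
        finally show ?thesis by (subst nn_integral_multc) (simp_all add: mult.commute)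
      qed (simp add: w_def D_def)
    qed
    also have "\<dots> = (\<integral>\<^sup>+t. \<integral>\<^sup>+A. f (A ** diag1 t) \<partial>cone_haar \<partial>\<nu>)"
      unfolding \<nu>_def by (subst nn_integral_distr) (auto simp: nn_integral_density)
    finally show ?thesis .
  qed
  have "sets \<nu> = sets borel" by (simp add: \<nu>_def)
  moreover have "AE t in \<nu>. t \<noteq> 0"
    unfolding \<nu>_def by (subst AE_distr_iff) (auto simp: AE_density w_def D_def)
  ultimately show ?thesis
    using main unfolding D_def by blast
qed

text \<open>Uniqueness of Haar measure is a special case of the disintegration: K sits on the single
  orbit det = 1, so only the mass c of \<nu> at the point 1 contributes.\<close>

lemma SL2_invariant_measure_unique:
  fixes K :: "(real^2^2) measure"
  assumes sets_K [measurable_cong, simp]: "sets K = sets borel" and "AE A in K. det A = 1"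
    and fin: "\<And>r. emeasure K (cball 0 r) < \<infinity>" and "emeasure K UNIV \<noteq> 0"
    and inv: "\<And>A f. det A = 1 \<Longrightarrow> f \<in> borel_measurable borel \<Longrightarrow> (\<integral>\<^sup>+X. f (A ** X) \<partial>K) = (\<integral>\<^sup>+X. f X \<partial>K)"
  obtains c where "0 < c" "c < \<infinity>"
    "\<And>f. f \<in> borel_measurable borel \<Longrightarrow> (\<integral>\<^sup>+A. f A \<partial>K) = c * (\<integral>\<^sup>+A. f A \<partial>cone_haar)"
proof -
  have U: "(\<Union>n. cball (0 :: real^2^2) (real n)) = UNIV"
    using real_arch_simple by auto
  have sp: "space K = UNIV" using sets_eq_imp_space_eq[OF sets_K] by simp
  have sf: "sigma_finite_measure K" by (rule sigma_finite_measure_cballI[OF sets_K fin])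
  obtain \<nu> where s\<nu> [measurable_cong, simp]: "sets \<nu> = sets borel"
    and \<nu>: "\<forall>f \<in> borel_measurable borel.
      (\<integral>\<^sup>+X. f X * indicator {X. det X \<noteq> 0} X \<partial>K) = (\<integral>\<^sup>+t. \<integral>\<^sup>+A. f (A ** diag1 t) \<partial>cone_haar \<partial>\<nu>)"
    using det_nonzero_disintegration[OF sets_K sf inv] by blast
  define c where "c = emeasure \<nu> {1}"
  have one: "A ** diag1 1 = A" for A
    by (simp add: diag1_def vec_eq_iff forall_2 matrix_matrix_mult_def sum_2)
  have eq: "(\<integral>\<^sup>+A. f A \<partial>K) = c * (\<integral>\<^sup>+A. f A \<partial>cone_haar)"
    if f [measurable]: "f \<in> borel_measurable borel" for f
  proof -
    let ?f = "\<lambda>X. f X * indicator {X. det X = 1} X"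
    have "(\<integral>\<^sup>+A. f A \<partial>K) = (\<integral>\<^sup>+X. ?f X * indicator {X. det X \<noteq> 0} X \<partial>K)"
      by (rule nn_integral_cong_AE, use assms(2) in eventually_elim) auto
    also have "\<dots> = (\<integral>\<^sup>+t. \<integral>\<^sup>+A. ?f (A ** diag1 t) \<partial>cone_haar \<partial>\<nu>)"
      by (rule \<nu>[rule_format]) measurable
    \<comment> \<open>Almost every A satisfies det(A diag1 t) = t, so the restriction to det = 1
      leaves t = 1 only.\<close>
    also have "\<dots> = (\<integral>\<^sup>+t. (\<integral>\<^sup>+A. f A \<partial>cone_haar) * indicator {1} t \<partial>\<nu>)"
    proof (intro nn_integral_cong)
      fix t
      have "(\<integral>\<^sup>+A. ?f (A ** diag1 t) \<partial>cone_haar) = (\<integral>\<^sup>+A. f (A ** diag1 t) * indicator {1} t \<partial>cone_haar)"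
        by (rule nn_integral_cong_AE, use AE_cone_haar in eventually_elim) (simp add: det_mul indicator_def)
      also have "\<dots> = (\<integral>\<^sup>+A. f A \<partial>cone_haar) * indicator {1} t"
        by (cases "t = 1") (simp_all add: one)
      finally show "(\<integral>\<^sup>+A. ?f (A ** diag1 t) \<partial>cone_haar) = (\<integral>\<^sup>+A. f A \<partial>cone_haar) * indicator {1} t" .
    qed
    also have "\<dots> = c * (\<integral>\<^sup>+A. f A \<partial>cone_haar)"
      unfolding c_def by (subst nn_integral_cmult) (auto simp: mult.commute)
    finally show ?thesis .
  qed
  show ?thesis
  proof (rule that)
    show "0 < c"
    proof (rule ccontr)
      assume "\<not> 0 < c"
      then have "emeasure K UNIV = 0" using eq[of "\<lambda>_. 1"] by (simp add: sp)
      with assms(4) show False by simp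
    qed
    show "c < \<infinity>"
    proof (rule ccontr)
      assume c: "\<not> c < \<infinity>"
      \<comment> \<open>An infinite c would force the cone measure to vanish on every ball, since K
        is finite there, and hence altogether.\<close>
      have 0: "emeasure cone_haar (cball 0 (real n)) = 0" for n
      proof -
        have [measurable]: "cball (0 :: real^2^2) (real n) \<in> sets borel" by simp
        have "emeasure K (cball 0 (real n)) = c * emeasure cone_haar (cball 0 (real n))"
          using eq[of "indicator (cball 0 (real n))"] by simp
        then show ?thesis using fin[of n] c by (auto simp: less_top[symmetric] ennreal_mult_eq_top_iff)
      qed
      have "emeasure cone_haar (\<Union>n. cball 0 (real n)) \<le> suminf (\<lambda>n. emeasure cone_haar (cball 0 (real n)))"
        by (rule emeasure_subadditive_countably) auto
      also have "\<dots> = 0" using 0 by simp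
      finally show False using cone_haar_nonzero by (simp add: U)
    qed
  qed (rule eq)
qed

section \<open>Invariant measures on pairs of vectors\<close>

lemma measurable_fst_snd_borel [measurable (raw)]:
  fixes f :: "'c \<Rightarrow> 'a::second_countable_topology \<times> 'b::second_countable_topology"
  assumes "f \<in> borel_measurable M"
  shows "(\<lambda>x. fst (f x)) \<in> borel_measurable M" "(\<lambda>x. snd (f x)) \<in> borel_measurable M"
  by (rule measurable_compose[OF assms], intro borel_measurable_continuous_onI continuous_intros)+

type_synonym vec_pair = "(real^2) \<times> (real^2)"

definition pair_det :: "vec_pair \<Rightarrow> real" where
  "pair_det p = fst p $ 1 * snd p $ 2 - fst p $ 2 * snd p $ 1"

lemma measurable_pair_det [measurable]: "pair_det \<in> borel_measurable borel"
  unfolding pair_det_def by (intro borel_measurable_continuous_onI continuous_intros)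

text \<open>For y = s x with x nonzero this quotient is s. The formula treats both coordinates
  alike, which avoids asking which coordinate of x vanishes.\<close>

definition slope :: "vec_pair \<Rightarrow> real" where
  "slope p = (fst p \<bullet> snd p) / (fst p \<bullet> fst p)"

lemma measurable_slope [measurable]: "slope \<in> borel_measurable borel"
  unfolding slope_def by measurable

lemma vec2_nonzero_iff: "(x :: real^2) \<noteq> 0 \<longleftrightarrow> x $ 1 \<noteq> 0 \<or> x $ 2 \<noteq> 0"
  by (auto simp: vec_eq_iff forall_2)

lemma inner_vec2: "(x :: real^2) \<bullet> y = x $ 1 * y $ 1 + x $ 2 * y $ 2"
  by (simp add: inner_vec_def sum_2)

lemma snd_eq_slope:
  assumes "fst p \<noteq> 0" "pair_det p = 0"
  shows "snd p = slope p *\<^sub>R fst p"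
proof -
  obtain x y where p: "p = (x, y)" by force
  have n: "x $ 1 * x $ 1 + x $ 2 * x $ 2 \<noteq> 0"
    using assms(1) inner_vec2[of x x] by (simp add: p flip: inner_vec2)
  have "x $ 1 * y $ 2 = x $ 2 * y $ 1" using assms(2) by (simp add: p pair_det_def)
  \<comment> \<open>In coordinates: the vector y (x . x) - (x . y) x is det(x, y) times the quarter
    turn of x.\<close>
  moreover have "y $ 1 * (x $ 1 * x $ 1 + x $ 2 * x $ 2) - (x $ 1 * y $ 1 + x $ 2 * y $ 2) * x $ 1
      = x $ 2 * (x $ 2 * y $ 1 - x $ 1 * y $ 2)"
    "y $ 2 * (x $ 1 * x $ 1 + x $ 2 * x $ 2) - (x $ 1 * y $ 1 + x $ 2 * y $ 2) * x $ 2
      = x $ 1 * (x $ 1 * y $ 2 - x $ 2 * y $ 1)"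
    by (simp_all add: algebra_simps)
  ultimately have "y $ 1 * (x $ 1 * x $ 1 + x $ 2 * x $ 2) = (x $ 1 * y $ 1 + x $ 2 * y $ 2) * x $ 1"
    "y $ 2 * (x $ 1 * x $ 1 + x $ 2 * x $ 2) = (x $ 1 * y $ 1 + x $ 2 * y $ 2) * x $ 2"
    by simp_all
  then show ?thesis using n
    by (simp add: p slope_def inner_vec2 vec_eq_iff forall_2 nonzero_eq_divide_eq)
qed

definition act2 :: "real^2^2 \<Rightarrow> vec_pair \<Rightarrow> vec_pair" where
  "act2 A p = (A *v fst p, A *v snd p)"

lemma measurable_act2 [measurable]:
  assumes [measurable]: "A \<in> borel_measurable M" "f \<in> borel_measurable M"
  shows "(\<lambda>x. act2 (A x) (f x)) \<in> borel_measurable M"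
  unfolding act2_def by measurable

lemma pair_det_act2: "pair_det (act2 A p) = det A * pair_det p"
  by (simp add: pair_det_def act2_def matrix_vector_mult_def sum_2 det_2 algebra_simps)

text \<open>
  The second column is \<open>u\<close> itself, so that \<open>upper u *v x\<close> sweeps out the plane when \<open>u\<close> does.
  Division by zero makes this matrix singular when \<open>u $ 2 = 0\<close>, a null set.
\<close>

definition upper :: "real^2 \<Rightarrow> real^2^2" where
  "upper u = vector [vector [1 / u $ 2, u $ 1], vector [0, u $ 2]]"

lemma measurable_upper [measurable]: "f \<in> borel_measurable M \<Longrightarrow> (\<lambda>x. upper (f x)) \<in> borel_measurable M"
  unfolding upper_def by measurable

lemma det_upper: "u $ 2 \<noteq> 0 \<Longrightarrow> det (upper u) = 1"
  by (simp add: upper_def det_2)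

lemma upper_mult_vec: "upper u *v x = vector [x $ 1 / u $ 2 + u $ 1 * x $ 2, u $ 2 * x $ 2]"
  by (simp add: vec_eq_iff forall_2 upper_def matrix_vector_mult_def sum_2)

text \<open>These matrices form a group with
  \<open>upper u ** upper x = upper (upper u *v x)\<close>. As u is the second column of
  \<open>upper u\<close>, the inverse of that matrix takes u to the second unit vector, and what
  remains is the second column of the inverse of \<open>upper x\<close>, free of u.\<close>

lemma adj2_upper_mult_upper:
  fixes u x :: "real^2"
  assumes "u $ 2 \<noteq> 0" "x $ 2 \<noteq> 0"
  shows "adj2 (upper (upper u *v x)) *v u = vector [- x $ 1, 1 / x $ 2]"
  using assms
  by (simp add: upper_mult_vec) (simp add: vec_eq_iff forall_2 upper_def adj2_def matrix_vector_mult_def sum_2 field_simps)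

text \<open>Left translation of the triangular group acts on u by a matrix of determinant 1 and
  preserves Lebesgue measure. Right translation scales each of the two coordinates by x_2, whence
  the Jacobian x_2^2.\<close>

lemma nn_integral_upper_right:
  fixes x :: "real^2"
  assumes [measurable]: "f \<in> borel_measurable borel" and x: "x $ 2 \<noteq> 0"
  shows "(\<integral>\<^sup>+u. f u \<partial>lborel) = ennreal ((x $ 2)\<^sup>2) * (\<integral>\<^sup>+u. f (upper u *v x) \<partial>lborel)"
proof -
  let ?c = "x $ 2"
  have "(\<integral>\<^sup>+u. f u \<partial>lborel) = (\<integral>\<^sup>+b. \<integral>\<^sup>+a. f (vector [a, b]) \<partial>lborel \<partial>lborel)"
    by (rule nn_integral_lborel_real2) simp
  also have "\<dots> = ennreal \<bar>?c\<bar> * (\<integral>\<^sup>+b. \<integral>\<^sup>+a. f (vector [a, 0 + ?c * b]) \<partial>lborel \<partial>lborel)"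
    by (rule nn_integral_real_affine) (use x in auto)
  \<comment> \<open>For fixed b the inner variable undergoes an affine substitution with shift x_1 /
    b; at b = 0 the shift is 0 by convention, and the substitution remains valid.\<close>
  also have "\<dots> = ennreal \<bar>?c\<bar> * (\<integral>\<^sup>+b. ennreal \<bar>?c\<bar> * (\<integral>\<^sup>+a. f (vector [x $ 1 / b + ?c * a, 0 + ?c * b]) \<partial>lborel) \<partial>lborel)"
    by (intro arg_cong2[where f = "(*)"] refl nn_integral_cong nn_integral_real_affine) (use x in auto)
  also have "\<dots> = ennreal \<bar>?c\<bar> * (ennreal \<bar>?c\<bar> * (\<integral>\<^sup>+b. \<integral>\<^sup>+a. f (upper (vector [a, b]) *v x) \<partial>lborel \<partial>lborel))"
    by (subst nn_integral_cmult) (auto simp: upper_mult_vec mult.commute)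
  also have "\<dots> = ennreal (?c\<^sup>2) * (\<integral>\<^sup>+u. f (upper u *v x) \<partial>lborel)"
    by (simp add: nn_integral_lborel_real2(2) mult.assoc[symmetric] ennreal_mult[symmetric] power2_eq_square)
  finally show ?thesis .
qed

lemma AE_lborel_real2: "AE u in lborel. (u :: real^2) $ 2 \<noteq> 0" "AE u in lborel. (u :: real^2) $ 1 + u $ 2 \<noteq> 0"
proof -
  have "(\<integral>\<^sup>+u. indicator {u :: real^2. u $ 2 = 0} u \<partial>lborel) = 0"
    by (subst nn_integral_lborel_real2(1)) (auto simp: indicator_def nn_integral_0_iff_AE intro!: AE_I2 eventually_mono[OF AE_lborel_singleton[of 0]])
  then show "AE u in lborel. (u :: real^2) $ 2 \<noteq> 0"
    by (intro AE_I[of _ _ "{u. u $ 2 = 0}"]) auto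
  have "(\<integral>\<^sup>+u. indicator {u :: real^2. u $ 1 + u $ 2 = 0} u \<partial>lborel) = (\<integral>\<^sup>+a. 0 \<partial>(lborel :: real measure))"
    unfolding nn_integral_lborel_real2(1)[of "indicator _", simplified]
  proof (subst nn_integral_lborel_real2(1), measurable, intro nn_integral_cong)
    fix a :: real
    show "(\<integral>\<^sup>+b. indicator {u :: real^2. u $ 1 + u $ 2 = 0} (vector [a, b]) \<partial>lborel) = (0 :: ennreal)"
      by (subst nn_integral_0_iff_AE) (auto simp: indicator_def intro!: eventually_mono[OF AE_lborel_singleton[of "-a"]])
  qed
  then show "AE u in lborel. (u :: real^2) $ 1 + u $ 2 \<noteq> 0"
    by (intro AE_I[of _ _ "{u. u $ 1 + u $ 2 = 0}"]) auto
qed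

text \<open>Along a degenerate orbit the pair is (x, s x) with s fixed, so the orbit is a punctured
  plane. The triangular group acts simply transitively on the part off the horizontal axis, and the
  computation for nonzero determinant is repeated with Lebesgue measure in u in place of Haar
  measure. The axis, which that group preserves, is dealt with separately.\<close>

lemma det_zero_disintegration:
  fixes m :: "vec_pair measure"
  assumes sets_m [measurable_cong, simp]: "sets m = sets borel" and "sigma_finite_measure m"
    and inv: "\<And>A f. det A = 1 \<Longrightarrow> f \<in> borel_measurable borel \<Longrightarrow> (\<integral>\<^sup>+p. f (act2 A p) \<partial>m) = (\<integral>\<^sup>+p. f p \<partial>m)"
  shows "\<exists>\<eta> :: real measure. sets \<eta> = sets borel \<and>
    (\<forall>f \<in> borel_measurable borel.
      (\<integral>\<^sup>+p. f p * indicator {p. fst p \<noteq> 0 \<and> pair_det p = 0} p \<partial>m) = (\<integral>\<^sup>+s. \<integral>\<^sup>+x. f (x, s *\<^sub>R x) \<partial>lborel \<partial>\<eta>))"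
proof -
  interpret m: sigma_finite_measure m by fact
  interpret P: pair_sigma_finite m "lborel :: (real^2) measure" ..
  define g :: "real^2 \<Rightarrow> ennreal" where "g = indicator (cbox 0 One)"
  have g [measurable]: "g \<in> borel_measurable borel" unfolding g_def by simp
  have g1: "(\<integral>\<^sup>+u. g u \<partial>lborel) = 1" unfolding g_def by simp
  define E :: "vec_pair \<Rightarrow> ennreal" where "E = indicator {p. fst p $ 2 \<noteq> 0 \<and> pair_det p = 0}"
  have E [measurable]: "E \<in> borel_measurable borel" unfolding E_def by measurable
  \<comment> \<open>The argument of g is the one left over by \<open>adj2_upper_mult_upper\<close>;
    the factor 1 / x_2^2 undoes the Jacobian of \<open>nn_integral_upper_right\<close>.\<close>
  define w where "w p = E p * (g (vector [- fst p $ 1, 1 / fst p $ 2]) * ennreal (1 / (fst p $ 2)\<^sup>2))" for p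
  have w [measurable]: "w \<in> borel_measurable borel" unfolding w_def by measurable
  define \<eta> where "\<eta> = distr (density m w) borel slope"
  have off_axis: "(\<integral>\<^sup>+p. f p * E p \<partial>m) = (\<integral>\<^sup>+s. \<integral>\<^sup>+x. f (x, s *\<^sub>R x) \<partial>lborel \<partial>\<eta>)"
    if f [measurable]: "f \<in> borel_measurable borel" for f
  proof -
    have "(\<integral>\<^sup>+p. f p * E p \<partial>m) = (\<integral>\<^sup>+p. f p * E p * (\<integral>\<^sup>+u. g u \<partial>lborel) \<partial>m)"
      by (simp add: g1)
    also have "\<dots> = (\<integral>\<^sup>+p. f p * E p * (\<integral>\<^sup>+u. g (adj2 (upper (fst p)) *v u) \<partial>lborel) \<partial>m)"
    proof (intro nn_integral_cong)
      fix p
      show "f p * E p * (\<integral>\<^sup>+u. g u \<partial>lborel) = f p * E p * (\<integral>\<^sup>+u. g (adj2 (upper (fst p)) *v u) \<partial>lborel)"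
        by (cases "fst p $ 2 = 0")
          (simp_all add: E_def nn_integral_lborel_det1[of "adj2 (upper (fst p))" g] det_adj2 det_upper)
    qed
    also have "\<dots> = (\<integral>\<^sup>+p. (\<integral>\<^sup>+u. f p * E p * g (adj2 (upper (fst p)) *v u) \<partial>lborel) \<partial>m)"
      by (simp add: nn_integral_cmult)
    also have "\<dots> = (\<integral>\<^sup>+u. (\<integral>\<^sup>+p. f p * E p * g (adj2 (upper (fst p)) *v u) \<partial>m) \<partial>lborel)"
      by (rule P.Fubini'[symmetric]) measurable
    also have "\<dots> = (\<integral>\<^sup>+u. (\<integral>\<^sup>+p. f (act2 (upper u) p) * (E p * g (vector [- fst p $ 1, 1 / fst p $ 2])) \<partial>m) \<partial>lborel)"
    proof (rule nn_integral_cong_AE, use AE_lborel_real2(1) in eventually_elim)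
      fix u :: "real^2" assume u: "u $ 2 \<noteq> 0"
      let ?F = "\<lambda>p. f p * E p * g (adj2 (upper (fst p)) *v u)"
      have "(\<integral>\<^sup>+p. ?F p \<partial>m) = (\<integral>\<^sup>+p. ?F (act2 (upper u) p) \<partial>m)"
        by (rule inv[OF det_upper[OF u], symmetric]) measurable
      also have "\<dots> = (\<integral>\<^sup>+p. f (act2 (upper u) p) * (E p * g (vector [- fst p $ 1, 1 / fst p $ 2])) \<partial>m)"
      proof (intro nn_integral_cong)
        fix p
        \<comment> \<open>A triangular matrix multiplies the second coordinate of x by a nonzero
          factor, so it moves no point onto or off the axis.\<close>
        have "E (act2 (upper u) p) = E p"
          using u by (simp add: E_def indicator_def pair_det_act2 det_upper) (simp add: act2_def upper_mult_vec)
        moreover have "g (adj2 (upper (fst (act2 (upper u) p))) *v u) = g (vector [- fst p $ 1, 1 / fst p $ 2])" if "E p \<noteq> 0"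
          using that u by (simp add: E_def act2_def adj2_upper_mult_upper indicator_def split: if_splits)
        ultimately show "?F (act2 (upper u) p) = f (act2 (upper u) p) * (E p * g (vector [- fst p $ 1, 1 / fst p $ 2]))"
          by (cases "E p = 0") (simp_all add: mult.assoc)
      qed
      finally show "(\<integral>\<^sup>+p. ?F p \<partial>m) = (\<integral>\<^sup>+p. f (act2 (upper u) p) * (E p * g (vector [- fst p $ 1, 1 / fst p $ 2])) \<partial>m)" .
    qed
    also have "\<dots> = (\<integral>\<^sup>+p. (\<integral>\<^sup>+u. f (act2 (upper u) p) * (E p * g (vector [- fst p $ 1, 1 / fst p $ 2])) \<partial>lborel) \<partial>m)"
      by (rule P.Fubini') measurable
    also have "\<dots> = (\<integral>\<^sup>+p. w p * (\<integral>\<^sup>+x. f (x, slope p *\<^sub>R x) \<partial>lborel) \<partial>m)"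
    proof (intro nn_integral_cong)
      fix p :: "vec_pair"
      show "(\<integral>\<^sup>+u. f (act2 (upper u) p) * (E p * g (vector [- fst p $ 1, 1 / fst p $ 2])) \<partial>lborel)
          = w p * (\<integral>\<^sup>+x. f (x, slope p *\<^sub>R x) \<partial>lborel)"
      proof (cases "E p = 0")
        case False
        then have p: "fst p $ 2 \<noteq> 0" "pair_det p = 0" by (auto simp: E_def indicator_def split: if_splits)
        let ?c = "(fst p $ 2)\<^sup>2"
        \<comment> \<open>The slope does not change under the action, so moving x sweeps out the
          pairs of one slope.\<close>
        have eq: "act2 (upper u) p = (upper u *v fst p, slope p *\<^sub>R (upper u *v fst p))" for u
          using snd_eq_slope[of p] p by (simp add: act2_def matrix_vector_mult_scaleR vec2_nonzero_iff)
        have "(\<integral>\<^sup>+x. f (x, slope p *\<^sub>R x) \<partial>lborel) = ennreal ?c * (\<integral>\<^sup>+u. f (act2 (upper u) p) \<partial>lborel)"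
          unfolding eq by (rule nn_integral_upper_right) (use p in auto)
        then have *: "ennreal (1 / ?c) * (\<integral>\<^sup>+x. f (x, slope p *\<^sub>R x) \<partial>lborel) = (\<integral>\<^sup>+u. f (act2 (upper u) p) \<partial>lborel)"
          using p by (simp add: mult.assoc[symmetric] ennreal_mult[symmetric])
        show ?thesis
          unfolding w_def by (subst nn_integral_multc) (auto simp: *[symmetric] mult_ac)
      qed (simp add: w_def)
    qed
    also have "\<dots> = (\<integral>\<^sup>+s. \<integral>\<^sup>+x. f (x, s *\<^sub>R x) \<partial>lborel \<partial>\<eta>)"
      unfolding \<eta>_def by (subst nn_integral_distr) (auto simp: nn_integral_density)
    finally show ?thesis .
  qed
  \<comment> \<open>The shear moves the axis to a line on which the formula just proved applies.\<close>
  have axis_null: "AE p in m. \<not> (fst p \<noteq> 0 \<and> pair_det p = 0 \<and> fst p $ 2 = 0)"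
  proof -
    let ?N = "\<lambda>p :: vec_pair. fst p \<noteq> 0 \<and> pair_det p = 0 \<and> fst p $ 2 = 0"
    let ?A = "vector [vector [1, 0], vector [1, 1]] :: real^2^2"
    have A: "det ?A = 1" by (simp add: det_2)
    have Ax: "?A *v x = vector [x $ 1, x $ 1 + x $ 2]" for x
      by (simp add: vec_eq_iff forall_2 matrix_vector_mult_def sum_2)
    have "(\<integral>\<^sup>+p. indicator {p. ?N p} p \<partial>m) = (\<integral>\<^sup>+p. indicator {p. ?N p} (act2 ?A p) \<partial>m)"
      by (rule inv[OF A, symmetric]) measurable
    also have "\<dots> \<le> (\<integral>\<^sup>+p. indicator {p :: vec_pair. fst p $ 1 + fst p $ 2 = 0} p * E p \<partial>m)"
    proof (intro nn_integral_mono)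
      fix p
      have "fst p $ 1 + fst p $ 2 = 0 \<and> fst p $ 2 \<noteq> 0 \<and> pair_det p = 0" if "?N (act2 ?A p)"
        using that by (auto simp: pair_det_act2 A) (auto simp: act2_def Ax vec2_nonzero_iff)
      then show "indicator {p. ?N p} (act2 ?A p) \<le> indicator {p :: vec_pair. fst p $ 1 + fst p $ 2 = 0} p * E p"
        by (auto simp: E_def indicator_def)
    qed
    also have "\<dots> = (\<integral>\<^sup>+s. \<integral>\<^sup>+x. indicator {p :: vec_pair. fst p $ 1 + fst p $ 2 = 0} (x, s *\<^sub>R x) \<partial>lborel \<partial>\<eta>)"
      by (rule off_axis) measurable
    \<comment> \<open>Whatever s is, the condition concerns x alone and describes a line, which is
      null in the plane.\<close>
    also have "\<dots> = (\<integral>\<^sup>+s. 0 \<partial>\<eta>)"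
    proof (intro nn_integral_cong)
      fix s
      have "(\<integral>\<^sup>+x. indicator {p :: vec_pair. fst p $ 1 + fst p $ 2 = 0} (x, s *\<^sub>R x) \<partial>lborel) = (\<integral>\<^sup>+x. 0 \<partial>(lborel :: (real^2) measure))"
        by (rule nn_integral_cong_AE, use AE_lborel_real2(2) in eventually_elim) simp
      then show "(\<integral>\<^sup>+x. indicator {p :: vec_pair. fst p $ 1 + fst p $ 2 = 0} (x, s *\<^sub>R x) \<partial>lborel) = (0::ennreal)" by simp
    qed
    finally have "emeasure m {p. ?N p} = 0" by simp
    then show ?thesis by (intro AE_I[of _ _ "{p. ?N p}"]) auto
  qed
  have main: "(\<integral>\<^sup>+p. f p * indicator {p. fst p \<noteq> 0 \<and> pair_det p = 0} p \<partial>m) = (\<integral>\<^sup>+s. \<integral>\<^sup>+x. f (x, s *\<^sub>R x) \<partial>lborel \<partial>\<eta>)"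
    if f [measurable]: "f \<in> borel_measurable borel" for f
    unfolding off_axis[OF f, symmetric]
    by (rule nn_integral_cong_AE, use axis_null in eventually_elim) (auto simp: E_def indicator_def vec2_nonzero_iff)
  have "sets \<eta> = sets borel" by (simp add: \<eta>_def)
  with main show ?thesis by blast
qed

section \<open>The given Haar measure and the decomposition by determinant\<close>

lemma sets_borel_of: "sets (borel_of X) = sigma_sets (topspace X) {U. openin X U}"
  and space_borel_of: "space (borel_of X) = topspace X"
  unfolding borel_of_def by (auto intro!: sets_measure_of space_measure_of dest: openin_subset)

lemma sets_borel_of_top_of_set:
  assumes "S \<in> sets borel"
  shows "sets (borel_of (top_of_set S)) = sets (restrict_space borel S)"
proof -
  have "sets (restrict_space borel S) = (\<inter>) S ` sigma_sets UNIV {T. open T}"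
    by (simp add: sets_restrict_space borel_def)
  also have "\<dots> = sigma_sets S ((\<inter>) S ` {T. open T})"
    by (rule sigma_sets_Int) (use assms in \<open>auto simp: borel_def\<close>)
  also have "(\<inter>) S ` {T. open T} = {U. openin (top_of_set S) U}"
    by (auto simp: openin_open)
  also have "sigma_sets S {U. openin (top_of_set S) U} = sets (borel_of (top_of_set S))"
    by (simp add: sets_borel_of)
  finally show ?thesis by simp
qed

lemma SL2_borel: "SL2 \<in> sets borel"
  unfolding SL2_def by measurable

text \<open>\<kappa> lives on the subspace \<open>SL2\<close>; its image under the inclusion is a
  measure on all matrices, to which the uniqueness of invariant measures applies.\<close>

lemma haar_SL2_eq_cone_haar:
  assumes "is_haar_SL2 \<kappa>"
  shows "\<exists>c. 0 < c \<and> c < \<infinity> \<and>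
    (\<forall>f\<in>borel_measurable borel. (\<integral>\<^sup>+A. f A \<partial>\<kappa>) = c * (\<integral>\<^sup>+A. f A \<partial>cone_haar))"
proof -
  have sets [measurable_cong]: "sets \<kappa> = sets (restrict_space borel SL2)"
    using assms sets_borel_of_top_of_set[OF SL2_borel] by (simp add: is_haar_SL2_def)
  have sp: "space \<kappa> = SL2"
    using sets_eq_imp_space_eq[OF sets] by (simp add: space_restrict_space)
  have id [measurable]: "(\<lambda>A. A) \<in> \<kappa> \<rightarrow>\<^sub>M borel"
    unfolding measurable_cong_sets[OF sets refl] by (rule measurable_restrict_space1) simp
  define K where "K = distr \<kappa> borel (\<lambda>A. A)"
  have K: "(\<integral>\<^sup>+A. f A \<partial>K) = (\<integral>\<^sup>+A. f A \<partial>\<kappa>)" if "f \<in> borel_measurable borel" for f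
    using that unfolding K_def by (simp add: nn_integral_distr)
  have "sets K = sets borel" by (simp add: K_def)
  moreover have "AE A in K. det A = 1"
    unfolding K_def by (subst AE_distr_iff) (auto simp: sp SL2_def)
  moreover have "emeasure K (cball 0 r) < \<infinity>" for r
  proof -
    \<comment> \<open>Compactness of the bounded closed parts of \<open>SL2\<close> turns finiteness
      of \<kappa> on compact sets into finiteness on balls.\<close>
    have "closed SL2"
      unfolding SL2_def det_2 by (intro closed_Collect_eq continuous_intros)
    then have "compact (cball 0 r \<inter> SL2)" by (simp add: compact_Int_closed)
    then have "emeasure \<kappa> (cball 0 r \<inter> SL2) < \<infinity>"
      using assms by (simp add: is_haar_SL2_def)
    then show ?thesis unfolding K_def by (subst emeasure_distr) (auto simp: sp)
  qed
  moreover have "emeasure K UNIV \<noteq> 0"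
    using assms unfolding K_def by (subst emeasure_distr) (auto simp: sp is_haar_SL2_def)
  moreover have "(\<integral>\<^sup>+X. f (A ** X) \<partial>K) = (\<integral>\<^sup>+X. f X \<partial>K)"
    if A: "det A = 1" and f [measurable]: "f \<in> borel_measurable borel" for A f
  proof -
    have m: "(**) A \<in> \<kappa> \<rightarrow>\<^sub>M \<kappa>"
      unfolding measurable_cong_sets[OF sets sets]
      by (rule measurable_restrict_space2, rule_tac [2] measurable_restrict_space1)
        (auto simp: SL2_def det_mul A space_restrict_space)
    have "(\<integral>\<^sup>+X. f X \<partial>\<kappa>) = (\<integral>\<^sup>+X. f X \<partial>distr \<kappa> \<kappa> ((**) A))"
      using assms A by (simp add: is_haar_SL2_def SL2_def)
    also have "\<dots> = (\<integral>\<^sup>+X. f (A ** X) \<partial>\<kappa>)"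
      by (rule nn_integral_distr[OF m]) simp
    finally show ?thesis by (simp add: K)
  qed
  ultimately obtain c where "0 < c" "c < \<infinity>"
    and "\<And>f. f \<in> borel_measurable borel \<Longrightarrow> (\<integral>\<^sup>+A. f A \<partial>K) = c * (\<integral>\<^sup>+A. f A \<partial>cone_haar)"
    by (rule SL2_invariant_measure_unique) blast+
  with K show ?thesis by (intro exI[of _ c]) simp
qed

lemma measurable_column [measurable (raw)]:
  fixes f :: "'c \<Rightarrow> real^2^2"
  assumes [measurable]: "f \<in> borel_measurable M"
  shows "(\<lambda>x. column i (f x)) \<in> borel_measurable M"
proof -
  have "column i A = vector [A $ 1 $ i, A $ 2 $ i]" for A :: "real^2^2"
    by (simp add: vec_eq_iff forall_2 column_def)
  then show ?thesis by simp
qed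

text \<open>Reading (x, y) as the matrix with columns x and y turns the diagonal action into left
  multiplication. The hypothesis \<open>nz\<close> leaves exactly the two cases det \<noteq> 0 and
  det = 0 with x \<noteq> 0.\<close>

lemma SL2_invariant_pair_measure_disintegration:
  fixes m :: "vec_pair measure"
  assumes sets_m [measurable_cong, simp]: "sets m = sets borel"
    and fin: "\<And>r. emeasure m (cball 0 r) < \<infinity>"
    and nz: "AE p in m. fst p \<noteq> 0"
    and inv: "\<And>A f. det A = 1 \<Longrightarrow> f \<in> borel_measurable borel \<Longrightarrow> (\<integral>\<^sup>+p. f (act2 A p) \<partial>m) = (\<integral>\<^sup>+p. f p \<partial>m)"
    and \<kappa>: "is_haar_SL2 \<kappa>"
  shows "\<exists>(\<nu> :: real measure) (\<eta> :: real measure). sets \<nu> = sets borel \<and> sets \<eta> = sets borel \<and>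
    (AE t in \<nu>. t \<noteq> 0) \<and>
    (\<forall>f \<in> borel_measurable borel. (\<integral>\<^sup>+p. f p \<partial>m) =
      (\<integral>\<^sup>+t. \<integral>\<^sup>+A. f (t *\<^sub>R column 1 A, column 2 A) \<partial>\<kappa> \<partial>\<nu>) + (\<integral>\<^sup>+s. \<integral>\<^sup>+x. f (x, s *\<^sub>R x) \<partial>lborel \<partial>\<eta>))"
proof -
  have U: "(\<Union>n. cball (0 :: vec_pair) (real n)) = UNIV"
    using real_arch_simple by auto
  have sp: "space m = UNIV" using sets_eq_imp_space_eq[OF sets_m] by simp
  have sf: "sigma_finite_measure m" by (rule sigma_finite_measure_cballI[OF sets_m fin])
  define P where "P p = transpose (vector [fst p, snd p] :: real^2^2)" for p :: "vec_pair"
  define Q where "Q X = (column 1 X, column 2 X)" for X :: "real^2^2"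
  have P [measurable]: "P \<in> borel_measurable borel" unfolding P_def by measurable
  have Q [measurable]: "Q \<in> borel_measurable borel" unfolding Q_def by measurable
  have QP: "Q (P p) = p" for p
    by (cases p) (simp add: P_def Q_def vec_eq_iff forall_2 column_def transpose_def)
  have PQ: "P (Q X) = X" for X
    by (simp add: P_def Q_def vec_eq_iff forall_2 column_def transpose_def)
  have AP: "A ** P p = P (act2 A p)" for A p
    by (simp add: P_def act2_def vec_eq_iff forall_2 matrix_matrix_mult_def matrix_vector_mult_def transpose_def sum_2)
  have det_P: "det (P p) = pair_det p" for p
    by (simp add: P_def pair_det_def transpose_def det_2)
  have Q_diag1: "Q (A ** diag1 t) = (t *\<^sub>R column 1 A, column 2 A)" for A t
    by (simp add: Q_def diag1_def vec_eq_iff forall_2 matrix_matrix_mult_def column_def sum_2)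
  have mP [measurable]: "P \<in> m \<rightarrow>\<^sub>M borel" by measurable
  define M where "M = distr m borel P"
  have sets_M: "sets M = sets borel" by (simp add: M_def)
  have M: "(\<integral>\<^sup>+X. f X \<partial>M) = (\<integral>\<^sup>+p. f (P p) \<partial>m)" if "f \<in> borel_measurable borel" for f
    using that unfolding M_def by (simp add: nn_integral_distr)
  have "sigma_finite_measure M"
  proof
    \<comment> \<open>The exhaustion of the pairs by balls of finite mass is carried over along the
      bijection P, whose inverse is Q.\<close>
    have s: "Q -` cball 0 (real n) \<in> sets borel" for n
      using measurable_sets_borel[OF Q, of "cball 0 (real n)"] by simp
    have f: "emeasure M (Q -` cball 0 (real n)) \<noteq> \<infinity>" for n
      using fin[of "real n"] s[of n] unfolding M_def
      by (subst emeasure_distr) (auto simp: vimage_def QP sp less_top cball_def)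
    show "\<exists>A. countable A \<and> A \<subseteq> sets M \<and> \<Union> A = space M \<and> (\<forall>a\<in>A. emeasure M a \<noteq> \<infinity>)"
    proof (intro exI conjI)
      show "\<Union> (range (\<lambda>n. Q -` cball 0 (real n))) = space M"
        using U unfolding vimage_UN[symmetric] by (simp add: M_def)
    qed (use s f in \<open>auto simp: sets_M\<close>)
  qed
  moreover have "(\<integral>\<^sup>+X. f (A ** X) \<partial>M) = (\<integral>\<^sup>+X. f X \<partial>M)"
    if A: "det A = 1" and f [measurable]: "f \<in> borel_measurable borel" for A f
    using inv[OF A, of "\<lambda>p. f (P p)"] by (simp add: M AP)
  ultimately obtain \<nu>0 where s\<nu>0 [measurable_cong, simp]: "sets \<nu>0 = sets borel" and nz0: "AE t in \<nu>0. t \<noteq> 0"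
    and \<nu>0: "\<forall>f \<in> borel_measurable borel.
      (\<integral>\<^sup>+X. f X * indicator {X. det X \<noteq> 0} X \<partial>M) = (\<integral>\<^sup>+t. \<integral>\<^sup>+A. f (A ** diag1 t) \<partial>cone_haar \<partial>\<nu>0)"
    using det_nonzero_disintegration[OF sets_M] by blast
  obtain \<eta> where s\<eta>: "sets \<eta> = sets borel"
    and \<eta>: "\<forall>f \<in> borel_measurable borel.
      (\<integral>\<^sup>+p. f p * indicator {p. fst p \<noteq> 0 \<and> pair_det p = 0} p \<partial>m) = (\<integral>\<^sup>+s. \<integral>\<^sup>+x. f (x, s *\<^sub>R x) \<partial>lborel \<partial>\<eta>)"
    using det_zero_disintegration[OF sets_m sf inv] by blast
  obtain c where c: "0 < c" "c < \<infinity>"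
    and \<kappa>c: "\<forall>f\<in>borel_measurable borel. (\<integral>\<^sup>+A. f A \<partial>\<kappa>) = c * (\<integral>\<^sup>+A. f A \<partial>cone_haar)"
    using haar_SL2_eq_cone_haar[OF \<kappa>] by blast
  interpret H: sigma_finite_measure cone_haar by (rule sigma_finite_cone_haar)
  \<comment> \<open>\<kappa> is c times the cone measure, so the measure on the line is divided by
    c; this is exact because 0 < c < \<infinity>.\<close>
  define \<nu> where "\<nu> = density \<nu>0 (\<lambda>_. 1 / c)"
  have "(\<integral>\<^sup>+p. f p \<partial>m) =
      (\<integral>\<^sup>+t. \<integral>\<^sup>+A. f (t *\<^sub>R column 1 A, column 2 A) \<partial>\<kappa> \<partial>\<nu>) + (\<integral>\<^sup>+s. \<integral>\<^sup>+x. f (x, s *\<^sub>R x) \<partial>lborel \<partial>\<eta>)"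
    if f [measurable]: "f \<in> borel_measurable borel" for f
  proof -
    have g [measurable]: "(\<lambda>A :: real^2^2. f (t *\<^sub>R column 1 A, column 2 A)) \<in> borel_measurable borel" for t
      by measurable
    have g2 [measurable]: "(\<lambda>t. \<integral>\<^sup>+A. f (t *\<^sub>R column 1 A, column 2 A) \<partial>cone_haar) \<in> borel_measurable borel"
      by measurable
    have "(\<integral>\<^sup>+p. f p \<partial>m) = (\<integral>\<^sup>+p. f p * indicator {p. pair_det p \<noteq> 0} p + f p * indicator {p. fst p \<noteq> 0 \<and> pair_det p = 0} p \<partial>m)"
      by (rule nn_integral_cong_AE, use nz in eventually_elim) (auto simp: indicator_def)
    also have "\<dots> = (\<integral>\<^sup>+p. f p * indicator {p. pair_det p \<noteq> 0} p \<partial>m) + (\<integral>\<^sup>+p. f p * indicator {p. fst p \<noteq> 0 \<and> pair_det p = 0} p \<partial>m)"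
      by (rule nn_integral_add) measurable
    also have "(\<integral>\<^sup>+p. f p * indicator {p. fst p \<noteq> 0 \<and> pair_det p = 0} p \<partial>m) = (\<integral>\<^sup>+s. \<integral>\<^sup>+x. f (x, s *\<^sub>R x) \<partial>lborel \<partial>\<eta>)"
      by (rule \<eta>[rule_format]) (rule f)
    also have "(\<integral>\<^sup>+p. f p * indicator {p. pair_det p \<noteq> 0} p \<partial>m) = (\<integral>\<^sup>+X. f (Q X) * indicator {X. det X \<noteq> 0} X \<partial>M)"
      by (subst M) (auto simp: QP det_P indicator_def)
    also have "\<dots> = (\<integral>\<^sup>+t. \<integral>\<^sup>+A. f (Q (A ** diag1 t)) \<partial>cone_haar \<partial>\<nu>0)"
      by (rule \<nu>0[rule_format]) measurable
    also have "\<dots> = (\<integral>\<^sup>+t. (1 / c) * (c * \<integral>\<^sup>+A. f (t *\<^sub>R column 1 A, column 2 A) \<partial>cone_haar) \<partial>\<nu>0)"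
      using c by (simp add: Q_diag1 mult.assoc[symmetric] ennreal_divide_times less_top[symmetric])
    also have "\<dots> = (\<integral>\<^sup>+t. \<integral>\<^sup>+A. f (t *\<^sub>R column 1 A, column 2 A) \<partial>\<kappa> \<partial>\<nu>)"
      unfolding \<nu>_def by (subst nn_integral_density) (auto simp: \<kappa>c)
    finally show ?thesis .
  qed
  moreover have "sets \<nu> = sets borel" by (simp add: \<nu>_def)
  moreover have "AE t in \<nu>. t \<noteq> 0" unfolding \<nu>_def by (subst AE_density) (use nz0 in auto)
  ultimately show ?thesis using s\<eta> by blast
qed

section \<open>The second moment measure of the Siegel--Veech transform\<close>

lemma Bc_D:
  fixes f :: "'a::euclidean_space \<Rightarrow> real"
  assumes "f \<in> B\<^sub>c"
  shows "\<exists>b r. (\<forall>x. \<bar>f x\<bar> \<le> b) \<and> (\<forall>x. f x \<noteq> 0 \<longrightarrow> norm x \<le> r) \<and> 0 \<le> b \<and> 0 \<le> r \<and> f \<in> borel_measurable borel"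
proof -
  obtain b where b: "\<And>x. \<bar>f x\<bar> \<le> b"
    using assms by (auto simp: B\<^sub>c_def bounded_iff)
  have "bounded {x. f x \<noteq> 0}"
    using assms by (auto simp: B\<^sub>c_def intro: bounded_subset[OF compact_imp_bounded closure_subset])
  then obtain r where r: "\<And>x. f x \<noteq> 0 \<Longrightarrow> norm x \<le> r" "0 < r"
    by (auto simp: bounded_pos)
  have "0 \<le> b" using b[of undefined] by linarith
  with b r show ?thesis using assms by (intro exI[of _ b] exI[of _ r]) (auto simp: B\<^sub>c_def)
qed

lemma Bc_I:
  fixes f :: "'a::euclidean_space \<Rightarrow> real"
  assumes "f \<in> borel_measurable borel" "\<And>x. \<bar>f x\<bar> \<le> b" "\<And>x. f x \<noteq> 0 \<Longrightarrow> norm x \<le> r"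
  shows "f \<in> B\<^sub>c"
proof -
  have "closure {x. f x \<noteq> 0} \<subseteq> cball 0 r"
    using assms(3) by (intro closure_minimal) auto
  then have "bounded {x. f x \<noteq> 0}"
    by (meson bounded_cball bounded_subset closure_subset)
  then show ?thesis using assms by (auto simp: B\<^sub>c_def bounded_iff)
qed

lemma indicator_Bc:
  fixes a :: "'a::euclidean_space set"
  assumes "a \<in> sets borel" "a \<subseteq> cball 0 r"
  shows "indicator a \<in> B\<^sub>c"
  by (rule Bc_I[of _ 1 r]) (use assms in \<open>auto simp: indicator_def split: if_splits\<close>)

lemma infsum_indicator_finite:
  assumes "finite (S \<inter> a)"
  shows "infsum (indicator a :: _ \<Rightarrow> real) S = card (S \<inter> a)"
proof -
  have "infsum (indicator a :: _ \<Rightarrow> real) S = infsum (indicator a) (S \<inter> a)"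
    by (rule infsum_cong_neutral) auto
  then show ?thesis using assms by simp
qed

text \<open>The geometry is reduced to properties of \<open>L\<close>, so the statement is about
  random discrete sets, with m their second moment measure. The main point is measurability of the
  integrand that defines m: the hypothesis \<open>sv\<close> speaks of functions of one
  vector.\<close>

lemma siegel_veech_pair_measure:
  fixes lam :: "'w measure" and L :: "'w \<Rightarrow> (real^2) set" and T :: "real^2^2 \<Rightarrow> 'w \<Rightarrow> 'w"
  assumes fin: "\<And>\<omega> r. \<omega> \<in> space lam \<Longrightarrow> finite (L \<omega> \<inter> cball 0 r)"
    and nz: "\<And>\<omega>. \<omega> \<in> space lam \<Longrightarrow> 0 \<notin> L \<omega>"
    and T: "\<And>A. det A = 1 \<Longrightarrow> T A \<in> lam \<rightarrow>\<^sub>M lam" "\<And>A. det A = 1 \<Longrightarrow> distr lam lam (T A) = lam"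
    and equiv: "\<And>A \<omega>. det A = 1 \<Longrightarrow> \<omega> \<in> space lam \<Longrightarrow> L (T A \<omega>) = (*v) A ` L \<omega>"
    and sv: "\<And>f. f \<in> B\<^sub>c \<Longrightarrow> (\<lambda>\<omega>. infsum f (L \<omega>)) \<in> borel_measurable lam"
      "\<And>f. f \<in> B\<^sub>c \<Longrightarrow> integrable lam (\<lambda>\<omega>. (infsum f (L \<omega>))\<^sup>2)"
  shows "\<exists>m :: vec_pair measure. sets m = sets borel \<and> (\<forall>r. emeasure m (cball 0 r) < \<infinity>) \<and>
    (AE p in m. fst p \<noteq> 0) \<and>
    (\<forall>A. det A = 1 \<longrightarrow> (\<forall>f\<in>borel_measurable borel. (\<integral>\<^sup>+p. f (act2 A p) \<partial>m) = (\<integral>\<^sup>+p. f p \<partial>m))) \<and>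
    (\<forall>f\<in>borel_measurable borel. (\<lambda>\<omega>. \<integral>\<^sup>+p. f p \<partial>count_space (L \<omega> \<times> L \<omega>)) \<in> borel_measurable lam \<and>
      (\<integral>\<^sup>+p. f p \<partial>m) = (\<integral>\<^sup>+\<omega>. \<integral>\<^sup>+p. f p \<partial>count_space (L \<omega> \<times> L \<omega>) \<partial>lam))"
proof -
  define I where "I f \<omega> = (\<integral>\<^sup>+p. f p \<partial>count_space (L \<omega> \<times> L \<omega>))" for f :: "vec_pair \<Rightarrow> ennreal" and \<omega>
  \<comment> \<open>On a bounded rectangle the count of pairs is a product of two transforms, which
    is where the hypothesis on functions of one vector enters.\<close>
  have I_rect: "I (indicator (a \<times> b)) \<omega> = ennreal (infsum (indicator a) (L \<omega>) * infsum (indicator b) (L \<omega>))"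
    if "a \<subseteq> cball 0 r" "b \<subseteq> cball 0 r" "\<omega> \<in> space lam" for a b r \<omega>
  proof -
    have f: "finite (L \<omega> \<inter> a)" "finite (L \<omega> \<inter> b)"
      using fin[OF that(3), of r] that(1,2) by (meson finite_subset Int_mono order_refl)+
    have "I (indicator (a \<times> b)) \<omega> = (\<integral>\<^sup>+p. indicator ((L \<omega> \<inter> a) \<times> (L \<omega> \<inter> b)) p \<partial>count_space (L \<omega> \<times> L \<omega>))"
      unfolding I_def by (rule nn_integral_cong) (auto simp: indicator_def)
    also have "\<dots> = emeasure (count_space (L \<omega> \<times> L \<omega>)) ((L \<omega> \<inter> a) \<times> (L \<omega> \<inter> b))"
      by (rule nn_integral_indicator) auto
    also have "\<dots> = of_nat (card ((L \<omega> \<inter> a) \<times> (L \<omega> \<inter> b)))"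
      using f by (subst emeasure_count_space_finite) auto
    finally show ?thesis
      using f by (simp add: infsum_indicator_finite card_cartesian_product ennreal_of_nat_eq_real_of_nat)
  qed
  define Q where "Q r = cball (0::real^2) r \<times> cball (0::real^2) r" for r :: real
  have Q [measurable]: "Q r \<in> sets borel" for r
    unfolding Q_def by (intro borel_closed closed_Times) auto
  have I_Q_fin: "I (indicator (Q r)) \<omega> < \<infinity>" if "\<omega> \<in> space lam" for r \<omega>
    using I_rect[OF order_refl order_refl that, of r] by (simp add: Q_def)
  have I_mono: "I f \<omega> \<le> I f' \<omega>" if "\<And>p. f p \<le> f' p" for f f' \<omega>
    unfolding I_def by (rule nn_integral_mono) (rule that)
  have sv_meas: "(\<lambda>\<omega>. infsum (indicator (a \<inter> cball 0 r)) (L \<omega>) :: real) \<in> borel_measurable lam"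
    if "a \<in> sets borel" for a r
    using that by (intro sv(1) indicator_Bc[of _ r]) auto
  have rect_meas: "I (indicator ((a \<inter> cball 0 r) \<times> (b \<inter> cball 0 r))) \<in> borel_measurable lam"
    if ab: "a \<in> sets borel" "b \<in> sets borel" for a b r
  proof -
    let ?a = "a \<inter> cball 0 r" and ?b = "b \<inter> cball 0 r"
    note sv_meas[OF ab(1), of r, measurable] sv_meas[OF ab(2), of r, measurable]
    have "(\<lambda>\<omega>. ennreal (infsum (indicator ?a) (L \<omega>) * infsum (indicator ?b) (L \<omega>))) \<in> borel_measurable lam"
      by measurable
    then show ?thesis
      by (rule measurable_cong[THEN iffD1, rotated]) (rule I_rect[symmetric, of _ r], auto)
  qed
  \<comment> \<open>A Dynkin argument that starts from rectangles. Cutting with the bounded set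
    \<open>Q r\<close> keeps all counts finite, so that passing to complements is a genuine
    subtraction.\<close>
  have meas_bounded: "I (indicator (E \<inter> Q r)) \<in> borel_measurable lam" if "E \<in> sets borel" for E r
  proof -
    let ?G = "{a \<times> b | a b. a \<in> sets (borel :: (real^2) measure) \<and> b \<in> sets (borel :: (real^2) measure)}"
    have "?G \<subseteq> Pow UNIV" by simp
    moreover have "E \<in> sigma_sets UNIV ?G"
      using that unfolding borel_prod[symmetric] sets_pair_measure by simp
    ultimately show ?thesis
    proof (induction rule: sigma_sets_induct_disjoint[OF Int_stable_pair_measure_generator, consumes 2, case_names basic empty compl union])
      case (basic E)
      then obtain a b where E: "E = a \<times> b" and ab: "a \<in> sets borel" "b \<in> sets borel" by auto
      have "E \<inter> Q r = (a \<inter> cball 0 r) \<times> (b \<inter> cball 0 r)" by (auto simp: E Q_def)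
      then show ?case using rect_meas[OF ab] by simp
    next
      case empty
      then show ?case by (simp add: I_def)
    next
      case (compl E)
      have [measurable]: "I (indicator (Q r)) \<in> borel_measurable lam"
        using rect_meas[of UNIV UNIV r] by (simp add: Q_def)
      note compl(2)[measurable]
      have "(\<lambda>\<omega>. I (indicator (Q r)) \<omega> - I (indicator (E \<inter> Q r)) \<omega>) \<in> borel_measurable lam"
        by measurable
      moreover have "I (indicator ((UNIV - E) \<inter> Q r)) \<omega> = I (indicator (Q r)) \<omega> - I (indicator (E \<inter> Q r)) \<omega>"
        if "\<omega> \<in> space lam" for \<omega>
      proof -
        have "I (indicator (E \<inter> Q r)) \<omega> \<le> I (indicator (Q r)) \<omega>"
          by (rule I_mono) (auto simp: indicator_def)
        moreover have "I (indicator (Q r)) \<omega> < \<infinity>" by (rule I_Q_fin[OF that])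
        moreover have "I (indicator (Q r)) \<omega> = I (indicator ((UNIV - E) \<inter> Q r)) \<omega> + I (indicator (E \<inter> Q r)) \<omega>"
          unfolding I_def by (subst nn_integral_add[symmetric]) (auto intro!: nn_integral_cong simp: indicator_def)
        ultimately show ?thesis by (auto simp: less_top[symmetric] ennreal_add_diff_cancel_right)
      qed
      ultimately show ?case
        using measurable_cong[of lam "I (indicator ((UNIV - E) \<inter> Q r))"] by simp
    next
      case (union A)
      note union(3)[measurable]
      have "(\<lambda>\<omega>. suminf (\<lambda>i. I (indicator (A i \<inter> Q r)) \<omega>)) \<in> borel_measurable lam"
        using union(3) by measurable
      moreover have "I (indicator (\<Union>(range A) \<inter> Q r)) \<omega> = suminf (\<lambda>i. I (indicator (A i \<inter> Q r)) \<omega>)" for \<omega>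
      proof -
        have "disjoint_family (\<lambda>i. A i \<inter> Q r)"
          using union(1) by (auto simp: disjoint_family_on_def)
        from suminf_indicator[OF this]
        have "indicator (\<Union>(range A) \<inter> Q r) p = suminf (\<lambda>i. indicator (A i \<inter> Q r) p :: ennreal)" for p
          by (simp add: Int_UN_distrib2)
        then show ?thesis
          unfolding I_def by (subst nn_integral_suminf[symmetric]) (auto intro!: nn_integral_cong)
      qed
      ultimately show ?case by simp
    qed
  qed
  \<comment> \<open>The sets \<open>Q n\<close> increase to the whole space, so monotone convergence
    removes the cut.\<close>
  have meas_set: "I (indicator E) \<in> borel_measurable lam" if "E \<in> sets borel" for E
  proof -
    have "I (indicator E) \<omega> = (SUP n. I (indicator (E \<inter> Q (real n))) \<omega>)" for \<omega>
    proof -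
      have "indicator E p = (SUP n. indicator (E \<inter> Q (real n)) p :: ennreal)" for p
      proof (rule antisym)
        obtain n where "norm (fst p) \<le> real n" "norm (snd p) \<le> real n"
          using real_arch_simple[of "max (norm (fst p)) (norm (snd p))"] by auto
        then have "p \<in> Q (real n)" by (auto simp: Q_def mem_Times_iff)
        then show "indicator E p \<le> (SUP n. indicator (E \<inter> Q (real n)) p :: ennreal)"
          by (intro SUP_upper2[of n]) (auto simp: indicator_def)
      qed (auto intro!: SUP_least simp: indicator_def)
      then have "I (indicator E) \<omega> = (\<integral>\<^sup>+p. (SUP n. indicator (E \<inter> Q (real n)) p) \<partial>count_space (L \<omega> \<times> L \<omega>))"
        by (simp add: I_def)
      also have "\<dots> = (SUP n. \<integral>\<^sup>+p. indicator (E \<inter> Q (real n)) p \<partial>count_space (L \<omega> \<times> L \<omega>))"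
      proof (rule nn_integral_monotone_convergence_SUP)
        show "incseq (\<lambda>n p. indicator (E \<inter> Q (real n)) p :: ennreal)"
          by (auto simp: incseq_def le_fun_def indicator_def Q_def)
      qed auto
      finally show ?thesis by (simp add: I_def)
    qed
    then have eq: "I (indicator E) = (\<lambda>\<omega>. SUP n. I (indicator (E \<inter> Q (real n))) \<omega>)" by auto
    show ?thesis unfolding eq using meas_bounded[OF that] by (intro borel_measurable_SUP) auto
  qed
  have I_SUP: "I (SUP i. U i) = (\<lambda>\<omega>. SUP i. I (U i) \<omega>)" if "incseq U" for U :: "nat \<Rightarrow> _"
  proof
    fix \<omega>
    have "I (SUP i. U i) \<omega> = (\<integral>\<^sup>+p. (SUP i. U i p) \<partial>count_space (L \<omega> \<times> L \<omega>))"
      unfolding I_def by (simp add: SUP_apply[abs_def])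
    also have "\<dots> = (SUP i. I (U i) \<omega>)"
      unfolding I_def using that by (intro nn_integral_monotone_convergence_SUP) auto
    finally show "I (SUP i. U i) \<omega> = (SUP i. I (U i) \<omega>)" .
  qed
  have meas: "I f \<in> borel_measurable lam" if "f \<in> borel_measurable borel" for f
    using that
  proof (induction rule: borel_measurable_induct)
    case (cong f g)
    then have "f = g" by auto
    with cong show ?case by simp
  next
    case (set A)
    then show ?case by (simp add: meas_set)
  next
    case (mult u c)
    have "I (\<lambda>x. c * u x) = (\<lambda>\<omega>. c * I u \<omega>)" by (auto simp: I_def nn_integral_cmult)
    with mult show ?case by simp
  next
    case (add u v)
    have "I (\<lambda>x. v x + u x) = (\<lambda>\<omega>. I v \<omega> + I u \<omega>)" by (auto simp: I_def nn_integral_add)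
    with add show ?case by simp
  next
    case (seq U)
    then show ?case unfolding I_SUP[OF seq(3)] by (intro borel_measurable_SUP) auto
  qed
  define m where "m = measure_of UNIV (sets borel) (\<lambda>E. \<integral>\<^sup>+\<omega>. I (indicator E) \<omega> \<partial>lam)"
  have sets_m [measurable_cong, simp]: "sets m = sets borel"
    unfolding m_def using sets.sets_measure_of_eq[of borel] by simp
  have em: "emeasure m E = (\<integral>\<^sup>+\<omega>. I (indicator E) \<omega> \<partial>lam)" if "E \<in> sets borel" for E
  proof (rule emeasure_measure_of[OF m_def])
    show "positive (sets m) (\<lambda>E. \<integral>\<^sup>+\<omega>. I (indicator E) \<omega> \<partial>lam)"
      by (simp add: positive_def I_def)
    show "countably_additive (sets m) (\<lambda>E. \<integral>\<^sup>+\<omega>. I (indicator E) \<omega> \<partial>lam)"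
    proof (rule countably_additiveI)
      fix A :: "nat \<Rightarrow> _" assume A: "range A \<subseteq> sets m" "disjoint_family A"
      have "I (indicator (\<Union>(range A))) \<omega> = suminf (\<lambda>i. I (indicator (A i)) \<omega>)" for \<omega>
        unfolding I_def
        by (subst nn_integral_suminf[symmetric]) (auto intro!: nn_integral_cong simp: suminf_indicator[OF A(2)])
      then show "suminf (\<lambda>i. \<integral>\<^sup>+\<omega>. I (indicator (A i)) \<omega> \<partial>lam) = (\<integral>\<^sup>+\<omega>. I (indicator (\<Union>(range A))) \<omega> \<partial>lam)"
        using A meas_set by (subst nn_integral_suminf[symmetric]) (auto intro!: nn_integral_cong)
    qed
  qed (use that in auto)
  have int: "(\<integral>\<^sup>+p. f p \<partial>m) = (\<integral>\<^sup>+\<omega>. I f \<omega> \<partial>lam)" if "f \<in> borel_measurable borel" for f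
    using that
  proof (induction rule: borel_measurable_induct)
    case (cong f g)
    then have "f = g" by auto
    with cong show ?case by simp
  next
    case (set A)
    then show ?case by (simp add: em)
  next
    case (mult u c)
    have "I (\<lambda>x. c * u x) = (\<lambda>\<omega>. c * I u \<omega>)" by (auto simp: I_def nn_integral_cmult)
    with mult meas[of u] show ?case by (simp add: nn_integral_cmult)
  next
    case (add u v)
    have "I (\<lambda>x. v x + u x) = (\<lambda>\<omega>. I v \<omega> + I u \<omega>)" by (auto simp: I_def nn_integral_add)
    with add meas[of u] meas[of v] show ?case by (simp add: nn_integral_add)
  next
    case (seq U)
    have "incseq (\<lambda>i. I (U i))"
      using seq(3) by (auto simp: incseq_def le_fun_def intro: I_mono)
    then have "(\<integral>\<^sup>+\<omega>. I (SUP i. U i) \<omega> \<partial>lam) = (SUP i. \<integral>\<^sup>+\<omega>. I (U i) \<omega> \<partial>lam)"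
      unfolding I_SUP[OF seq(3)] using seq(1) meas by (intro nn_integral_monotone_convergence_SUP) auto
    also have "\<dots> = (SUP i. \<integral>\<^sup>+p. U i p \<partial>m)" using seq.IH by simp
    also have "\<dots> = (\<integral>\<^sup>+p. (SUP i. U i p) \<partial>m)"
      using seq(1,3) by (intro nn_integral_monotone_convergence_SUP[symmetric]) auto
    finally show ?case by (simp add: SUP_apply[abs_def])
  qed
  \<comment> \<open>A ball of pairs lies in a product of two equal balls, whose count is the square
    of a single transform; the integral of this square is finite by hypothesis.\<close>
  have bnd: "emeasure m (cball 0 r) < \<infinity>" for r
  proof -
    have "cball 0 r \<subseteq> Q r"
    proof
      fix p :: "vec_pair" assume "p \<in> cball 0 r"
      then show "p \<in> Q r"
        using norm_fst_le[of "fst p" "snd p"] norm_snd_le[of "snd p" "fst p"]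
        by (simp add: Q_def mem_Times_iff)
    qed
    then have "emeasure m (cball 0 r) \<le> emeasure m (Q r)" by (intro emeasure_mono) auto
    also have "\<dots> = (\<integral>\<^sup>+\<omega>. I (indicator (Q r)) \<omega> \<partial>lam)" by (rule em) simp
    also have "\<dots> = (\<integral>\<^sup>+\<omega>. ennreal ((infsum (indicator (cball 0 r)) (L \<omega>))\<^sup>2) \<partial>lam)"
      unfolding Q_def power2_eq_square by (intro nn_integral_cong I_rect) auto
    also have "\<dots> < \<infinity>"
      using sv(2)[OF indicator_Bc[of "cball 0 r" r]] by (auto simp: integrable_iff_bounded)
    finally show ?thesis .
  qed
  have AE_nz: "AE p in m. fst p \<noteq> 0"
  proof (rule AE_I[of _ _ "{p. fst p = 0}"])
    have c: "{p :: vec_pair. fst p = 0} \<in> sets borel"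
      by (intro borel_closed closed_Collect_eq continuous_intros)
    then show "{p. fst p = 0} \<in> sets m" by simp
    have "I (indicator {p. fst p = 0}) \<omega> = 0" if "\<omega> \<in> space lam" for \<omega>
      unfolding I_def using nz[OF that] by (subst nn_integral_0_iff_AE) (auto simp: AE_count_space indicator_def)
    then have "(\<integral>\<^sup>+\<omega>. I (indicator {p. fst p = 0}) \<omega> \<partial>lam) = (\<integral>\<^sup>+\<omega>. 0 \<partial>lam)"
      by (intro nn_integral_cong) auto
    with em[OF c] show "emeasure m {p. fst p = 0} = 0" by simp
  qed auto
  have inv: "(\<integral>\<^sup>+p. f (act2 A p) \<partial>m) = (\<integral>\<^sup>+p. f p \<partial>m)"
    if A: "det A = 1" and f [measurable]: "f \<in> borel_measurable borel" for A f
  proof -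
    have inj: "inj ((*v) A)"
      by (rule inj_on_inverseI[of _ "(*v) (adj2 A)"]) (simp add: matrix_vector_mul_assoc adj2_mult[OF A])
    \<comment> \<open>\<open>act2 A\<close> maps the pairs of \<omega> bijectively onto those of
      \<open>T A \<omega>\<close>. The linear action is thus traded for the action on \<omega>,
      which preserves \<open>lam\<close>.\<close>
    have eq: "I (\<lambda>p. f (act2 A p)) \<omega> = I f (T A \<omega>)" if "\<omega> \<in> space lam" for \<omega>
    proof -
      have "act2 A = map_prod ((*v) A) ((*v) A)" by (auto simp: act2_def)
      then have "bij_betw (act2 A) (L \<omega> \<times> L \<omega>) (L (T A \<omega>) \<times> L (T A \<omega>))"
        unfolding equiv[OF A that] bij_betw_def
        using inj by (simp add: map_prod_inj_on inj_on_subset map_prod_surj_on)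
      then show ?thesis
        unfolding I_def by (rule nn_integral_bij_count_space)
    qed
    have "(\<integral>\<^sup>+p. f (act2 A p) \<partial>m) = (\<integral>\<^sup>+\<omega>. I (\<lambda>p. f (act2 A p)) \<omega> \<partial>lam)"
      by (rule int) measurable
    also have "\<dots> = (\<integral>\<^sup>+\<omega>. I f (T A \<omega>) \<partial>lam)" by (rule nn_integral_cong) (rule eq)
    also have "\<dots> = (\<integral>\<^sup>+\<omega>. I f \<omega> \<partial>distr lam lam (T A))"
      by (rule nn_integral_distr[OF T(1)[OF A], symmetric]) (use meas[OF f] in simp)
    also have "\<dots> = (\<integral>\<^sup>+p. f p \<partial>m)" by (simp add: T(2)[OF A] int)
    finally show ?thesis .
  qed
  show ?thesis
  proof (intro exI[of _ m] conjI allI impI ballI)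
    fix f :: "vec_pair \<Rightarrow> ennreal" assume f: "f \<in> borel_measurable borel"
    show "(\<lambda>\<omega>. \<integral>\<^sup>+p. f p \<partial>count_space (L \<omega> \<times> L \<omega>)) \<in> borel_measurable lam"
      using meas[OF f] unfolding I_def[abs_def] .
    show "(\<integral>\<^sup>+p. f p \<partial>m) = (\<integral>\<^sup>+\<omega>. \<integral>\<^sup>+p. f p \<partial>count_space (L \<omega> \<times> L \<omega>) \<partial>lam)"
      using int[OF f] unfolding I_def .
  qed (fact sets_m bnd AE_nz | (rule inv; assumption))+
qed

text \<open>A finite integral makes J finite almost everywhere, so \<open>enn2real\<close> loses
  nothing. This is the passage from extended to real integrals.\<close>

lemma integrable_enn2real:
  assumes J: "J \<in> borel_measurable M" and fin: "(\<integral>\<^sup>+x. J x \<partial>M) < \<infinity>"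
  shows "integrable M (\<lambda>x. enn2real (J x))" "(LINT x|M. enn2real (J x)) = enn2real (\<integral>\<^sup>+x. J x \<partial>M)"
proof -
  note J[measurable]
  have "AE x in M. J x \<noteq> \<infinity>" using nn_integral_PInf_AE[OF J] fin by auto
  then have eq: "(\<integral>\<^sup>+x. ennreal (enn2real (J x)) \<partial>M) = (\<integral>\<^sup>+x. J x \<partial>M)"
    by (intro nn_integral_cong_AE) (auto elim!: eventually_mono simp: less_top)
  show "integrable M (\<lambda>x. enn2real (J x))"
    using fin eq by (intro integrableI_nonneg) auto
  show "(LINT x|M. enn2real (J x)) = enn2real (\<integral>\<^sup>+x. J x \<partial>M)"
    by (subst integral_eq_nn_integral) (auto simp: eq)
qed

lemma nn_integral_bounded_support:
  fixes f :: "'a \<Rightarrow> ennreal"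
  assumes "\<And>x. x \<in> space M \<Longrightarrow> f x \<le> ennreal b * indicator S x" "S \<in> sets M" "emeasure M S < \<infinity>"
  shows "(\<integral>\<^sup>+x. f x \<partial>M) < \<infinity>"
proof -
  have "(\<integral>\<^sup>+x. f x \<partial>M) \<le> (\<integral>\<^sup>+x. ennreal b * indicator S x \<partial>M)"
    by (rule nn_integral_mono) (rule assms)
  also have "\<dots> = ennreal b * emeasure M S"
    by (rule nn_integral_cmult_indicator) (rule assms)
  also have "\<dots> < \<infinity>" using assms(3) by (simp add: ennreal_mult_less_top)
  finally show ?thesis .
qed

section \<open>Borel structure of the projective line\<close>

lemma topspace_P1: "topspace P1 = UNIV"
  by (auto simp: P1_def topspace_Alexandroff_compactification UNIV_option_conv)

text \<open>An open set of the one-point compactification is an open set of reals, or the point at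
  infinity together with the complement of a closed set; in both cases its finite part is
  open.\<close>

lemma Some_measurable_P1: "Some \<in> borel \<rightarrow>\<^sub>M borel_of P1"
proof -
  have "Some -` U \<in> sets borel" if "openin P1 U" for U
  proof -
    have *: "Some -` (Some ` V) = V" "Some -` (insert None (Some ` V)) = V" for V :: "real set"
      by auto
    from that consider V where "open V" "U = Some ` V"
      | C where "closed C" "U = insert None (Some ` (UNIV - C))"
      unfolding P1_def openin_Alexandroff_compactification by auto
    then show ?thesis
    proof cases
      case 1
      then show ?thesis by (simp only: *) simp
    next
      case 2
      then show ?thesis by (simp only: *) simp
    qed
  qed
  then show ?thesis
    unfolding borel_of_def
    by (intro measurable_measure_of) (auto dest: openin_subset simp: topspace_P1)
qed

lemma Some_image_P1:
  assumes "B \<in> sets borel"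
  shows "Some ` B \<in> sets (borel_of P1)"
proof -
  have "B \<in> sigma_sets UNIV {U :: real set. open U}" using assms by (simp add: borel_def)
  then show ?thesis
  proof (induction)
    case (Basic U)
    then show ?case
      unfolding sets_borel_of P1_def
      by (intro sigma_sets.Basic) (auto simp: openin_Alexandroff_compactification)
  next
    case Empty
    then show ?case by simp
  next
    case (Compl B)
    have "range Some \<in> sets (borel_of P1)"
      unfolding sets_borel_of P1_def
      by (intro sigma_sets.Basic) (auto simp: openin_Alexandroff_compactification intro!: exI[of _ UNIV])
    moreover have "Some ` (UNIV - B) = range Some - Some ` B" by auto
    ultimately show ?case using sets.Diff[OF _ Compl.IH] by simp
  next
    case (Union B)
    then show ?case by (simp add: image_UN)
  qed
qed

text \<open>The point at infinity is a Borel set by itself, so measurability is decided on the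
  finite slopes.\<close>

lemma measurable_P1_I:
  fixes G :: "real option \<Rightarrow> real"
  assumes "(\<lambda>r. G (Some r)) \<in> borel_measurable borel"
  shows "G \<in> borel_measurable (borel_of P1)"
proof (rule measurableI)
  fix A :: "real set" assume A: "A \<in> sets borel"
  let ?B = "(\<lambda>r. G (Some r)) -` A"
  have B: "Some ` ?B \<in> sets (borel_of P1)"
    using measurable_sets_borel[OF assms A] by (rule Some_image_P1)
  have N: "{None} \<in> sets (borel_of P1)"
  proof -
    have "range Some \<in> sets (borel_of P1)" by (rule Some_image_P1) simp
    then have "space (borel_of P1) - range Some \<in> sets (borel_of P1)" by (rule sets.compl_sets)
    moreover have "space (borel_of P1) - range Some = {None :: real option}"
      by (auto simp: space_borel_of topspace_P1 UNIV_option_conv)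
    ultimately show ?thesis by simp
  qed
  have "G -` A \<inter> space (borel_of P1) = (if G None \<in> A then Some ` ?B \<union> {None} else Some ` ?B)"
  proof (rule Set.set_eqI)
    fix s
    show "s \<in> G -` A \<inter> space (borel_of P1) \<longleftrightarrow> s \<in> (if G None \<in> A then Some ` ?B \<union> {None} else Some ` ?B)"
      by (cases s) (auto simp: space_borel_of topspace_P1)
  qed
  also have "\<dots> \<in> sets (borel_of P1)" using sets.Un[OF B N] B by simp
  finally show "G -` A \<inter> space (borel_of P1) \<in> sets (borel_of P1)" .
qed auto

text \<open>A crude bound: entries are at most r, rows at most 2 r, and there are two rows. It shows
  that bounded columns confine a matrix to a ball.\<close>

lemma norm_mat2_le:
  fixes A :: "real^2^2"
  assumes "norm (column 1 A) \<le> r" "norm (column 2 A) \<le> r"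
  shows "norm A \<le> 4 * r"
proof -
  have e: "\<bar>A $ i $ j\<bar> \<le> r" for i j
  proof -
    have "\<bar>column j A $ i\<bar> \<le> norm (column j A)" by (rule component_le_norm_cart)
    then show ?thesis using assms exhaust_2[of j] by (auto simp: column_def)
  qed
  have "norm (A $ i) \<le> 2 * r" for i
    using norm_le_l1_cart[of "A $ i"] e[of i 1] e[of i 2] by (simp add: sum_2)
  moreover have "norm A \<le> norm (A $ 1) + norm (A $ 2)"
    using L2_set_le_sum[of UNIV "\<lambda>i. norm (A $ i)"] by (simp add: norm_vec_def sum_2)
  ultimately show ?thesis by (smt (verit))
qed
text \<open>Integrability comes with the identity: for nonnegative h the left side is finite because
  m is finite on balls, so both terms on the right are finite. The inner integrals have to exist at
  every t \<noteq> 0 and every s, not just at almost every one; this rests on bounded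
  support.\<close>

lemma siegel_veech2_disintegration:
  fixes lam :: "'w measure" and L :: "'w \<Rightarrow> (real^2) set" and T :: "real^2^2 \<Rightarrow> 'w \<Rightarrow> 'w"
  assumes fin: "\<And>\<omega> r. \<omega> \<in> space lam \<Longrightarrow> finite (L \<omega> \<inter> cball 0 r)"
    and nz: "\<And>\<omega>. \<omega> \<in> space lam \<Longrightarrow> 0 \<notin> L \<omega>"
    and T: "\<And>A. det A = 1 \<Longrightarrow> T A \<in> lam \<rightarrow>\<^sub>M lam" "\<And>A. det A = 1 \<Longrightarrow> distr lam lam (T A) = lam"
    and equiv: "\<And>A \<omega>. det A = 1 \<Longrightarrow> \<omega> \<in> space lam \<Longrightarrow> L (T A \<omega>) = (*v) A ` L \<omega>"
    and sv: "\<And>f. f \<in> B\<^sub>c \<Longrightarrow> (\<lambda>\<omega>. infsum f (L \<omega>)) \<in> borel_measurable lam"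
      "\<And>f. f \<in> B\<^sub>c \<Longrightarrow> integrable lam (\<lambda>\<omega>. (infsum f (L \<omega>))\<^sup>2)"
    and \<kappa>: "is_haar_SL2 \<kappa>"
  shows "\<exists>(\<nu> :: real measure) (\<eta> :: real option measure).
    sets \<nu> = sets (borel_of (top_of_set (- {0}))) \<and>
    sets \<eta> = sets (borel_of P1) \<and>
    (\<forall>h \<in> B\<^sub>c.
      integrable lam (\<lambda>\<omega>. infsum h (L \<omega> \<times> L \<omega>)) \<and>
      (\<forall>t. t \<noteq> 0 \<longrightarrow> integrable \<kappa> (\<lambda>A. h (t *\<^sub>R column 1 A, column 2 A))) \<and>
      integrable \<nu> (\<lambda>t. LINT A|\<kappa>. h (t *\<^sub>R column 1 A, column 2 A)) \<and>
      (\<forall>s. integrable lborel (slope_slice h s)) \<and>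
      integrable \<eta> (\<lambda>s. LINT x|lborel. slope_slice h s x) \<and>
      (LINT \<omega>|lam. infsum h (L \<omega> \<times> L \<omega>)) =
        (LINT t|\<nu>. (LINT A|\<kappa>. h (t *\<^sub>R column 1 A, column 2 A))) +
        (LINT s|\<eta>. (LINT x|lborel. slope_slice h s x)))"
proof -
  obtain m :: "vec_pair measure" where sets_m [measurable_cong, simp]: "sets m = sets borel"
    and m_fin: "\<And>r. emeasure m (cball 0 r) < \<infinity>" and m_nz: "AE p in m. fst p \<noteq> 0"
    and m_inv: "\<And>A f. det A = 1 \<Longrightarrow> f \<in> borel_measurable borel \<Longrightarrow> (\<integral>\<^sup>+p. f (act2 A p) \<partial>m) = (\<integral>\<^sup>+p. f p \<partial>m)"
    and I_meas: "\<And>f. f \<in> borel_measurable borel \<Longrightarrow> (\<lambda>\<omega>. \<integral>\<^sup>+p. f p \<partial>count_space (L \<omega> \<times> L \<omega>)) \<in> borel_measurable lam"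
    and I_int: "\<And>f. f \<in> borel_measurable borel \<Longrightarrow>
      (\<integral>\<^sup>+p. f p \<partial>m) = (\<integral>\<^sup>+\<omega>. \<integral>\<^sup>+p. f p \<partial>count_space (L \<omega> \<times> L \<omega>) \<partial>lam)"
    using siegel_veech_pair_measure[OF fin nz T equiv sv] by blast
  obtain \<nu>0 \<eta>0 :: "real measure" where s\<nu>0 [measurable_cong, simp]: "sets \<nu>0 = sets borel"
    and s\<eta>0 [measurable_cong, simp]: "sets \<eta>0 = sets borel" and \<nu>0_nz: "AE t in \<nu>0. t \<noteq> 0"
    and dec: "\<forall>f \<in> borel_measurable borel. (\<integral>\<^sup>+p. f p \<partial>m) =
      (\<integral>\<^sup>+t. \<integral>\<^sup>+A. f (t *\<^sub>R column 1 A, column 2 A) \<partial>\<kappa> \<partial>\<nu>0) + (\<integral>\<^sup>+s. \<integral>\<^sup>+x. f (x, s *\<^sub>R x) \<partial>lborel \<partial>\<eta>0)"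
    using SL2_invariant_pair_measure_disintegration[OF sets_m m_fin m_nz m_inv \<kappa>] by blast
  obtain c where c: "0 < c" "c < \<infinity>"
    and \<kappa>c: "\<forall>f\<in>borel_measurable borel. (\<integral>\<^sup>+A. f A \<partial>\<kappa>) = c * (\<integral>\<^sup>+A. f A \<partial>cone_haar)"
    using haar_SL2_eq_cone_haar[OF \<kappa>] by blast
  interpret H: sigma_finite_measure cone_haar by (rule sigma_finite_cone_haar)
  have sets_\<kappa>: "sets \<kappa> = sets (restrict_space borel SL2)"
    using \<kappa> sets_borel_of_top_of_set[OF SL2_borel] by (simp add: is_haar_SL2_def)
  have \<kappa>_meas: "f \<in> borel_measurable \<kappa>" if "f \<in> borel_measurable borel" for f :: "real^2^2 \<Rightarrow> real"
    unfolding measurable_cong_sets[OF sets_\<kappa> refl] by (rule measurable_restrict_space1) (rule that)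
  \<comment> \<open>The point 0 is null for \<open>\<nu>0\<close>, so restricting to its complement
    changes no integral.\<close>
  define \<nu> where "\<nu> = restrict_space \<nu>0 (- {0})"
  \<comment> \<open>Pairs with nonzero first vector have finite slope, so the image under
    \<open>Some\<close> suffices and puts no mass on the point at infinity.\<close>
  define \<eta> where "\<eta> = distr \<eta>0 (borel_of P1) Some"
  have sp: "space \<nu>0 = UNIV" "space \<eta>0 = UNIV"
    using sets_eq_imp_space_eq[OF s\<nu>0] sets_eq_imp_space_eq[OF s\<eta>0] by auto
  have \<nu>_int: "integrable \<nu> f \<longleftrightarrow> integrable \<nu>0 f" "(LINT t|\<nu>. f t) = (LINT t|\<nu>0. f t)"
    if [measurable]: "f \<in> borel_measurable borel" for f :: "real \<Rightarrow> real"
  proof -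
    have S: "- {0} \<inter> space \<nu>0 \<in> sets \<nu>0" by (simp add: sp)
    show "integrable \<nu> f \<longleftrightarrow> integrable \<nu>0 f"
      unfolding \<nu>_def integrable_restrict_space[OF S]
      by (rule integrable_cong_AE) (use \<nu>0_nz in \<open>auto elim!: eventually_mono\<close>)
    show "(LINT t|\<nu>. f t) = (LINT t|\<nu>0. f t)"
      unfolding \<nu>_def integral_restrict_space[OF S]
      by (rule integral_cong_AE) (use \<nu>0_nz in \<open>auto elim!: eventually_mono\<close>)
  qed
  have Some_meas: "Some \<in> \<eta>0 \<rightarrow>\<^sub>M borel_of P1"
    unfolding measurable_cong_sets[OF s\<eta>0 refl] by (rule Some_measurable_P1)
  \<comment> \<open>Bounded support and local finiteness turn the infinite sum into a finite one,
    which can be subtracted and compared with counting integrals freely.\<close>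
  have sum_h: "infsum h (L \<omega> \<times> L \<omega>) = sum h ((L \<omega> \<times> L \<omega>) \<inter> cball 0 r)" "finite ((L \<omega> \<times> L \<omega>) \<inter> cball 0 r)"
    if "\<omega> \<in> space lam" "\<And>p. h p \<noteq> 0 \<Longrightarrow> norm p \<le> r" for h :: "vec_pair \<Rightarrow> real" and \<omega> r
  proof -
    have "(L \<omega> \<times> L \<omega>) \<inter> cball 0 r \<subseteq> (L \<omega> \<inter> cball 0 r) \<times> (L \<omega> \<inter> cball 0 r)"
    proof
      fix p assume "p \<in> (L \<omega> \<times> L \<omega>) \<inter> cball 0 r"
      then show "p \<in> (L \<omega> \<inter> cball 0 r) \<times> (L \<omega> \<inter> cball 0 r)"
        using norm_fst_le[of "fst p" "snd p"] norm_snd_le[of "snd p" "fst p"]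
        by (auto simp: mem_Times_iff)
    qed
    then show f: "finite ((L \<omega> \<times> L \<omega>) \<inter> cball 0 r)"
      using fin[OF that(1), of r] by (meson finite_SigmaI finite_subset)
    have "infsum h (L \<omega> \<times> L \<omega>) = infsum h ((L \<omega> \<times> L \<omega>) \<inter> cball 0 r)"
      by (rule infsum_cong_neutral) (use that(2) in auto)
    then show "infsum h (L \<omega> \<times> L \<omega>) = sum h ((L \<omega> \<times> L \<omega>) \<inter> cball 0 r)" using f by simp
  qed
  \<comment> \<open>The whole conclusion for one h, packed so that it can be transferred from the
    positive and negative parts to h.\<close>
  define good where "good h \<longleftrightarrow> integrable lam (\<lambda>\<omega>. infsum h (L \<omega> \<times> L \<omega>)) \<and>
      (\<forall>t. t \<noteq> 0 \<longrightarrow> integrable \<kappa> (\<lambda>A. h (t *\<^sub>R column 1 A, column 2 A))) \<and>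
      integrable \<nu> (\<lambda>t. LINT A|\<kappa>. h (t *\<^sub>R column 1 A, column 2 A)) \<and>
      (\<forall>s. integrable lborel (slope_slice h s)) \<and>
      integrable \<eta> (\<lambda>s. LINT x|lborel. slope_slice h s x) \<and>
      (LINT \<omega>|lam. infsum h (L \<omega> \<times> L \<omega>)) =
        (LINT t|\<nu>. (LINT A|\<kappa>. h (t *\<^sub>R column 1 A, column 2 A))) +
        (LINT s|\<eta>. (LINT x|lborel. slope_slice h s x))"
    for h :: "vec_pair \<Rightarrow> real"
  have nonneg: "good h" if h: "h \<in> B\<^sub>c" and pos: "\<And>p. 0 \<le> h p" for h
  proof -
    obtain b r where b: "\<And>p. \<bar>h p\<bar> \<le> b" and r: "\<And>p. h p \<noteq> 0 \<Longrightarrow> norm p \<le> r" and br: "0 \<le> b" "0 \<le> r"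
      and h_meas [measurable]: "h \<in> borel_measurable borel"
      using Bc_D[OF h] by blast
    define H where "H p = ennreal (h p)" for p
    have H [measurable]: "H \<in> borel_measurable borel" unfolding H_def by measurable
    have H_le: "H p \<le> ennreal b * indicator S x" if "norm p \<le> r \<Longrightarrow> x \<in> S" for p and x :: 'z and S
      using b[of p] r[of p] that pos[of p] by (cases "h p = 0") (auto simp: H_def indicator_def ennreal_leI)
    have int_m: "(\<integral>\<^sup>+p. H p \<partial>m) < \<infinity>"
      by (rule nn_integral_bounded_support[where S = "cball 0 r"]) (use m_fin[of r] in \<open>auto intro!: H_le\<close>)
    have sv_eq: "infsum h (L \<omega> \<times> L \<omega>) = enn2real (\<integral>\<^sup>+p. H p \<partial>count_space (L \<omega> \<times> L \<omega>))"
      if \<omega>: "\<omega> \<in> space lam" for \<omega>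
    proof -
      have "(\<integral>\<^sup>+p. H p \<partial>count_space (L \<omega> \<times> L \<omega>)) = (\<Sum>p\<in>(L \<omega> \<times> L \<omega>) \<inter> cball 0 r. H p)"
      proof (rule nn_integral_count_space')
        show "finite ((L \<omega> \<times> L \<omega>) \<inter> cball 0 r)" by (rule sum_h(2)[OF \<omega>]) (rule r)
        show "H p = 0" if "p \<notin> (L \<omega> \<times> L \<omega>) \<inter> cball 0 r" "p \<in> L \<omega> \<times> L \<omega>" for p
        proof -
          have "h p = 0" using that r[of p] by auto
          then show ?thesis by (simp add: H_def)
        qed
      qed auto
      also have "\<dots> = ennreal (infsum h (L \<omega> \<times> L \<omega>))"
        using pos sum_h(1)[OF \<omega>, of h r] r by (simp add: H_def sum_ennreal)
      finally show ?thesis using pos by (simp add: infsum_nonneg)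
    qed
    have 1: "integrable lam (\<lambda>\<omega>. infsum h (L \<omega> \<times> L \<omega>))"
      "(LINT \<omega>|lam. infsum h (L \<omega> \<times> L \<omega>)) = enn2real (\<integral>\<^sup>+p. H p \<partial>m)"
      using integrable_enn2real[OF I_meas[OF H]] int_m
      by (simp_all add: sv_eq I_int cong: Bochner_Integration.integrable_cong Bochner_Integration.integral_cong)
    define J where "J t = (\<integral>\<^sup>+A. H (t *\<^sub>R column 1 A, column 2 A) \<partial>\<kappa>)" for t
    have g [measurable]: "(\<lambda>A :: real^2^2. H (t *\<^sub>R column 1 A, column 2 A)) \<in> borel_measurable borel" for t
      by measurable
    have g' [measurable]: "(\<lambda>A :: real^2^2. h (t *\<^sub>R column 1 A, column 2 A)) \<in> borel_measurable borel" for t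
      by measurable
    have J_eq: "J t = c * (\<integral>\<^sup>+A. H (t *\<^sub>R column 1 A, column 2 A) \<partial>cone_haar)" for t
      unfolding J_def by (rule \<kappa>c[rule_format]) measurable
    have J_meas [measurable]: "J \<in> borel_measurable borel" unfolding J_eq by measurable
    \<comment> \<open>For t \<noteq> 0 the support of h bounds both columns of A, the first by r /
      |t| and the second by r. At t = 0 the first column would be free.\<close>
    have J_fin: "J t < \<infinity>" if t: "t \<noteq> 0" for t
    proof -
      have "(\<integral>\<^sup>+A. H (t *\<^sub>R column 1 A, column 2 A) \<partial>cone_haar) < \<infinity>"
      proof (rule nn_integral_bounded_support[where S = "cball 0 (4 * (r / \<bar>t\<bar> + r))"])
        fix A :: "real^2^2"
        show "H (t *\<^sub>R column 1 A, column 2 A) \<le> ennreal b * indicator (cball 0 (4 * (r / \<bar>t\<bar> + r))) A"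
        proof (rule H_le)
          assume n: "norm (t *\<^sub>R column 1 A, column 2 A) \<le> r"
          have "norm (t *\<^sub>R column 1 A) \<le> r"
            using norm_fst_le[of "t *\<^sub>R column 1 A" "column 2 A"] n by linarith
          then have "norm (column 1 A) \<le> r / \<bar>t\<bar>" using t by (simp add: field_simps)
          moreover have "norm (column 2 A) \<le> r"
            using norm_snd_le[of "column 2 A" "t *\<^sub>R column 1 A"] n by linarith
          moreover have "0 \<le> r / \<bar>t\<bar>" using br by simp
          ultimately have "norm (column 1 A) \<le> r / \<bar>t\<bar> + r" "norm (column 2 A) \<le> r / \<bar>t\<bar> + r"
            using br by linarith+
          then show "A \<in> cball 0 (4 * (r / \<bar>t\<bar> + r))"
            using norm_mat2_le[of A "r / \<bar>t\<bar> + r"] by simp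
        qed
      qed (use emeasure_cone_haar_cball[of "4 * (r / \<bar>t\<bar> + r)"] in auto)
      then show ?thesis using c by (simp add: J_eq ennreal_mult_less_top)
    qed
    have 2: "integrable \<kappa> (\<lambda>A. h (t *\<^sub>R column 1 A, column 2 A))" if "t \<noteq> 0" for t
      using J_fin[OF that] pos by (intro integrableI_nonneg \<kappa>_meas) (auto simp: J_def H_def)
    have J_LINT: "(LINT A|\<kappa>. h (t *\<^sub>R column 1 A, column 2 A)) = enn2real (J t)" for t
      using pos by (subst integral_eq_nn_integral) (auto simp: J_def H_def intro!: \<kappa>_meas)
    define J2 where "J2 s = (\<integral>\<^sup>+x. H (x, s *\<^sub>R x) \<partial>lborel)" for s
    have J2_meas [measurable]: "J2 \<in> borel_measurable borel" unfolding J2_def by measurable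
    have split: "(\<integral>\<^sup>+p. H p \<partial>m) = (\<integral>\<^sup>+t. J t \<partial>\<nu>0) + (\<integral>\<^sup>+s. J2 s \<partial>\<eta>0)"
      unfolding J_def J2_def by (rule dec[rule_format]) (rule H)
    then have fin1: "(\<integral>\<^sup>+t. J t \<partial>\<nu>0) < \<infinity>" and fin2: "(\<integral>\<^sup>+s. J2 s \<partial>\<eta>0) < \<infinity>"
      using int_m by (auto simp: top_unique)
    have J_\<nu>0: "J \<in> borel_measurable \<nu>0" and J2_\<eta>0: "J2 \<in> borel_measurable \<eta>0" by measurable
    have r_meas: "(\<lambda>t. enn2real (J t)) \<in> borel_measurable borel" by measurable
    have 3: "integrable \<nu> (\<lambda>t. LINT A|\<kappa>. h (t *\<^sub>R column 1 A, column 2 A))"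
      "(LINT t|\<nu>. (LINT A|\<kappa>. h (t *\<^sub>R column 1 A, column 2 A))) = enn2real (\<integral>\<^sup>+t. J t \<partial>\<nu>0)"
      using integrable_enn2real[OF J_\<nu>0 fin1] by (simp_all add: J_LINT \<nu>_int[OF r_meas])
    have 4: "integrable lborel (slope_slice h s)" for s
    proof (rule integrableI_nonneg)
      show "slope_slice h s \<in> borel_measurable lborel"
        unfolding slope_slice_def by (cases s) simp_all
      show "AE x in lborel. 0 \<le> slope_slice h s x"
        unfolding slope_slice_def using pos by (auto split: option.split)
      \<comment> \<open>A pair (x, k x) is at least as long as x, and (0, x) has the length of x, so
        one radius serves all slopes, infinity included.\<close>
      have "norm x \<le> r" if "slope_slice h s x \<noteq> 0" for x
      proof (cases s)
        case None
        then show ?thesis using that r[of "(0, x)"] by (simp add: slope_slice_def norm_Pair)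
      next
        case (Some k)
        then have "norm (x, k *\<^sub>R x) \<le> r" using that by (intro r) (simp add: slope_slice_def)
        then show ?thesis using norm_fst_le[of x "k *\<^sub>R x"] by linarith
      qed
      moreover have "\<bar>slope_slice h s x\<bar> \<le> b" for x
        unfolding slope_slice_def using b by (auto split: option.split)
      ultimately have "ennreal (slope_slice h s x) \<le> ennreal b * indicator (cball 0 r) x" for x
        by (cases "slope_slice h s x = 0") (auto simp: indicator_def intro!: ennreal_leI, smt (verit))
      then show "(\<integral>\<^sup>+x. ennreal (slope_slice h s x) \<partial>lborel) < \<infinity>"
        by (rule nn_integral_bounded_support) (use emeasure_lborel_cball_finite[of 0 r] in auto)
    qed
    have J2_LINT: "(LINT x|lborel. slope_slice h (Some s) x) = enn2real (J2 s)" for s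
      using pos unfolding slope_slice_def by (subst integral_eq_nn_integral) (auto simp: J2_def H_def)
    have G_meas: "(\<lambda>s. LINT x|lborel. slope_slice h s x) \<in> borel_measurable (borel_of P1)"
      by (rule measurable_P1_I) (simp add: J2_LINT)
    have 5: "integrable \<eta> (\<lambda>s. LINT x|lborel. slope_slice h s x)"
      "(LINT s|\<eta>. (LINT x|lborel. slope_slice h s x)) = enn2real (\<integral>\<^sup>+s. J2 s \<partial>\<eta>0)"
      using integrable_enn2real[OF J2_\<eta>0 fin2] unfolding \<eta>_def
      by (simp_all add: integrable_distr_eq[OF Some_meas G_meas] integral_distr[OF Some_meas G_meas] J2_LINT)
    have "enn2real (\<integral>\<^sup>+p. H p \<partial>m) = enn2real (\<integral>\<^sup>+t. J t \<partial>\<nu>0) + enn2real (\<integral>\<^sup>+s. J2 s \<partial>\<eta>0)"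
      unfolding split using fin1 fin2 by (simp add: enn2real_plus)
    then show ?thesis
      unfolding good_def using 1 2 3 4 5 by simp
  qed
  have "good h" if h: "h \<in> B\<^sub>c" for h
  proof -
    obtain b r where b: "\<And>p. \<bar>h p\<bar> \<le> b" and r: "\<And>p. h p \<noteq> 0 \<Longrightarrow> norm p \<le> r" and br: "0 \<le> b" "0 \<le> r"
      and h_meas [measurable]: "h \<in> borel_measurable borel"
      using Bc_D[OF h] by blast
    define u where "u p = max 0 (h p)" for p
    define v where "v p = max 0 (- h p)" for p
    have h_eq: "h p = u p - v p" for p by (simp add: u_def v_def)
    have u_r: "norm p \<le> r" if "u p \<noteq> 0" for p using that r[of p] by (auto simp: u_def)
    have v_r: "norm p \<le> r" if "v p \<noteq> 0" for p using that r[of p] by (auto simp: v_def)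
    have uv_b: "\<bar>u p\<bar> \<le> b" "\<bar>v p\<bar> \<le> b" for p
      using b[of p] by (auto simp: u_def v_def)
    have uv_meas: "u \<in> borel_measurable borel" "v \<in> borel_measurable borel"
      unfolding u_def v_def by measurable
    have u: "u \<in> B\<^sub>c" by (rule Bc_I[OF uv_meas(1) uv_b(1)]) (rule u_r)
    have v: "v \<in> B\<^sub>c" by (rule Bc_I[OF uv_meas(2) uv_b(2)]) (rule v_r)
    have gu: "good u" by (rule nonneg[OF u]) (simp add: u_def)
    have gv: "good v" by (rule nonneg[OF v]) (simp add: v_def)
    have S: "infsum h (L \<omega> \<times> L \<omega>) = infsum u (L \<omega> \<times> L \<omega>) - infsum v (L \<omega> \<times> L \<omega>)" if "\<omega> \<in> space lam" for \<omega>
    proof -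
      note sum_h(1)[OF that]
      from this[of h r] this[of u r] this[of v r] show ?thesis
        using r u_r v_r by (simp add: h_eq sum_subtractf)
    qed
    have sl: "slope_slice h s = (\<lambda>x. slope_slice u s x - slope_slice v s x)" for s
      by (auto simp: slope_slice_def h_eq split: option.split)
    have K: "(LINT A|\<kappa>. h (t *\<^sub>R column 1 A, column 2 A)) =
        (LINT A|\<kappa>. u (t *\<^sub>R column 1 A, column 2 A)) - (LINT A|\<kappa>. v (t *\<^sub>R column 1 A, column 2 A))" if "t \<noteq> 0" for t
      using gu gv that unfolding h_eq good_def by (simp add: Bochner_Integration.integral_diff)
    \<comment> \<open>The space of \<nu> omits 0, so the splitting of the inner integral, valid for
      t \<noteq> 0, holds on all of it.\<close>
    have space_\<nu>: "space \<nu> = - {0}" by (simp add: \<nu>_def space_restrict_space sp)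
    have K1: "integrable \<nu> (\<lambda>t. LINT A|\<kappa>. h (t *\<^sub>R column 1 A, column 2 A)) \<longleftrightarrow>
        integrable \<nu> (\<lambda>t. (LINT A|\<kappa>. u (t *\<^sub>R column 1 A, column 2 A)) - (LINT A|\<kappa>. v (t *\<^sub>R column 1 A, column 2 A)))"
      by (rule Bochner_Integration.integrable_cong) (auto simp: space_\<nu> K)
    have K2: "(LINT t|\<nu>. (LINT A|\<kappa>. h (t *\<^sub>R column 1 A, column 2 A))) =
        (LINT t|\<nu>. ((LINT A|\<kappa>. u (t *\<^sub>R column 1 A, column 2 A)) - (LINT A|\<kappa>. v (t *\<^sub>R column 1 A, column 2 A))))"
      by (rule Bochner_Integration.integral_cong) (auto simp: space_\<nu> K)
    have S1: "integrable lam (\<lambda>\<omega>. infsum h (L \<omega> \<times> L \<omega>)) \<longleftrightarrow>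
        integrable lam (\<lambda>\<omega>. infsum u (L \<omega> \<times> L \<omega>) - infsum v (L \<omega> \<times> L \<omega>))"
      by (rule Bochner_Integration.integrable_cong) (auto simp: S)
    have S2: "(LINT \<omega>|lam. infsum h (L \<omega> \<times> L \<omega>)) = (LINT \<omega>|lam. infsum u (L \<omega> \<times> L \<omega>) - infsum v (L \<omega> \<times> L \<omega>))"
      by (rule Bochner_Integration.integral_cong) (auto simp: S)
    have sl_int: "(LINT x|lborel. slope_slice h s x) = (LINT x|lborel. slope_slice u s x) - (LINT x|lborel. slope_slice v s x)" for s
      unfolding sl using gu gv unfolding good_def by (simp add: Bochner_Integration.integral_diff)
    have "integrable \<kappa> (\<lambda>A. h (t *\<^sub>R column 1 A, column 2 A))" if "t \<noteq> 0" for t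
      unfolding h_eq using gu gv that unfolding good_def by simp
    moreover have "integrable lborel (slope_slice h s)" for s
      unfolding sl using gu gv unfolding good_def by simp
    ultimately show ?thesis
      using gu gv unfolding good_def[of h] S1 S2 K1 K2 sl_int unfolding good_def
      by (simp add: Bochner_Integration.integral_diff)
  qed
  moreover have "sets \<nu> = sets (borel_of (top_of_set (- {0})))"
    by (simp add: \<nu>_def sets_borel_of_top_of_set sets_restrict_space)
  moreover have "sets \<eta> = sets (borel_of P1)" by (simp add: \<eta>_def)
  ultimately show ?thesis unfolding good_def by blast
qed

section \<open>Charts and straight paths\<close>

lemma
  assumes "is_chart X c"
  shows chart_openin: "openin X (fst c)"
    and chart_open_image: "open (snd c ` fst c)"
    and chart_subset: "fst c \<subseteq> topspace X"
    and chart_homeomorphic: "homeomorphic_map (subtopology X (fst c)) (top_of_set (snd c ` fst c)) (snd c)"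
    and chart_inj: "inj_on (snd c) (fst c)"
proof -
  show "openin X (fst c)" "open (snd c ` fst c)"
    and h: "homeomorphic_map (subtopology X (fst c)) (top_of_set (snd c ` fst c)) (snd c)"
    using assms by (auto simp: is_chart_def)
  then show sub: "fst c \<subseteq> topspace X" by (simp add: openin_subset)
  show "inj_on (snd c) (fst c)"
    using homeomorphic_imp_injective_map[OF h] sub by (simp add: Int_absorb1)
qed

lemma chart_inv_left [simp]: "is_chart X c \<Longrightarrow> p \<in> fst c \<Longrightarrow> chart_inv c (snd c p) = p"
  unfolding chart_inv_def by (simp add: chart_inj)

lemma chart_inv_mem: "w \<in> snd c ` fst c \<Longrightarrow> chart_inv c w \<in> fst c"
  unfolding chart_inv_def by (rule inv_into_into)

lemma chart_inv_right: "w \<in> snd c ` fst c \<Longrightarrow> snd c (chart_inv c w) = w"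
  unfolding chart_inv_def by (rule f_inv_into_f)

lemma openin_chart_preimage:
  assumes c: "is_chart X c" and "open V"
  shows "openin X {p \<in> fst c. snd c p \<in> V}"
proof -
  have "continuous_map (subtopology X (fst c)) (top_of_set (snd c ` fst c)) (snd c)"
    using chart_homeomorphic[OF c] homeomorphic_imp_continuous_map by blast
  then have "continuous_map (subtopology X (fst c)) euclidean (snd c)"
    by (simp add: continuous_map_in_subtopology)
  from openin_continuous_map_preimage[OF this, of V] assms(2) chart_subset[OF c]
  have "openin (subtopology X (fst c)) {p \<in> fst c. snd c p \<in> V}"
    by (simp add: Int_absorb1)
  then show ?thesis
    using openin_open_subtopology[OF chart_openin[OF c]] by blast
qed

lemma open_chart_image:
  assumes c: "is_chart X c" and "openin X V"
  shows "open (snd c ` (fst c \<inter> V))"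
proof -
  have "open_map (subtopology X (fst c)) (top_of_set (snd c ` fst c)) (snd c)"
    using chart_homeomorphic[OF c] homeomorphic_imp_open_map by blast
  moreover have "openin (subtopology X (fst c)) (fst c \<inter> V)"
    using assms(2) by (auto simp: openin_subtopology)
  ultimately have "openin (top_of_set (snd c ` fst c)) (snd c ` (fst c \<inter> V))"
    unfolding open_map_def by blast
  then show ?thesis
    using chart_open_image[OF c] openin_open_eq by blast
qed

lemma continuous_map_chart_inv:
  assumes c: "is_chart X c"
  shows "continuous_map (top_of_set (snd c ` fst c)) X (chart_inv c)"
proof -
  have "homeomorphic_maps (subtopology X (fst c)) (top_of_set (snd c ` fst c)) (snd c) (chart_inv c)"
  proof -
    obtain g where g: "homeomorphic_maps (subtopology X (fst c)) (top_of_set (snd c ` fst c)) (snd c) g"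
      using chart_homeomorphic[OF c] homeomorphic_map_maps by blast
    have "g w = chart_inv c w" if "w \<in> snd c ` fst c" for w
    proof -
      from that obtain p where p: "p \<in> fst c" "w = snd c p" by blast
      have "g (snd c p) = p"
        using g p chart_subset[OF c] by (auto simp: homeomorphic_maps_def Int_absorb1)
      then show ?thesis using p c by simp
    qed
    then show ?thesis
      using homeomorphic_maps_eq[OF g, of "snd c" "chart_inv c"] by auto
  qed
  then have "continuous_map (top_of_set (snd c ` fst c)) (subtopology X (fst c)) (chart_inv c)"
    by (simp add: homeomorphic_maps_def)
  then show ?thesis by (simp add: continuous_map_in_subtopology)
qed

lemma compactin_chart_inv:
  assumes c: "is_chart X c" and K: "compact K" "K \<subseteq> snd c ` fst c"
  shows "compactin X {p \<in> fst c. snd c p \<in> K}"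
proof -
  have "compactin (top_of_set (snd c ` fst c)) K"
    using K by (simp add: compactin_subtopology)
  then have "compactin X (chart_inv c ` K)"
    by (rule image_compactin) (rule continuous_map_chart_inv[OF c])
  also have "chart_inv c ` K = {p \<in> fst c. snd c p \<in> K}"
  proof (rule Set.set_eqI, rule iffI)
    fix p assume "p \<in> chart_inv c ` K"
    then obtain w where "w \<in> K" "p = chart_inv c w" by blast
    then show "p \<in> {p \<in> fst c. snd c p \<in> K}"
      using chart_inv_mem[of w c] chart_inv_right[of w c] K(2) by auto
  next
    fix p assume "p \<in> {p \<in> fst c. snd c p \<in> K}"
    then show "p \<in> chart_inv c ` K" using c by (intro image_eqI[of _ _ "snd c p"]) auto
  qed
  finally show ?thesis .
qed

lemma
  assumes "translation_surface S"
  shows translation_surface_Hausdorff: "Hausdorff_space (surf_top S)"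
    and translation_surface_compact: "compact_space (surf_top S)"
    and translation_surface_connected: "connected_space (surf_top S)"
    and atlas_chart: "\<And>c. c \<in> atlas S \<Longrightarrow> is_chart (surf_top S) c"
    and atlas_covers: "(\<Union>c\<in>atlas S. fst c) = topspace (surf_top S)"
    and atlas_holomorphic: "\<And>c d. c \<in> atlas S \<Longrightarrow> d \<in> atlas S \<Longrightarrow>
      (snd d \<circ> chart_inv c) holomorphic_on (snd c ` (fst c \<inter> fst d))"
    and form_holomorphic: "\<And>c. c \<in> atlas S \<Longrightarrow> form S c holomorphic_on (snd c ` fst c)"
    and form_cocycle: "\<And>c d p. c \<in> atlas S \<Longrightarrow> d \<in> atlas S \<Longrightarrow> p \<in> fst c \<Longrightarrow> p \<in> fst d \<Longrightarrow>
        form S c (snd c p) = form S d (snd d p) * deriv (snd d \<circ> chart_inv c) (snd c p)"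
    and form_nonzero: "\<exists>c\<in>atlas S. \<exists>p\<in>fst c. form S c (snd c p) \<noteq> 0"
proof -
  have C: "compact_riemann_surface (surf_top S) (atlas S)" and H: "holomorphic_one_form (atlas S) (form S)"
    and "\<exists>c\<in>atlas S. \<exists>p\<in>fst c. form S c (snd c p) \<noteq> 0"
    using assms unfolding translation_surface_def by blast+
  then show "\<exists>c\<in>atlas S. \<exists>p\<in>fst c. form S c (snd c p) \<noteq> 0" by blast
  show "Hausdorff_space (surf_top S)" "compact_space (surf_top S)" "connected_space (surf_top S)"
    "(\<Union>c\<in>atlas S. fst c) = topspace (surf_top S)"
    using C unfolding compact_riemann_surface_def by blast+
  show "is_chart (surf_top S) c" if "c \<in> atlas S" for c
    using C that unfolding compact_riemann_surface_def by blast
  show "(snd d \<circ> chart_inv c) holomorphic_on (snd c ` (fst c \<inter> fst d))"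
    if "c \<in> atlas S" "d \<in> atlas S" for c d
    using C that unfolding compact_riemann_surface_def by blast
  show "form S c holomorphic_on (snd c ` fst c)" if "c \<in> atlas S" for c
    using H that unfolding holomorphic_one_form_def by blast
  show "form S c (snd c p) = form S d (snd d p) * deriv (snd d \<circ> chart_inv c) (snd c p)"
    if "c \<in> atlas S" "d \<in> atlas S" "p \<in> fst c" "p \<in> fst d" for c d p
    using H that unfolding holomorphic_one_form_def by blast
qed

text \<open>The cocycle relation carries a zero from the chart that witnesses it to every other
  chart around the point.\<close>

lemma zeros_iff:
  assumes S: "translation_surface S" and c: "c \<in> atlas S" "p \<in> fst c"
  shows "p \<in> zeros S \<longleftrightarrow> form S c (snd c p) = 0"
proof
  assume "p \<in> zeros S"
  then obtain d where "d \<in> atlas S" "p \<in> fst d" "form S d (snd d p) = 0"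
    by (auto simp: zeros_def)
  then show "form S c (snd c p) = 0" using form_cocycle[OF S c(1), of d p] c by simp
qed (use c in \<open>auto simp: zeros_def\<close>)

lemma zeros_subset: "translation_surface S \<Longrightarrow> zeros S \<subseteq> topspace (surf_top S)"
  using atlas_covers by (fastforce simp: zeros_def)

lemma holomorphic_inverse_has_derivative:
  assumes "f holomorphic_on D" "open D" "inj_on f D" "w \<in> D" "\<And>w. w \<in> D \<Longrightarrow> g (f w) = w"
  shows "(g has_field_derivative inverse (deriv f w)) (at (f w))" "deriv f w \<noteq> 0"
proof -
  show nz: "deriv f w \<noteq> 0"
    using holomorphic_injective_imp_regular[OF assms(1-3)] assms(4) by blast
  have "(f has_field_derivative deriv f w) (at w)"
    using assms holomorphic_derivI by blast
  then show "(g has_field_derivative inverse (deriv f w)) (at (f w))"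
    using assms nz holomorphic_on_imp_continuous_on
    by (intro has_field_derivative_inverse_strong[of f _ _ D]) auto
qed

section \<open>Velocity and holonomy of paths\<close>

definition local_velocity :: "'a surface_with_form \<Rightarrow> (real \<Rightarrow> 'a) \<Rightarrow> real \<Rightarrow> complex \<Rightarrow> bool" where
  "local_velocity S \<gamma> t v \<longleftrightarrow> (\<exists>(U, z) \<in> translation_charts S. \<exists>a.
     \<gamma> t \<in> U \<and> v \<noteq> 0 \<and> (\<forall>\<^sub>F s in nhds t. \<gamma> s \<in> U \<and> z (\<gamma> s) = a + s *\<^sub>R v))"

lemma local_velocityI:
  assumes "(U, z) \<in> translation_charts S" "\<forall>\<^sub>F s in nhds t. \<gamma> s \<in> U \<and> z (\<gamma> s) = a + s *\<^sub>R v" "v \<noteq> 0"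
  shows "local_velocity S \<gamma> t v"
  unfolding local_velocity_def
proof (rule bexI[OF _ assms(1)], unfold prod.case, intro exI conjI)
  show "\<gamma> t \<in> U" using eventually_nhds_x_imp_x[OF assms(2)] by blast
qed (fact assms)+

lemma saddle_connection_iff:
  "saddle_connection S \<gamma> \<longleftrightarrow> pathin (surf_top S) \<gamma> \<and> \<gamma> 0 \<in> zeros S \<and> \<gamma> 1 \<in> zeros S \<and>
     (\<forall>t\<in>{0<..<1}. \<gamma> t \<notin> zeros S) \<and> (\<forall>t\<in>{0<..<1}. \<exists>v. local_velocity S \<gamma> t v)"
  unfolding saddle_connection_def local_velocity_def by fast

text \<open>Straightness is expressed in the atlas: the form takes the constant value v on the
  velocity. In this shape it can be integrated against primitives defined across a zero, where no
  translation chart exists.\<close>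

definition straight_path :: "'a surface_with_form \<Rightarrow> (real \<Rightarrow> 'a) \<Rightarrow> complex \<Rightarrow> bool" where
  "straight_path S \<gamma> v \<longleftrightarrow> pathin (surf_top S) \<gamma> \<and>
     (\<forall>t\<in>{0<..<1}. \<forall>c\<in>atlas S. \<gamma> t \<in> fst c \<longrightarrow>
        form S c (snd c (\<gamma> t)) \<noteq> 0 \<and>
        ((snd c \<circ> \<gamma>) has_vector_derivative v / form S c (snd c (\<gamma> t))) (at t))"

text \<open>Off the zeros a translation chart is a primitive with nonzero derivative, so by the
  inverse function theorem the atlas coordinate depends differentiably on the translation
  coordinate.\<close>

lemma translation_chart_derivative:
  assumes S: "translation_surface S" and UZ: "(U, z) \<in> translation_charts S"
    and c: "c \<in> atlas S" and p: "p \<in> U" "p \<in> fst c"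
  shows "form S c (snd c p) \<noteq> 0"
    and "((snd c \<circ> chart_inv (U, z)) has_field_derivative inverse (form S c (snd c p))) (at (z p))"
proof -
  have ch: "is_chart (surf_top S) (U, z)" and U0: "U \<inter> zeros S = {}"
    and der: "\<And>q. q \<in> U \<inter> fst c \<Longrightarrow> ((z \<circ> chart_inv c) has_field_derivative form S c (snd c q)) (at (snd c q))"
    using UZ c unfolding translation_charts_def by auto
  have cc: "is_chart (surf_top S) c" by (rule atlas_chart[OF S c])
  show nz: "form S c (snd c p) \<noteq> 0" using U0 p zeros_iff[OF S c p(2)] by blast
  define D where "D = snd c ` (fst c \<inter> U)"
  have "open D" unfolding D_def using open_chart_image[OF cc] chart_openin[OF ch] by simp
  have der': "((z \<circ> chart_inv c) has_field_derivative form S c w) (at w)" if "w \<in> D" for w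
    using that der by (auto simp: D_def)
  have "((snd c \<circ> chart_inv (U, z)) has_field_derivative inverse (form S c (snd c p))) (at ((z \<circ> chart_inv c) (snd c p)))"
  proof (rule has_field_derivative_inverse_strong[of "z \<circ> chart_inv c" _ "snd c p" D])
    show "((z \<circ> chart_inv c) has_field_derivative form S c (snd c p)) (at (snd c p))"
      using der p by blast
    show "open D" by fact
    show "snd c p \<in> D" using p by (auto simp: D_def)
    show "continuous_on D (z \<circ> chart_inv c)"
      by (intro continuous_at_imp_continuous_on ballI DERIV_isCont[OF der'])
    show "(snd c \<circ> chart_inv (U, z)) ((z \<circ> chart_inv c) w) = w" if "w \<in> D" for w
    proof -
      from that obtain q where q: "q \<in> fst c" "q \<in> U" "w = snd c q" unfolding D_def by blast
      then show ?thesis using chart_inv_left[OF ch, of q] cc by simp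
    qed
  qed (rule nz)
  then show "((snd c \<circ> chart_inv (U, z)) has_field_derivative inverse (form S c (snd c p))) (at (z p))"
    using p cc by simp
qed

lemma local_velocity_chart:
  assumes S: "translation_surface S" and \<gamma>: "pathin (surf_top S) \<gamma>" and t: "t \<in> {0<..<1}"
    and v: "local_velocity S \<gamma> t v" and c: "c \<in> atlas S" "\<gamma> t \<in> fst c"
  shows "form S c (snd c (\<gamma> t)) \<noteq> 0"
    and "((snd c \<circ> \<gamma>) has_vector_derivative v / form S c (snd c (\<gamma> t))) (at t)"
proof -
  obtain U z a where UZ: "(U, z) \<in> translation_charts S" and U: "\<gamma> t \<in> U"
    and ev: "\<forall>\<^sub>F s in nhds t. \<gamma> s \<in> U \<and> z (\<gamma> s) = a + s *\<^sub>R v"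
    using v unfolding local_velocity_def by blast
  have ch: "is_chart (surf_top S) (U, z)" using UZ unfolding translation_charts_def by blast
  let ?w = "form S c (snd c (\<gamma> t))"
  let ?g = "snd c \<circ> chart_inv (U, z)"
  show "?w \<noteq> 0" by (rule translation_chart_derivative[OF S UZ c(1) U c(2)])
  have "z (\<gamma> t) = a + t *\<^sub>R v" using eventually_nhds_x_imp_x[OF ev] by blast
  then have "(?g has_field_derivative inverse ?w) (at (a + t *\<^sub>R v))"
    using translation_chart_derivative(2)[OF S UZ c(1) U c(2)] by simp
  moreover have "((\<lambda>s. a + s *\<^sub>R v) has_vector_derivative v) (at t)"
    by (auto intro!: derivative_eq_intros)
  ultimately have comp: "((?g \<circ> (\<lambda>s. a + s *\<^sub>R v)) has_vector_derivative v * inverse ?w) (at t)"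
    using field_vector_diff_chain_at[of "\<lambda>s. a + s *\<^sub>R v" v t ?g "inverse ?w"] by simp
  \<comment> \<open>Near t the path is recovered from its straight image through the inverse of the
    translation chart.\<close>
  have same: "\<forall>\<^sub>F s in nhds t. (?g \<circ> (\<lambda>s. a + s *\<^sub>R v)) s = (snd c \<circ> \<gamma>) s"
    using ev
  proof eventually_elim
    case (elim s)
    then have "chart_inv (U, z) (a + s *\<^sub>R v) = \<gamma> s" using chart_inv_left[OF ch, of "\<gamma> s"] by simp
    then show ?case by simp
  qed
  show "((snd c \<circ> \<gamma>) has_vector_derivative v / ?w) (at t)"
  proof (rule has_vector_derivative_cong_ev[THEN iffD1])
    show "((?g \<circ> (\<lambda>s. a + s *\<^sub>R v)) has_vector_derivative v / ?w) (at t)"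
      using comp by (simp add: field_class.field_divide_inverse)
    show "\<forall>\<^sub>F s in nhds t. s \<in> UNIV \<longrightarrow> (?g \<circ> (\<lambda>s. a + s *\<^sub>R v)) s = (snd c \<circ> \<gamma>) s"
      using same by simp
    show "(?g \<circ> (\<lambda>s. a + s *\<^sub>R v)) t = (snd c \<circ> \<gamma>) t"
      using eventually_nhds_x_imp_x[OF same] .
  qed
qed

text \<open>The description in \<open>form_velocity\<close> is met by one value only: in every atlas
  chart the derivative of the path is v divided by the coefficient of the form, and derivatives are
  unique.\<close>

lemma form_velocity_eq:
  assumes S: "translation_surface S" and \<gamma>: "pathin (surf_top S) \<gamma>" and t: "t \<in> {0<..<1}"
    and v: "local_velocity S \<gamma> t v"
  shows "form_velocity S \<gamma> t = v"
proof -
  have "\<gamma> t \<in> topspace (surf_top S)"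
    using \<gamma> t by (auto simp: pathin_def continuous_map_def)
  then obtain c where c: "c \<in> atlas S" "\<gamma> t \<in> fst c" using atlas_covers[OF S] by blast
  note L = local_velocity_chart[OF S \<gamma> t v]
  show ?thesis
    unfolding form_velocity_def
  proof (rule the_equality)
    show "\<exists>c\<in>atlas S. \<exists>u. \<gamma> t \<in> fst c \<and> ((snd c \<circ> \<gamma>) has_vector_derivative u) (at t) \<and> v = form S c (snd c (\<gamma> t)) * u"
      using c L[OF c] by (intro bexI[of _ c] exI[of _ "v / form S c (snd c (\<gamma> t))"]) auto
    fix w assume "\<exists>c\<in>atlas S. \<exists>u. \<gamma> t \<in> fst c \<and> ((snd c \<circ> \<gamma>) has_vector_derivative u) (at t) \<and> w = form S c (snd c (\<gamma> t)) * u"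
    then obtain d u where d: "d \<in> atlas S" "\<gamma> t \<in> fst d" and u: "((snd d \<circ> \<gamma>) has_vector_derivative u) (at t)"
      and w: "w = form S d (snd d (\<gamma> t)) * u" by blast
    have "u = v / form S d (snd d (\<gamma> t))" using vector_derivative_unique_at[OF u L(2)[OF d]] .
    then show "w = v" using w L(1)[OF d] by simp
  qed
qed

text \<open>The value of \<open>form_velocity\<close> at the two endpoints is left open, and a
  finite set does not change the integral.\<close>

lemma path_holonomy_cong:
  assumes "\<And>t. t \<in> {0<..<1} \<Longrightarrow> form_velocity S \<gamma> t = v t"
  shows "path_holonomy S \<gamma> = integral {0..1} v"
  unfolding path_holonomy_def
  by (rule integral_spike[of "{0, 1}"]) (use assms in \<open>auto simp: not_le\<close>)

text \<open>A priori every time has its own chart and velocity. Within one translation chart the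
  velocity does not change, so it is locally constant on the connected interval (0, 1), hence
  constant, and its integral over [0, 1] is the velocity itself.\<close>

lemma saddle_connection_velocity:
  assumes S: "translation_surface S" and \<gamma>: "saddle_connection S \<gamma>"
  shows "\<And>t. t \<in> {0<..<1} \<Longrightarrow> local_velocity S \<gamma> t (path_holonomy S \<gamma>)"
proof -
  have p: "pathin (surf_top S) \<gamma>" using \<gamma> by (simp add: saddle_connection_def)
  have lv: "local_velocity S \<gamma> t (form_velocity S \<gamma> t)" if "t \<in> {0<..<1}" for t
    using \<gamma> that form_velocity_eq[OF S p that] unfolding saddle_connection_iff by metis
  have const: "form_velocity S \<gamma> s = form_velocity S \<gamma> t" if "s \<in> {0<..<1}" "t \<in> {0<..<1}" for s t
  proof (rule connected_local_const[OF _ that])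
    show "connected {0<..<1::real}" by simp
    show "\<forall>r\<in>{0<..<1}. \<forall>\<^sub>F r' in at r within {0<..<1}. form_velocity S \<gamma> r = form_velocity S \<gamma> r'"
    proof
      fix r :: real assume r: "r \<in> {0<..<1}"
      let ?v = "form_velocity S \<gamma> r"
      obtain U z a where UZ: "(U, z) \<in> translation_charts S" and v: "?v \<noteq> 0"
        and ev: "\<forall>\<^sub>F s in nhds r. \<gamma> s \<in> U \<and> z (\<gamma> s) = a + s *\<^sub>R ?v"
        using lv[OF r] unfolding local_velocity_def by blast
      have "\<forall>\<^sub>F r' in nhds r. r' \<in> {0<..<1}"
        using eventually_nhds_in_open[OF open_greaterThanLessThan r] .
      \<comment> \<open>What holds for all s near r also holds near every r' close to r, so one
        chart and one velocity serve both times.\<close>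
      moreover have "\<forall>\<^sub>F r' in nhds r. \<forall>\<^sub>F s in nhds r'. \<gamma> s \<in> U \<and> z (\<gamma> s) = a + s *\<^sub>R ?v"
        using ev by (simp add: eventually_eventually)
      ultimately have "\<forall>\<^sub>F r' in nhds r. ?v = form_velocity S \<gamma> r'"
      proof eventually_elim
        case (elim r')
        have "local_velocity S \<gamma> r' ?v"
          by (rule local_velocityI[OF UZ elim(2) v])
        then show ?case using form_velocity_eq[OF S p elim(1)] by simp
      qed
      then show "\<forall>\<^sub>F r' in at r within {0<..<1}. ?v = form_velocity S \<gamma> r'"
        by (simp add: eventually_at_filter eventually_mono)
    qed
  qed
  fix t :: real assume t: "t \<in> {0<..<1}"
  have "path_holonomy S \<gamma> = integral {0..1::real} (\<lambda>_. form_velocity S \<gamma> t)"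
    using path_holonomy_cong[of S \<gamma> "\<lambda>_. form_velocity S \<gamma> t"] const[OF _ t] by blast
  also have "\<dots> = form_velocity S \<gamma> t" by simp
  finally show "local_velocity S \<gamma> t (path_holonomy S \<gamma>)" using lv[OF t] by simp
qed

lemma path_holonomy_eqI:
  assumes S: "translation_surface S" and \<gamma>: "pathin (surf_top S) \<gamma>"
    and v: "\<And>t. t \<in> {0<..<1} \<Longrightarrow> local_velocity S \<gamma> t v"
  shows "path_holonomy S \<gamma> = v"
  using path_holonomy_cong[of S \<gamma> "\<lambda>_. v"] form_velocity_eq[OF S \<gamma> _ v] by simp

lemma saddle_connection_nonzero:
  assumes "translation_surface S" "saddle_connection S \<gamma>"
  shows "path_holonomy S \<gamma> \<noteq> 0"
  using saddle_connection_velocity[OF assms, of "1/2"] by (auto simp: local_velocity_def)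

lemma saddle_connection_straight:
  assumes S: "translation_surface S" and \<gamma>: "saddle_connection S \<gamma>"
  shows "straight_path S \<gamma> (path_holonomy S \<gamma>)"
proof -
  have p: "pathin (surf_top S) \<gamma>" using \<gamma> by (simp add: saddle_connection_def)
  show ?thesis
    unfolding straight_path_def
    using p local_velocity_chart[OF S p _ saddle_connection_velocity[OF S \<gamma>]] by blast
qed

section \<open>Isomorphic surfaces\<close>

definition surface_iso :: "'a surface_with_form \<Rightarrow> 'b surface_with_form \<Rightarrow> ('a \<Rightarrow> 'b) \<Rightarrow> bool" where
  "surface_iso S T F \<longleftrightarrow> homeomorphic_map (surf_top S) (surf_top T) F \<and>
     (\<forall>c\<in>atlas S. \<forall>d\<in>atlas T.
        (snd d \<circ> F \<circ> chart_inv c) holomorphic_on (snd c ` {p \<in> fst c. F p \<in> fst d}) \<and>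
        (\<forall>p\<in>fst c. F p \<in> fst d \<longrightarrow>
           form S c (snd c p) = form T d (snd d (F p)) * deriv (snd d \<circ> F \<circ> chart_inv c) (snd c p)))"

lemma isomorphic_surfaces_iff: "isomorphic_surfaces S T \<longleftrightarrow> (\<exists>F. surface_iso S T F)"
  by (simp add: isomorphic_surfaces_def surface_iso_def)

lemma
  assumes "surface_iso S T F"
  shows surface_iso_homeomorphic: "homeomorphic_map (surf_top S) (surf_top T) F"
    and surface_iso_continuous: "continuous_map (surf_top S) (surf_top T) F"
    and surface_iso_inj: "inj_on F (topspace (surf_top S))"
    and surface_iso_image: "F ` topspace (surf_top S) = topspace (surf_top T)"
    and surface_iso_holomorphic: "\<And>c d. c \<in> atlas S \<Longrightarrow> d \<in> atlas T \<Longrightarrow>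
        (snd d \<circ> F \<circ> chart_inv c) holomorphic_on (snd c ` {p \<in> fst c. F p \<in> fst d})"
    and surface_iso_form: "\<And>c d p. c \<in> atlas S \<Longrightarrow> d \<in> atlas T \<Longrightarrow> p \<in> fst c \<Longrightarrow> F p \<in> fst d \<Longrightarrow>
        form S c (snd c p) = form T d (snd d (F p)) * deriv (snd d \<circ> F \<circ> chart_inv c) (snd c p)"
proof -
  show h: "homeomorphic_map (surf_top S) (surf_top T) F"
    using assms by (simp add: surface_iso_def)
  show "continuous_map (surf_top S) (surf_top T) F" "inj_on F (topspace (surf_top S))"
    "F ` topspace (surf_top S) = topspace (surf_top T)"
    using h homeomorphic_imp_continuous_map homeomorphic_imp_injective_map homeomorphic_imp_surjective_map by blast+
  show "(snd d \<circ> F \<circ> chart_inv c) holomorphic_on (snd c ` {p \<in> fst c. F p \<in> fst d})"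
    if "c \<in> atlas S" "d \<in> atlas T" for c d
    using assms that unfolding surface_iso_def by blast
  show "form S c (snd c p) = form T d (snd d (F p)) * deriv (snd d \<circ> F \<circ> chart_inv c) (snd c p)"
    if "c \<in> atlas S" "d \<in> atlas T" "p \<in> fst c" "F p \<in> fst d" for c d p
    using assms that unfolding surface_iso_def by blast
qed

lemma
  assumes S: "translation_surface S" and T: "translation_surface T" and F: "surface_iso S T F"
    and c: "c \<in> atlas S" and d: "d \<in> atlas T"
  shows surface_iso_open: "open (snd c ` {p \<in> fst c. F p \<in> fst d})"
    and surface_iso_inj_chart: "inj_on (snd d \<circ> F \<circ> chart_inv c) (snd c ` {p \<in> fst c. F p \<in> fst d})"
proof -
  have cc: "is_chart (surf_top S) c" and dd: "is_chart (surf_top T) d"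
    using atlas_chart S T c d by blast+
  have "openin (surf_top S) {p \<in> topspace (surf_top S). F p \<in> fst d}"
    by (rule openin_continuous_map_preimage[OF surface_iso_continuous[OF F] chart_openin[OF dd]])
  from open_chart_image[OF cc this]
  show "open (snd c ` {p \<in> fst c. F p \<in> fst d})"
    using chart_subset[OF cc] by (simp add: Int_def subset_iff conj_ac cong: conj_cong)
  show "inj_on (snd d \<circ> F \<circ> chart_inv c) (snd c ` {p \<in> fst c. F p \<in> fst d})"
  proof (rule inj_onI)
    fix w w' assume "w \<in> snd c ` {p \<in> fst c. F p \<in> fst d}" "w' \<in> snd c ` {p \<in> fst c. F p \<in> fst d}"
    then obtain p p' where p: "p \<in> fst c" "F p \<in> fst d" "w = snd c p" and p': "p' \<in> fst c" "F p' \<in> fst d" "w' = snd c p'"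
      by blast
    assume "(snd d \<circ> F \<circ> chart_inv c) w = (snd d \<circ> F \<circ> chart_inv c) w'"
    then have "snd d (F p) = snd d (F p')" using p p' cc by simp
    then have "F p = F p'" using chart_inj[OF dd] p p' by (simp add: inj_on_eq_iff)
    then show "w = w'"
      using inj_onD[OF surface_iso_inj[OF F], of p p'] chart_subset[OF cc] p p' by auto
  qed
qed

text \<open>In charts an isomorphism is injective and holomorphic, so its derivative does not
  vanish, and the coefficients on the two sides vanish together.\<close>

lemma surface_iso_zeros:
  assumes S: "translation_surface S" and T: "translation_surface T" and F: "surface_iso S T F"
    and p: "p \<in> topspace (surf_top S)"
  shows "F p \<in> zeros T \<longleftrightarrow> p \<in> zeros S"
proof -
  obtain c where c: "c \<in> atlas S" "p \<in> fst c" using p atlas_covers[OF S] by blast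
  have "F p \<in> topspace (surf_top T)" using p surface_iso_image[OF F] by blast
  then obtain d where d: "d \<in> atlas T" "F p \<in> fst d" using atlas_covers[OF T] by blast
  have "deriv (snd d \<circ> F \<circ> chart_inv c) (snd c p) \<noteq> 0"
    using holomorphic_injective_imp_regular[OF surface_iso_holomorphic[OF F c(1) d(1)]
        surface_iso_open[OF S T F c(1) d(1)] surface_iso_inj_chart[OF S T F c(1) d(1)]] c d by blast
  then show ?thesis
    using zeros_iff[OF S c] zeros_iff[OF T d] surface_iso_form[OF F c(1) d(1) c(2) d(2)] by simp
qed

text \<open>The inverse of an injective holomorphic function is differentiable with reciprocal
  derivative, which inverts the transformation rule of the form.\<close>

lemma surface_iso_inverse:
  assumes S: "translation_surface S" and T: "translation_surface T" and F: "surface_iso S T F"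
  shows "\<exists>G. surface_iso T S G"
proof -
  obtain G where FG: "homeomorphic_maps (surf_top S) (surf_top T) F G"
    using surface_iso_homeomorphic[OF F] homeomorphic_map_maps by blast
  have G: "homeomorphic_map (surf_top T) (surf_top S) G"
    using FG homeomorphic_map_maps homeomorphic_maps_sym by blast
  have GF: "G (F p) = p" if "p \<in> topspace (surf_top S)" for p
    using FG that by (simp add: homeomorphic_maps_def)
  have FG': "F (G q) = q" "G q \<in> topspace (surf_top S)" if "q \<in> topspace (surf_top T)" for q
    using FG that by (auto simp: homeomorphic_maps_def continuous_map_def)
  have "(snd c \<circ> G \<circ> chart_inv d) holomorphic_on (snd d ` {q \<in> fst d. G q \<in> fst c}) \<and>
        (\<forall>q\<in>fst d. G q \<in> fst c \<longrightarrow>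
           form T d (snd d q) = form S c (snd c (G q)) * deriv (snd c \<circ> G \<circ> chart_inv d) (snd d q))"
    if d: "d \<in> atlas T" and c: "c \<in> atlas S" for c d
  proof -
    have cc: "is_chart (surf_top S) c" and dd: "is_chart (surf_top T) d"
      using atlas_chart S T c d by blast+
    let ?\<phi> = "snd d \<circ> F \<circ> chart_inv c" and ?\<psi> = "snd c \<circ> G \<circ> chart_inv d"
    let ?D = "snd c ` {p \<in> fst c. F p \<in> fst d}"
    note hol = surface_iso_holomorphic[OF F c d] and op = surface_iso_open[OF S T F c d]
      and inj = surface_iso_inj_chart[OF S T F c d]
    have inv: "?\<psi> (?\<phi> w) = w" if "w \<in> ?D" for w
    proof -
      from that obtain p where p: "p \<in> fst c" "F p \<in> fst d" "w = snd c p" by blast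
      then show ?thesis using cc dd GF[of p] chart_subset[OF cc] by auto
    qed
    have der: "(?\<psi> has_field_derivative inverse (deriv ?\<phi> (snd c (G q)))) (at (snd d q))"
      "deriv ?\<phi> (snd c (G q)) \<noteq> 0" "F (G q) = q"
      if q: "q \<in> fst d" "G q \<in> fst c" for q
    proof -
      have qt: "q \<in> topspace (surf_top T)" using q chart_subset[OF dd] by blast
      show FGq: "F (G q) = q" by (rule FG'(1)[OF qt])
      have mem: "snd c (G q) \<in> ?D" using q FGq by auto
      have "?\<phi> (snd c (G q)) = snd d q" using q cc FGq by simp
      then show "(?\<psi> has_field_derivative inverse (deriv ?\<phi> (snd c (G q)))) (at (snd d q))"
        using holomorphic_inverse_has_derivative(1)[OF hol op inj mem, of ?\<psi>] inv by simp
      show "deriv ?\<phi> (snd c (G q)) \<noteq> 0"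
        by (rule holomorphic_inverse_has_derivative(2)[OF hol op inj mem, of ?\<psi>]) (rule inv)
    qed
    have "?\<psi> field_differentiable (at (snd d q))" if "q \<in> fst d" "G q \<in> fst c" for q
      using der(1)[OF that] by (auto simp: field_differentiable_def)
    then have "?\<psi> holomorphic_on (snd d ` {q \<in> fst d. G q \<in> fst c})"
      by (auto simp: holomorphic_on_def intro: field_differentiable_at_within)
    moreover have "form T d (snd d q) = form S c (snd c (G q)) * deriv ?\<psi> (snd d q)"
      if q: "q \<in> fst d" "G q \<in> fst c" for q
    proof -
      have "form S c (snd c (G q)) = form T d (snd d q) * deriv ?\<phi> (snd c (G q))"
        using surface_iso_form[OF F c d q(2)] q der(3)[OF q] by simp
      moreover have "deriv ?\<psi> (snd d q) = inverse (deriv ?\<phi> (snd c (G q)))"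
        by (rule DERIV_imp_deriv[OF der(1)[OF q]])
      ultimately show ?thesis using der(2)[OF q] by simp
    qed
    ultimately show ?thesis by blast
  qed
  with G show ?thesis unfolding surface_iso_def by (intro exI[of _ G]) blast
qed

text \<open>By the chain rule the derivative of the composition is the coefficient on T times the
  derivative of F in charts, and this product is the coefficient on S.\<close>

lemma translation_chart_pullback:
  assumes S: "translation_surface S" and T: "translation_surface T" and F: "surface_iso S T F"
    and VW: "(V, w) \<in> translation_charts T"
  shows "({p \<in> topspace (surf_top S). F p \<in> V}, w \<circ> F) \<in> translation_charts S"
proof -
  let ?U = "{p \<in> topspace (surf_top S). F p \<in> V}"
  have ch: "is_chart (surf_top T) (V, w)" and V0: "V \<inter> zeros T = {}"
    using VW unfolding translation_charts_def by blast+
  have sub: "V \<subseteq> topspace (surf_top T)" using chart_subset[OF ch] by simp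
  have FU: "F ` ?U = V"
  proof
    show "V \<subseteq> F ` ?U"
      using sub surface_iso_image[OF F] by (auto 4 3)
  qed auto
  have "openin (surf_top S) ?U"
    using openin_continuous_map_preimage[OF surface_iso_continuous[OF F] chart_openin[OF ch]] by simp
  moreover have im: "(w \<circ> F) ` ?U = w ` V" using FU by (metis image_comp)
  moreover have "open (w ` V)" using chart_open_image[OF ch] by simp
  moreover have "homeomorphic_map (subtopology (surf_top S) ?U) (top_of_set (w ` V)) (w \<circ> F)"
  proof (rule homeomorphic_map_compose)
    show "homeomorphic_map (subtopology (surf_top S) ?U) (subtopology (surf_top T) V) F"
    proof (rule homeomorphic_map_subtopologies[OF surface_iso_homeomorphic[OF F]])
      have "topspace (surf_top S) \<inter> ?U = ?U" by blast
      then show "F ` (topspace (surf_top S) \<inter> ?U) = topspace (surf_top T) \<inter> V"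
        using FU sub by (simp add: Int_absorb1)
    qed
    show "homeomorphic_map (subtopology (surf_top T) V) (top_of_set (w ` V)) w"
      using chart_homeomorphic[OF ch] by simp
  qed
  ultimately have "is_chart (surf_top S) (?U, w \<circ> F)"
    by (simp add: is_chart_def del: image_comp)
  moreover have "?U \<inter> zeros S = {}"
    using surface_iso_zeros[OF S T F] V0 by blast
  moreover have "((w \<circ> F \<circ> chart_inv c) has_field_derivative form S c (snd c p)) (at (snd c p))"
    if c: "c \<in> atlas S" and p: "p \<in> ?U \<inter> fst c" for c p
  proof -
    have cc: "is_chart (surf_top S) c" using atlas_chart[OF S c] .
    have "F p \<in> topspace (surf_top T)" using p sub by blast
    then obtain d where d: "d \<in> atlas T" "F p \<in> fst d" using atlas_covers[OF T] by blast
    have dd: "is_chart (surf_top T) d" using atlas_chart[OF T d(1)] .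
    let ?\<phi> = "snd d \<circ> F \<circ> chart_inv c"
    let ?D = "snd c ` {p \<in> fst c. F p \<in> fst d}"
    have mem: "snd c p \<in> ?D" using p d by blast
    have "(?\<phi> has_field_derivative deriv ?\<phi> (snd c p)) (at (snd c p))"
      by (rule holomorphic_derivI[OF surface_iso_holomorphic[OF F c d(1)] surface_iso_open[OF S T F c d(1)] mem])
    moreover have "?\<phi> (snd c p) = snd d (F p)" using p cc by simp
    moreover have "((w \<circ> chart_inv d) has_field_derivative form T d (snd d (F p))) (at (snd d (F p)))"
      using VW d p unfolding translation_charts_def by auto
    ultimately have "((w \<circ> chart_inv d \<circ> ?\<phi>) has_field_derivative form T d (snd d (F p)) * deriv ?\<phi> (snd c p)) (at (snd c p))"
      using DERIV_chain[of "w \<circ> chart_inv d" "form T d (snd d (F p))" ?\<phi> "snd c p"] by simp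
    then have "((w \<circ> chart_inv d \<circ> ?\<phi>) has_field_derivative form S c (snd c p)) (at (snd c p))"
      using surface_iso_form[OF F c d(1) _ d(2)] p by simp
    then show ?thesis
    proof (rule has_field_derivative_transform_within_open[OF _ surface_iso_open[OF S T F c d(1)] mem])
      fix x assume "x \<in> ?D"
      then obtain q where "q \<in> fst c" "F q \<in> fst d" "x = snd c q" by blast
      then show "(w \<circ> chart_inv d \<circ> ?\<phi>) x = (w \<circ> F \<circ> chart_inv c) x"
        using cc dd by simp
    qed
  qed
  ultimately show ?thesis unfolding translation_charts_def by blast
qed

text \<open>Paths travel from T to S along the inverse of F, charts from T to S by composition with
  F. In the pulled back chart the transported path has the same coordinates, hence the same velocity
  and holonomy.\<close>

lemma surface_holonomies_iso_subset:
  assumes S: "translation_surface S" and T: "translation_surface T" and F: "surface_iso S T F"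
  shows "surface_holonomies T \<subseteq> surface_holonomies S"
proof
  fix h assume "h \<in> surface_holonomies T"
  then obtain \<gamma> where \<gamma>: "saddle_connection T \<gamma>" and h: "h = to_R2 (path_holonomy T \<gamma>)"
    unfolding surface_holonomies_def by blast
  let ?v = "path_holonomy T \<gamma>"
  obtain G where FG: "homeomorphic_maps (surf_top S) (surf_top T) F G"
    using surface_iso_homeomorphic[OF F] homeomorphic_map_maps by blast
  have p: "pathin (surf_top T) \<gamma>" using \<gamma> by (simp add: saddle_connection_def)
  have "continuous_map (surf_top T) (surf_top S) G" using FG by (simp add: homeomorphic_maps_def)
  then have pG: "pathin (surf_top S) (G \<circ> \<gamma>)"
    using p continuous_map_compose unfolding pathin_def by blast
  have mem: "\<gamma> t \<in> topspace (surf_top T)" if "t \<in> {0..1}" for t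
    using p that by (auto simp: pathin_def continuous_map_def)
  have FG': "F (G q) = q" "G q \<in> topspace (surf_top S)" if "q \<in> topspace (surf_top T)" for q
    using FG that by (auto simp: homeomorphic_maps_def continuous_map_def)
  have zer: "(G \<circ> \<gamma>) t \<in> zeros S \<longleftrightarrow> \<gamma> t \<in> zeros T" if "t \<in> {0..1}" for t
    using surface_iso_zeros[OF S T F, of "G (\<gamma> t)"] FG'[OF mem[OF that]] by simp
  have lv: "local_velocity S (G \<circ> \<gamma>) t ?v" if t: "t \<in> {0<..<1}" for t
  proof -
    obtain V w a where VW: "(V, w) \<in> translation_charts T" and V: "\<gamma> t \<in> V" "?v \<noteq> 0"
      and ev: "\<forall>\<^sub>F s in nhds t. \<gamma> s \<in> V \<and> w (\<gamma> s) = a + s *\<^sub>R ?v"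
      using saddle_connection_velocity[OF T \<gamma> t] unfolding local_velocity_def by blast
    let ?U = "{p \<in> topspace (surf_top S). F p \<in> V}"
    have V_sub: "V \<subseteq> topspace (surf_top T)"
      using VW chart_subset[of "surf_top T" "(V, w)"] unfolding translation_charts_def by auto
    have "\<forall>\<^sub>F s in nhds t. (G \<circ> \<gamma>) s \<in> ?U \<and> (w \<circ> F) ((G \<circ> \<gamma>) s) = a + s *\<^sub>R ?v"
      using ev
    proof eventually_elim
      case (elim s)
      then have "\<gamma> s \<in> topspace (surf_top T)" using V_sub by blast
      from FG'[OF this] elim show ?case by simp
    qed
    then show ?thesis
      by (rule local_velocityI[OF translation_chart_pullback[OF S T F VW]]) (rule V(2))
  qed
  have "saddle_connection S (G \<circ> \<gamma>)"
    unfolding saddle_connection_iff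
  proof (intro conjI ballI)
    show "(G \<circ> \<gamma>) 0 \<in> zeros S" "(G \<circ> \<gamma>) 1 \<in> zeros S"
      using zer[of 0] zer[of 1] \<gamma> by (simp_all add: saddle_connection_def)
    fix t :: real assume t: "t \<in> {0<..<1}"
    then have "\<gamma> t \<notin> zeros T" using \<gamma> unfolding saddle_connection_def by blast
    then show "(G \<circ> \<gamma>) t \<notin> zeros S" using zer[of t] t by simp
    show "\<exists>v. local_velocity S (G \<circ> \<gamma>) t v" using lv[OF t] by blast
  qed (rule pG)
  moreover have "path_holonomy S (G \<circ> \<gamma>) = ?v" by (rule path_holonomy_eqI[OF S pG lv])
  ultimately show "h \<in> surface_holonomies S" unfolding surface_holonomies_def h by force
qed

lemma surface_holonomies_isomorphic:
  assumes S: "translation_surface S" and T: "translation_surface T" and "isomorphic_surfaces S T"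
  shows "surface_holonomies S = surface_holonomies T"
proof -
  obtain F where F: "surface_iso S T F" using assms(3) isomorphic_surfaces_iff by blast
  obtain G where G: "surface_iso T S G" using surface_iso_inverse[OF S T F] by blast
  show ?thesis
    using surface_holonomies_iso_subset[OF S T F] surface_holonomies_iso_subset[OF T S G] by blast
qed

text \<open>\<open>\<Lambda>\<close> takes the union over all representatives of the class. All of
  them are isomorphic to the one that generates it, so each contributes the whole set.\<close>

lemma Lambda_eq_surface_holonomies:
  assumes "c \<in> stratum g \<alpha>" "S \<in> c"
  shows "\<Lambda> c = surface_holonomies S" "translation_surface S"
proof -
  obtain S0 where c: "c = iso_rel `` {S0}"
    using assms(1) unfolding stratum_def moduli_space_def quotient_def by blast
  have mem: "translation_surface S0 \<and> translation_surface S' \<and> isomorphic_surfaces S0 S'" if "S' \<in> c" for S'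
    using that unfolding c iso_rel_def by blast
  then have eq: "surface_holonomies S' = surface_holonomies S0" if "S' \<in> c" for S'
    using that surface_holonomies_isomorphic by blast
  show "translation_surface S" using mem[OF assms(2)] by blast
  show "\<Lambda> c = surface_holonomies S"
    unfolding \<Lambda>_def using eq assms(2) by blast
qed

section \<open>The linear action on holonomy vectors\<close>

lemma of_R2_to_R2 [simp]: "of_R2 (to_R2 w) = w"
  by (simp add: of_R2_def to_R2_def complex_eq_iff)

lemma to_R2_of_R2 [simp]: "to_R2 (of_R2 x) = x"
  by (simp add: of_R2_def to_R2_def vec_eq_iff forall_2)

lemma to_R2_lin_map: "to_R2 (lin_map A w) = A *v to_R2 w"
  by (simp add: lin_map_def)

lemma lin_map_comp: "lin_map A (lin_map B w) = lin_map (A ** B) w"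
  by (simp add: lin_map_def matrix_vector_mul_assoc)

lemma to_R2_add: "to_R2 (w + z) = to_R2 w + to_R2 z"
  and to_R2_scaleR: "to_R2 (r *\<^sub>R w) = r *\<^sub>R to_R2 w"
  by (simp_all add: to_R2_def vec_eq_iff forall_2)

lemma of_R2_add: "of_R2 (x + y) = of_R2 x + of_R2 y"
  and of_R2_scaleR: "of_R2 (r *\<^sub>R x) = r *\<^sub>R of_R2 x"
  by (simp_all add: of_R2_def complex_eq_iff)

lemma lin_map_add: "lin_map A (w + z) = lin_map A w + lin_map A z"
  and lin_map_scaleR: "lin_map A (r *\<^sub>R w) = r *\<^sub>R lin_map A w"
  by (simp_all add: lin_map_def to_R2_add to_R2_scaleR of_R2_add of_R2_scaleR matrix_vector_right_distrib matrix_vector_mult_scaleR)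

lemma norm_to_R2: "norm (to_R2 w) = norm w"
  by (simp add: to_R2_def norm_vec_def L2_set_def sum_2 cmod_def)

text \<open>The path is the same; its coordinates are composed with A, and so is its velocity. The
  left inverse B ensures that the new velocity is nonzero.\<close>

lemma saddle_connection_lin_map:
  assumes S: "translation_surface S" and T: "translation_surface T"
    and top: "surf_top T = surf_top S" and zer: "zeros T = zeros S"
    and charts: "translation_charts T = (\<lambda>(U, z). (U, lin_map A \<circ> z)) ` translation_charts S"
    and BA: "B ** A = mat 1" and \<gamma>: "saddle_connection S \<gamma>"
  shows "saddle_connection T \<gamma> \<and> path_holonomy T \<gamma> = lin_map A (path_holonomy S \<gamma>)"
proof -
  let ?v = "path_holonomy S \<gamma>"
  have p: "pathin (surf_top T) \<gamma>" using \<gamma> top by (simp add: saddle_connection_def)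
  have lv: "local_velocity T \<gamma> t (lin_map A ?v)" if t: "t \<in> {0<..<1}" for t
  proof -
    obtain U z a where UZ: "(U, z) \<in> translation_charts S" and U: "\<gamma> t \<in> U" "?v \<noteq> 0"
      and ev: "\<forall>\<^sub>F s in nhds t. \<gamma> s \<in> U \<and> z (\<gamma> s) = a + s *\<^sub>R ?v"
      using saddle_connection_velocity[OF S \<gamma> t] unfolding local_velocity_def by blast
    have "(U, lin_map A \<circ> z) \<in> translation_charts T" unfolding charts using UZ by force
    moreover have "\<forall>\<^sub>F s in nhds t. \<gamma> s \<in> U \<and> (lin_map A \<circ> z) (\<gamma> s) = lin_map A a + s *\<^sub>R lin_map A ?v"
      using ev by eventually_elim (simp add: lin_map_add lin_map_scaleR)
    moreover have "lin_map A ?v \<noteq> 0"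
    proof
      assume "lin_map A ?v = 0"
      then have "lin_map B (lin_map A ?v) = 0" by (simp add: lin_map_def to_R2_def of_R2_def complex_eq_iff vec_eq_iff forall_2 matrix_vector_mult_def sum_2)
      then show False using U(2) by (simp add: lin_map_comp BA) (simp add: lin_map_def)
    qed
    ultimately show ?thesis by (rule local_velocityI)
  qed
  have "saddle_connection T \<gamma>"
    unfolding saddle_connection_iff
  proof (intro conjI ballI)
    show "\<gamma> 0 \<in> zeros T" "\<gamma> 1 \<in> zeros T"
      using zer \<gamma> by (simp_all add: saddle_connection_def)
    fix t :: real assume t: "t \<in> {0<..<1}"
    then show "\<gamma> t \<notin> zeros T" using \<gamma> zer unfolding saddle_connection_def by blast
    show "\<exists>v. local_velocity T \<gamma> t v" using lv[OF t] by blast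
  qed (rule p)
  moreover have "path_holonomy T \<gamma> = lin_map A ?v" by (rule path_holonomy_eqI[OF T p lv])
  ultimately show ?thesis ..
qed

lemma surface_holonomies_lin_map:
  assumes S: "translation_surface S" and T: "translation_surface T"
    and top: "surf_top T = surf_top S" and zer: "zeros T = zeros S"
    and charts: "translation_charts T = (\<lambda>(U, z). (U, lin_map A \<circ> z)) ` translation_charts S"
    and AB: "A ** B = mat 1" "B ** A = mat 1"
  shows "surface_holonomies T = (*v) A ` surface_holonomies S"
proof -
  have id: "lin_map A (lin_map B w) = w" "lin_map B (lin_map A w) = w" for w
    unfolding lin_map_comp AB by (simp_all add: lin_map_def)
  then have "lin_map B \<circ> (lin_map A \<circ> z) = z" for z :: "'a \<Rightarrow> complex"
    by auto
  \<comment> \<open>S arises from T by the inverse matrix, so one inclusion is the other with the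
    roles of S and T exchanged.\<close>
  have charts': "translation_charts S = (\<lambda>(U, z). (U, lin_map B \<circ> z)) ` translation_charts T"
    unfolding charts using \<open>\<And>z. lin_map B \<circ> (lin_map A \<circ> z) = z\<close> by (simp add: image_image case_prod_beta)
  show ?thesis
  proof
    show "surface_holonomies T \<subseteq> (*v) A ` surface_holonomies S"
    proof
      fix h assume "h \<in> surface_holonomies T"
      then obtain \<gamma> where \<gamma>: "saddle_connection T \<gamma>" and h: "h = to_R2 (path_holonomy T \<gamma>)"
        unfolding surface_holonomies_def by blast
      from saddle_connection_lin_map[OF T S top[symmetric] zer[symmetric] charts' AB(1) \<gamma>]
      have "saddle_connection S \<gamma>" "path_holonomy T \<gamma> = lin_map A (path_holonomy S \<gamma>)"
        by (simp_all add: id)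
      then show "h \<in> (*v) A ` surface_holonomies S"
        unfolding h surface_holonomies_def by (auto simp: to_R2_lin_map)
    qed
    show "(*v) A ` surface_holonomies S \<subseteq> surface_holonomies T"
    proof
      fix h assume "h \<in> (*v) A ` surface_holonomies S"
      then obtain \<gamma> where \<gamma>: "saddle_connection S \<gamma>" and h: "h = A *v to_R2 (path_holonomy S \<gamma>)"
        unfolding surface_holonomies_def by blast
      from saddle_connection_lin_map[OF S T top zer charts AB(2) \<gamma>]
      show "h \<in> surface_holonomies T"
        unfolding h surface_holonomies_def by (force simp: to_R2_lin_map)
    qed
  qed
qed

text \<open>Membership of \<open>SL2_act A c\<close> in the stratum supplies a representative T:
  \<open>SL2_act\<close> collects the surfaces with prescribed charts, and an empty collection would
  have no holonomy vectors.\<close>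

lemma Lambda_SL2_act:
  assumes c: "c \<in> stratum g \<alpha>" and Ac: "SL2_act A c \<in> stratum g \<alpha>" and A: "A ** B = mat 1" "B ** A = mat 1"
  shows "\<Lambda> (SL2_act A c) = (*v) A ` \<Lambda> c"
proof -
  obtain T where T: "T \<in> SL2_act A c" using Ac unfolding stratum_def by blast
  then obtain S where S: "S \<in> c" and tT: "translation_surface T" and "surf_top T = surf_top S" "zeros T = zeros S"
    "translation_charts T = (\<lambda>(U, z). (U, lin_map A \<circ> z)) ` translation_charts S"
    unfolding SL2_act_def by blast
  moreover have "translation_surface S" by (rule Lambda_eq_surface_holonomies[OF c S])
  ultimately have "surface_holonomies T = (*v) A ` surface_holonomies S"
    by (intro surface_holonomies_lin_map[OF _ _ _ _ _ A])
  then show ?thesis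
    by (simp add: Lambda_eq_surface_holonomies(1)[OF c S] Lambda_eq_surface_holonomies(1)[OF Ac T])
qed

section \<open>Local finiteness of the holonomy vectors\<close>

text \<open>Identity theorem and connectedness: the interior Z of the zero set is open and also
  closed, so if it were nonempty the form would vanish everywhere.\<close>

lemma form_not_locally_zero:
  assumes S: "translation_surface S" and c: "c \<in> atlas S" and V: "open V" "V \<noteq> {}" "V \<subseteq> snd c ` fst c"
  shows "\<exists>w\<in>V. form S c w \<noteq> 0"
proof (rule ccontr)
  assume "\<not> ?thesis"
  then have zero: "form S c w = 0" if "w \<in> V" for w using that by blast
  let ?X = "surf_top S"
  have cc: "is_chart ?X c" by (rule atlas_chart[OF S c])
  define Z where "Z = \<Union>{W. openin ?X W \<and> W \<subseteq> zeros S}"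
  have "openin ?X Z" unfolding Z_def by (rule openin_Union) blast
  have "Z \<subseteq> zeros S" unfolding Z_def by blast
  have ZI: "W \<subseteq> Z" if "openin ?X W" "W \<subseteq> zeros S" for W using that unfolding Z_def by blast
  have "Z \<noteq> {}"
  proof -
    have "{p \<in> fst c. snd c p \<in> V} \<subseteq> Z"
    proof (rule ZI[OF openin_chart_preimage[OF cc V(1)]])
      show "{p \<in> fst c. snd c p \<in> V} \<subseteq> zeros S" using zero zeros_iff[OF S c] by blast
    qed
    moreover obtain w where "w \<in> V" using V(2) by blast
    ultimately show ?thesis using V(3) by blast
  qed
  moreover have "openin ?X (topspace ?X - Z)"
  proof (subst openin_subopen, intro ballI)
    fix p assume p: "p \<in> topspace ?X - Z"
    then obtain d where d: "d \<in> atlas S" "p \<in> fst d" using atlas_covers[OF S] by blast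
    have dd: "is_chart ?X d" by (rule atlas_chart[OF S d(1)])
    obtain r where r: "0 < r" "ball (snd d p) r \<subseteq> snd d ` fst d"
      using chart_open_image[OF dd] d(2) open_contains_ball by blast
    let ?B = "ball (snd d p) r"
    let ?P = "{q \<in> fst d. snd d q \<in> ?B}"
    have oP: "openin ?X ?P" by (rule openin_chart_preimage[OF dd]) simp
    have hol: "form S d holomorphic_on ?B"
      using form_holomorphic[OF S d(1)] r(2) holomorphic_on_subset by blast
    \<comment> \<open>A point of Z in the disc around p would make the form vanish on the whole disc
      by analytic continuation, and then p would belong to Z.\<close>
    have "q \<notin> Z" if q: "q \<in> ?P" for q
    proof
      assume "q \<in> Z"
      let ?N = "snd d ` (fst d \<inter> (Z \<inter> ?P))"
      have oN: "open ?N" by (rule open_chart_image[OF dd openin_Int[OF \<open>openin ?X Z\<close> oP]])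
      have "form S d w = 0" if "w \<in> ?N" for w
        using that \<open>Z \<subseteq> zeros S\<close> zeros_iff[OF S d(1)] by blast
      have eq: "form S d w = 0" if "w \<in> ?B" for w
      proof (rule analytic_continuation_open[of ?N ?B "form S d" "\<lambda>_. 0"])
        show "?N \<noteq> {}" using q \<open>q \<in> Z\<close> by blast
        show "?N \<subseteq> ?B" by blast
      qed (use oN hol that \<open>\<And>w. w \<in> ?N \<Longrightarrow> form S d w = 0\<close> in auto)
      have "?P \<subseteq> Z"
        by (rule ZI[OF oP]) (use eq zeros_iff[OF S d(1)] in blast)
      then show False using p d(2) r(1) by auto
    qed
    moreover have "?P \<subseteq> topspace ?X" using openin_subset[OF oP] .
    ultimately show "\<exists>T. openin ?X T \<and> p \<in> T \<and> T \<subseteq> topspace ?X - Z"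
      using oP d(2) r(1) by (intro exI[of _ ?P]) auto
  qed
  then have "closedin ?X Z"
    using openin_subset[OF \<open>openin ?X Z\<close>] by (simp add: closedin_def)
  ultimately have "Z = topspace ?X"
    using translation_surface_connected[OF S] \<open>openin ?X Z\<close> connected_space_clopen_in by blast
  moreover obtain d p where d: "d \<in> atlas S" "p \<in> fst d" "form S d (snd d p) \<noteq> 0"
    using form_nonzero[OF S] by blast
  moreover have "p \<in> topspace ?X" using chart_subset[OF atlas_chart[OF S d(1)]] d(2) by blast
  ultimately show False using zeros_iff[OF S d(1,2)] \<open>Z \<subseteq> zeros S\<close> by blast
qed

text \<open>Translation charts stay away from the zeros. Here W may contain zeros and f may fail to
  be injective, so that discs around zeros can be used as well.\<close>

definition primitive_on :: "'a surface_with_form \<Rightarrow> 'a set \<Rightarrow> ('a \<Rightarrow> complex) \<Rightarrow> bool" where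
  "primitive_on S W f \<longleftrightarrow> openin (surf_top S) W \<and> (\<exists>c\<in>atlas S. W \<subseteq> fst c \<and> (\<exists>F.
     (\<forall>w\<in>snd c ` W. (F has_field_derivative form S c w) (at w)) \<and> (\<forall>p\<in>W. f p = F (snd c p))))"

lemma primitive_on_continuous:
  assumes S: "translation_surface S" and f: "primitive_on S W f"
  shows "continuous_map (subtopology (surf_top S) W) euclidean f"
proof -
  obtain c F where c: "c \<in> atlas S" "W \<subseteq> fst c" and F: "\<And>w. w \<in> snd c ` W \<Longrightarrow> (F has_field_derivative form S c w) (at w)"
    and eq: "\<And>p. p \<in> W \<Longrightarrow> f p = F (snd c p)"
    using f unfolding primitive_on_def by blast
  have cc: "is_chart (surf_top S) c" by (rule atlas_chart[OF S c(1)])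
  have "continuous_map (subtopology (surf_top S) (fst c)) (top_of_set (snd c ` fst c)) (snd c)"
    using chart_homeomorphic[OF cc] homeomorphic_imp_continuous_map by blast
  then have "continuous_map (subtopology (surf_top S) (fst c)) euclidean (snd c)"
    by (simp add: continuous_map_in_subtopology)
  then have "continuous_map (subtopology (surf_top S) W) euclidean (snd c)"
    using c(2) by (metis continuous_map_from_subtopology_mono)
  then have 1: "continuous_map (subtopology (surf_top S) W) (top_of_set (snd c ` W)) (snd c)"
    by (simp add: continuous_map_in_subtopology image_mono)
  have "continuous_on (snd c ` W) F"
    by (intro continuous_at_imp_continuous_on ballI DERIV_isCont[OF F])
  then have 2: "continuous_map (top_of_set (snd c ` W)) euclidean F" by simp
  show ?thesis
    using continuous_map_compose[OF 1 2] by (rule continuous_map_eq) (simp add: eq)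
qed

text \<open>Along a straight path the derivative of f is the coefficient of the form times the
  velocity, that is v. The fundamental theorem asks for this in the interior and for continuity at
  the ends, so the ends may be zeros.\<close>

lemma primitive_on_straight_path:
  assumes S: "translation_surface S" and \<gamma>: "straight_path S \<gamma> v" and f: "primitive_on S W f"
    and ab: "0 \<le> a" "a \<le> b" "b \<le> 1" and W: "\<gamma> ` {a..b} \<subseteq> W"
  shows "f (\<gamma> b) - f (\<gamma> a) = (b - a) *\<^sub>R v"
proof -
  obtain c F where c: "c \<in> atlas S" "W \<subseteq> fst c" and F: "\<And>w. w \<in> snd c ` W \<Longrightarrow> (F has_field_derivative form S c w) (at w)"
    and eq: "\<And>p. p \<in> W \<Longrightarrow> f p = F (snd c p)"
    using f unfolding primitive_on_def by blast
  have p: "pathin (surf_top S) \<gamma>" using \<gamma> by (simp add: straight_path_def)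
  have "continuous_map (top_of_set {a..b}) (subtopology (surf_top S) W) \<gamma>"
    using p ab W continuous_map_from_subtopology_mono[of euclideanreal "{0..1}" "surf_top S" \<gamma> "{a..b}"]
    unfolding pathin_def by (auto simp: continuous_map_in_subtopology)
  from continuous_map_compose[OF this primitive_on_continuous[OF S f]]
  have cont: "continuous_on {a..b} (f \<circ> \<gamma>)" by simp
  have der: "((f \<circ> \<gamma>) has_vector_derivative v) (at t)" if t: "t \<in> {a<..<b}" for t
  proof -
    have t01: "t \<in> {0<..<1}" using t ab by auto
    have tW: "\<gamma> t \<in> W" using W t by auto
    have nz: "form S c (snd c (\<gamma> t)) \<noteq> 0"
      and d: "((snd c \<circ> \<gamma>) has_vector_derivative v / form S c (snd c (\<gamma> t))) (at t)"
      using \<gamma> t01 c tW unfolding straight_path_def by blast+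
    have "(F has_field_derivative form S c (snd c (\<gamma> t))) (at ((snd c \<circ> \<gamma>) t))" using F tW by simp
    from field_vector_diff_chain_at[OF d this]
    have "((F \<circ> (snd c \<circ> \<gamma>)) has_vector_derivative v / form S c (snd c (\<gamma> t)) * form S c (snd c (\<gamma> t))) (at t)" .
    moreover have "v / form S c (snd c (\<gamma> t)) * form S c (snd c (\<gamma> t)) = v" using nz by simp
    ultimately have "((F \<circ> (snd c \<circ> \<gamma>)) has_vector_derivative v) (at t)" by (simp only:)
    then show ?thesis
    proof (rule has_vector_derivative_transform_within_open)
      show "open {a<..<b}" "t \<in> {a<..<b}" using t by auto
      show "(F \<circ> (snd c \<circ> \<gamma>)) s = (f \<circ> \<gamma>) s" if "s \<in> {a<..<b}" for s
        using that W eq[of "\<gamma> s"] by (auto simp: image_subset_iff)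
    qed
  qed
  have "((\<lambda>_. v) has_integral (f \<circ> \<gamma>) b - (f \<circ> \<gamma>) a) {a..b}"
    using fundamental_theorem_of_calculus_interior[OF ab(2) cont der] .
  moreover have "((\<lambda>_. v) has_integral (b - a) *\<^sub>R v) {a..b}"
    using has_integral_const_real[of v a b] ab by simp
  ultimately have "(f \<circ> \<gamma>) b - (f \<circ> \<gamma>) a = (b - a) *\<^sub>R v" by (rule has_integral_unique)
  then show ?thesis by simp
qed

text \<open>In the chart of f both primitives have the same derivative, by the cocycle relation, so
  their difference is constant on a disc.\<close>

lemma primitive_on_difference:
  assumes S: "translation_surface S" and f: "primitive_on S W f" and g: "primitive_on S W' g"
    and p: "p \<in> W" "p \<in> W'"
  shows "\<exists>N. openin (surf_top S) N \<and> p \<in> N \<and> (\<forall>q\<in>N. f q - g q = f p - g p)"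
proof -
  obtain c F where c: "c \<in> atlas S" "W \<subseteq> fst c" and F: "\<And>w. w \<in> snd c ` W \<Longrightarrow> (F has_field_derivative form S c w) (at w)"
    and f_eq: "\<And>p. p \<in> W \<Longrightarrow> f p = F (snd c p)" and oW: "openin (surf_top S) W"
    using f unfolding primitive_on_def by blast
  obtain d G where d: "d \<in> atlas S" "W' \<subseteq> fst d" and G: "\<And>w. w \<in> snd d ` W' \<Longrightarrow> (G has_field_derivative form S d w) (at w)"
    and g_eq: "\<And>p. p \<in> W' \<Longrightarrow> g p = G (snd d p)" and oW': "openin (surf_top S) W'"
    using g unfolding primitive_on_def by blast
  have cc: "is_chart (surf_top S) c" and dd: "is_chart (surf_top S) d"
    using atlas_chart[OF S] c d by blast+
  let ?D = "snd c ` (fst c \<inter> (W \<inter> W'))"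
  have oD: "open ?D" by (rule open_chart_image[OF cc openin_Int[OF oW oW']])
  have pD: "snd c p \<in> ?D" using p c by blast
  obtain r where r: "0 < r" "ball (snd c p) r \<subseteq> ?D" using oD pD open_contains_ball by blast
  let ?B = "ball (snd c p) r"
  let ?\<phi> = "snd d \<circ> chart_inv c"
  let ?h = "\<lambda>w. F w - (G \<circ> ?\<phi>) w"
  have oI: "open (snd c ` (fst c \<inter> fst d))" by (rule open_chart_image[OF cc chart_openin[OF dd]])
  have der: "(?h has_field_derivative 0) (at w)" if "w \<in> ?B" for w
  proof -
    from that r(2) have "w \<in> ?D" by blast
    then obtain q where q: "q \<in> fst c" "q \<in> W" "q \<in> W'" "w = snd c q" by blast
    have "q \<in> fst d" using q d by blast
    have "(?\<phi> has_field_derivative deriv ?\<phi> w) (at w)"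
      by (rule holomorphic_derivI[OF atlas_holomorphic[OF S c(1) d(1)] oI]) (use q \<open>q \<in> fst d\<close> in blast)
    moreover have "?\<phi> w = snd d q" using q cc by simp
    moreover have "(G has_field_derivative form S d (snd d q)) (at (snd d q))" using G q by blast
    ultimately have "((G \<circ> ?\<phi>) has_field_derivative form S d (snd d q) * deriv ?\<phi> w) (at w)"
      using DERIV_chain[of G "form S d (snd d q)" ?\<phi> w] by simp
    then have "((G \<circ> ?\<phi>) has_field_derivative form S c w) (at w)"
      using form_cocycle[OF S c(1) d(1) q(1) \<open>q \<in> fst d\<close>] q(4) by simp
    moreover have "(F has_field_derivative form S c w) (at w)" using F q by blast
    ultimately show ?thesis using DERIV_diff by fastforce
  qed
  have const: "?h w = ?h (snd c p)" if "w \<in> ?B" for w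
  proof (rule has_field_derivative_zero_constant[of ?B ?h, THEN exE])
    show "convex ?B" by simp
    show "(?h has_field_derivative 0) (at x within ?B)" if "x \<in> ?B" for x
      using der[OF that] by (rule DERIV_subset) simp
    fix k assume "\<forall>x\<in>?B. ?h x = k"
    then show ?thesis using that r(1) by (metis centre_in_ball)
  qed
  let ?N = "{q \<in> fst c. snd c q \<in> ?B}"
  have "f q - g q = f p - g p" if "q \<in> ?N" for q
  proof -
    have 1: "f q - g q = ?h (snd c q)" if "q \<in> fst c" "q \<in> W" "q \<in> W'" for q
      using that f_eq g_eq cc by simp
    from that r(2) obtain q' where "q' \<in> fst c" "q' \<in> W" "q' \<in> W'" "snd c q = snd c q'" by blast
    then have "q \<in> W" "q \<in> W'" "q \<in> fst c" using that chart_inj[OF cc] by (auto simp: inj_on_eq_iff)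
    then have "f q - g q = ?h (snd c q)" by (intro 1)
    also have "\<dots> = ?h (snd c p)" by (rule const) (use that in blast)
    also have "\<dots> = f p - g p" using 1[of p] p c by auto
    finally show ?thesis .
  qed
  moreover have "openin (surf_top S) ?N" by (rule openin_chart_preimage[OF cc]) simp
  moreover have "p \<in> ?N" using p c r(1) by auto
  ultimately show ?thesis by (intro exI[of _ ?N]) blast
qed

text \<open>Finitely many of the neighbourhoods of constancy cover K, and each contributes one
  value.\<close>

lemma primitive_on_difference_finite:
  assumes S: "translation_surface S" and f: "primitive_on S W f" and g: "primitive_on S W' g"
    and K: "compactin (surf_top S) K" "K \<subseteq> W" "K \<subseteq> W'"
  shows "finite ((\<lambda>q. f q - g q) ` K)"
proof -
  have "\<forall>p\<in>K. \<exists>N. openin (surf_top S) N \<and> p \<in> N \<and> (\<forall>q\<in>N. f q - g q = f p - g p)"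
    using primitive_on_difference[OF S f g] K by blast
  then obtain N where N: "\<And>p. p \<in> K \<Longrightarrow> openin (surf_top S) (N p) \<and> p \<in> N p \<and> (\<forall>q\<in>N p. f q - g q = f p - g p)"
    by metis
  obtain \<F> where F: "finite \<F>" "\<F> \<subseteq> N ` K" "K \<subseteq> \<Union>\<F>"
    using compactinD[OF K(1), of "N ` K"] N by blast
  obtain D where D: "finite D" "D \<subseteq> K" "\<F> = N ` D"
    using finite_subset_image[OF F(1,2)] by blast
  have "(\<lambda>q. f q - g q) ` K \<subseteq> (\<lambda>q. f q - g q) ` D"
  proof
    fix y assume "y \<in> (\<lambda>q. f q - g q) ` K"
    then obtain q where q: "q \<in> K" "y = f q - g q" by blast
    then obtain p where "p \<in> D" "q \<in> N p" using F(3) D(3) by blast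
    then show "y \<in> (\<lambda>q. f q - g q) ` D" using N[of p] D(2) q by blast
  qed
  then show ?thesis using D(1) finite_subset by blast
qed

text \<open>A disc with a guarded boundary: a path starts in V, I is the open disc, K the closed
  disc, W the domain of f. The gap between \<epsilon> on V and 2 \<epsilon> on K - I is what a path
  has to cover before it can leave K. The last clause lets saddle connections start and end at the
  value 0.\<close>

definition flat_neighbourhood ::
  "'a surface_with_form \<Rightarrow> 'a \<Rightarrow> ('a \<Rightarrow> complex) \<Rightarrow> 'a set \<Rightarrow> 'a set \<Rightarrow> 'a set \<Rightarrow> 'a set \<Rightarrow> real \<Rightarrow> bool" where
  "flat_neighbourhood S x f W K I V \<epsilon> \<longleftrightarrow>
     0 < \<epsilon> \<and> primitive_on S W f \<and> x \<in> V \<and> openin (surf_top S) V \<and> openin (surf_top S) I \<and>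
     compactin (surf_top S) K \<and> V \<subseteq> I \<and> I \<subseteq> K \<and> K \<subseteq> W \<and>
     (\<forall>p\<in>V. norm (f p) < \<epsilon>) \<and> (\<forall>p\<in>K - I. 2 * \<epsilon> \<le> norm (f p)) \<and>
     (\<forall>p\<in>K \<inter> zeros S. f p = 0)"

text \<open>Zeros of a nonzero holomorphic function are isolated. On a small disc around x both the
  form and its primitive vanishing at x are therefore nonzero off the centre, so the primitive has
  positive modulus on the boundary circle, and x is the only possible zero of the form.\<close>

lemma flat_neighbourhood_exists:
  assumes S: "translation_surface S" and x: "x \<in> topspace (surf_top S)"
  shows "\<exists>f W K I V \<epsilon>. flat_neighbourhood S x f W K I V \<epsilon>"
proof -
  obtain c where c: "c \<in> atlas S" "x \<in> fst c" using x atlas_covers[OF S] by blast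
  have cc: "is_chart (surf_top S) c" by (rule atlas_chart[OF S c(1)])
  let ?z = "snd c x" and ?\<omega> = "form S c"
  obtain r where r: "0 < r" "ball ?z r \<subseteq> snd c ` fst c"
    using chart_open_image[OF cc] c(2) open_contains_ball by blast
  let ?B = "ball ?z r"
  have hol: "?\<omega> holomorphic_on ?B"
    using form_holomorphic[OF S c(1)] r(2) holomorphic_on_subset by blast
  obtain F0 where F0: "\<And>w. w \<in> ?B \<Longrightarrow> (F0 has_field_derivative ?\<omega> w) (at w)"
    using holomorphic_convex_primitive'[OF convex_ball open_ball hol] at_within_open[OF _ open_ball] by metis
  define F where "F w = F0 w - F0 ?z" for w
  have F: "(F has_field_derivative ?\<omega> w) (at w)" if "w \<in> ?B" for w
    unfolding F_def using DERIV_diff[OF F0[OF that] DERIV_const] by simp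
  have F_z: "F ?z = 0" by (simp add: F_def)
  have F_hol: "F holomorphic_on ?B"
    unfolding holomorphic_on_open[OF open_ball] using F by blast
  obtain w0 where w0: "w0 \<in> ?B" "?\<omega> w0 \<noteq> 0"
    using form_not_locally_zero[OF S c(1) open_ball _ r(2)] r(1) by auto
  \<comment> \<open>If F vanished on the whole disc, so would its derivative, the form.\<close>
  have "\<exists>w\<in>?B. F w \<noteq> 0"
  proof (rule ccontr)
    assume "\<not> ?thesis"
    then have "((\<lambda>_. 0) has_field_derivative ?\<omega> w0) (at w0)"
      using has_field_derivative_transform_within_open[OF F[OF w0(1)] open_ball w0(1)] by simp
    then show False using w0(2) DERIV_unique[OF _ DERIV_const] by blast
  qed
  then obtain w1 where w1: "w1 \<in> ?B" "F w1 \<noteq> 0" by blast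
  have zB: "?z \<in> ?B" using r(1) by simp
  have "\<forall>\<^sub>F w in at ?z. (F w \<noteq> 0 \<and> w \<in> ?B) \<and> (?\<omega> w \<noteq> 0 \<and> w \<in> ?B)"
    by (intro eventually_conj non_zero_neighbour_alt[OF F_hol open_ball connected_ball zB w1]
        non_zero_neighbour_alt[OF hol open_ball connected_ball zB w0])
  then obtain d where d: "0 < d" "\<And>w. w \<noteq> ?z \<Longrightarrow> dist w ?z < d \<Longrightarrow> F w \<noteq> 0 \<and> ?\<omega> w \<noteq> 0"
    unfolding eventually_at by blast
  \<comment> \<open>Half of the smaller radius, so that the closed disc fits into both open
    ones.\<close>
  define \<rho> where "\<rho> = min d r / 2"
  have \<rho>: "0 < \<rho>" "\<rho> < d" "\<rho> < r" using d(1) r(1) by (auto simp: \<rho>_def)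
  have cb: "cball ?z \<rho> \<subseteq> ?B" using \<rho> by auto
  have cont: "continuous_on ?B F" using F_hol by (rule holomorphic_on_imp_continuous_on)
  have "sphere ?z \<rho> \<noteq> {}" using \<rho>(1) by simp
  moreover have "continuous_on (sphere ?z \<rho>) (\<lambda>w. norm (F w))"
    using cb by (intro continuous_on_norm continuous_on_subset[OF cont]) auto
  ultimately obtain w2 where w2: "w2 \<in> sphere ?z \<rho>" "\<And>w. w \<in> sphere ?z \<rho> \<Longrightarrow> norm (F w2) \<le> norm (F w)"
    using continuous_attains_inf[OF compact_sphere] by blast
  \<comment> \<open>\<open>w2\<close> minimizes the modulus of F on the circle, so it is at least 2
    \<epsilon> there.\<close>
  define \<epsilon> where "\<epsilon> = norm (F w2) / 2"
  have "F w2 \<noteq> 0" using d(2)[of w2] w2(1) \<rho> by (auto simp: dist_commute)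
  then have \<epsilon>: "0 < \<epsilon>" by (simp add: \<epsilon>_def)
  define V0 where "V0 = ball ?z \<rho> \<inter> F -` ball 0 \<epsilon>"
  have "continuous_on (ball ?z \<rho>) F" using cb by (intro continuous_on_subset[OF cont]) auto
  then have V0: "open V0" unfolding V0_def by (rule continuous_open_preimage) auto
  let ?W = "{p \<in> fst c. snd c p \<in> ?B}" and ?K = "{p \<in> fst c. snd c p \<in> cball ?z \<rho>}"
    and ?I = "{p \<in> fst c. snd c p \<in> ball ?z \<rho>}" and ?V = "{p \<in> fst c. snd c p \<in> V0}"
  let ?f = "\<lambda>p. F (snd c p)"
  have "flat_neighbourhood S x ?f ?W ?K ?I ?V \<epsilon>"
    unfolding flat_neighbourhood_def
  proof (intro conjI ballI)
    show "primitive_on S ?W ?f"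
      unfolding primitive_on_def using c(1) F openin_chart_preimage[OF cc open_ball] by blast
    show "x \<in> ?V" using c(2) \<rho>(1) F_z \<epsilon> by (simp add: V0_def)
    show "openin (surf_top S) ?V" by (rule openin_chart_preimage[OF cc V0])
    show "openin (surf_top S) ?I" by (rule openin_chart_preimage[OF cc open_ball])
    show "compactin (surf_top S) ?K" using cb r(2) by (intro compactin_chart_inv[OF cc]) auto
    show "?K \<subseteq> ?W" using cb by blast
    show "norm (?f p) < \<epsilon>" if "p \<in> ?V" for p using that by (simp add: V0_def)
    show "2 * \<epsilon> \<le> norm (?f p)" if "p \<in> ?K - ?I" for p
    proof -
      have "snd c p \<in> sphere ?z \<rho>" using that by auto
      then show ?thesis using w2(2)[of "snd c p"] by (simp add: \<epsilon>_def)
    qed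
    show "?f p = 0" if "p \<in> ?K \<inter> zeros S" for p
    proof -
      have p: "p \<in> fst c" "dist (snd c p) ?z < d" using that \<rho>(2) by (auto simp: dist_commute)
      have "?\<omega> (snd c p) = 0" using that zeros_iff[OF S c(1) p(1)] by blast
      then have "snd c p = ?z" using d(2)[of "snd c p"] p(2) by blast
      then show ?thesis using F_z by simp
    qed
  qed (use \<epsilon> in \<open>auto simp: V0_def\<close>)
  then show ?thesis by blast
qed

lemma closed_pathin_preimage:
  assumes "pathin X \<gamma>" "closedin X C"
  shows "closed {s \<in> {0..1}. \<gamma> s \<in> C}"
proof -
  have "closedin (top_of_set {0..1}) {s \<in> {0..1}. \<gamma> s \<in> C}"
    using closedin_continuous_map_preimage[of "top_of_set {0..1}" X \<gamma> C] assms by (simp add: pathin_def)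
  then show ?thesis by (rule closedin_closed_trans) simp
qed

text \<open>
  Along the path \<open>f\<close> grows by at most \<open>\<epsilon>\<close>, from below \<open>\<epsilon>\<close> on \<open>V\<close>, so it cannot reach the boundary of \<open>K\<close>.
\<close>

lemma straight_path_stays:
  assumes S: "translation_surface S" and \<gamma>: "straight_path S \<gamma> v"
    and nb: "flat_neighbourhood S x f W K I V \<epsilon>"
    and ab: "0 \<le> a" "a \<le> b" "b \<le> 1" and a: "\<gamma> a \<in> V" and short: "(b - a) * norm v \<le> \<epsilon>"
  shows "\<gamma> ` {a..b} \<subseteq> K"
proof -
  let ?X = "surf_top S"
  have p: "pathin ?X \<gamma>" using \<gamma> by (simp add: straight_path_def)
  have pr: "primitive_on S W f" and oI: "openin ?X I" and cK: "compactin ?X K"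
    and sub: "V \<subseteq> I" "I \<subseteq> K" "K \<subseteq> W"
    and small: "\<And>p. p \<in> V \<Longrightarrow> norm (f p) < \<epsilon>" and large: "\<And>p. p \<in> K - I \<Longrightarrow> 2 * \<epsilon> \<le> norm (f p)"
    using nb unfolding flat_neighbourhood_def by blast+
  have clK: "closedin ?X K" using compactin_imp_closedin[OF translation_surface_Hausdorff[OF S] cK] .
  define B where "B = {a..b} \<inter> {s \<in> {0..1}. \<gamma> s \<in> topspace ?X - I}"
  have "closed B"
    unfolding B_def using oI by (intro closed_Int closed_pathin_preimage[OF p]) auto
  have mem: "\<gamma> s \<in> topspace ?X" if "s \<in> {a..b}" for s
    using p that ab by (auto simp: pathin_def continuous_map_def)
  have "B = {}"
  proof (rule ccontr)
    assume "B \<noteq> {}"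
    \<comment> \<open>The first time at which the path is outside I; it is attained because I is
      open.\<close>
    define s0 where "s0 = Inf B"
    have bb: "bdd_below B" unfolding B_def by (auto intro: bdd_belowI[of _ a])
    have s0: "s0 \<in> B" unfolding s0_def by (rule closed_contains_Inf[OF \<open>B \<noteq> {}\<close> bb \<open>closed B\<close>])
    have ab0: "a \<le> s0" "s0 \<le> b" "\<gamma> s0 \<notin> I" using s0 by (auto simp: B_def)
    have "a \<noteq> s0" using a sub(1) ab0(3) by blast
    then have lt: "a < s0" using ab0(1) by simp
    have before: "\<gamma> s \<in> I" if "s \<in> {a..<s0}" for s
    proof (rule ccontr)
      assume "\<gamma> s \<notin> I"
      then have "s \<in> B" using that ab0 ab mem[of s] by (auto simp: B_def)
      then have "s0 \<le> s" unfolding s0_def by (rule cInf_lower[OF _ bb])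
      then show False using that by simp
    qed
    \<comment> \<open>Before s0 the path is in I, and K is closed, so the exit point still belongs
      to K, where the lower bound 2 \<epsilon> applies.\<close>
    have "{a..<s0} \<subseteq> {s \<in> {0..1}. \<gamma> s \<in> K}" using before sub ab ab0 by auto
    then have "closure {a..<s0} \<subseteq> {s \<in> {0..1}. \<gamma> s \<in> K}"
      by (rule closure_minimal) (rule closed_pathin_preimage[OF p clK])
    then have K: "\<gamma> ` {a..s0} \<subseteq> K" using closure_atLeastLessThan[OF lt] by auto
    then have "2 * \<epsilon> \<le> norm (f (\<gamma> s0))" using ab0 by (intro large) auto
    moreover have "f (\<gamma> s0) - f (\<gamma> a) = (s0 - a) *\<^sub>R v"
      using primitive_on_straight_path[OF S \<gamma> pr ab(1) ab0(1)] ab ab0 K sub by force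
    then have "norm (f (\<gamma> s0) - f (\<gamma> a)) = (s0 - a) * norm v" using lt by simp
    moreover have "(s0 - a) * norm v \<le> (b - a) * norm v" using ab0 by (intro mult_right_mono) auto
    moreover have "norm (f (\<gamma> a)) < \<epsilon>" by (rule small[OF a])
    ultimately show False
      using short norm_triangle_ineq2[of "f (\<gamma> s0)" "f (\<gamma> a)"] by linarith
  qed
  show ?thesis
  proof
    fix y assume "y \<in> \<gamma> ` {a..b}"
    then obtain s where s: "s \<in> {a..b}" "y = \<gamma> s" by blast
    then have "\<gamma> s \<in> I" using \<open>B = {}\<close> mem[of s] ab by (auto simp: B_def)
    then show "y \<in> K" using s sub by blast
  qed
qed

section \<open>Finiteness of the holonomy vectors of bounded length\<close>

primrec sumset_power :: "complex set \<Rightarrow> nat \<Rightarrow> complex set" where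
  "sumset_power C 0 = {0}"
| "sumset_power C (Suc k) = (\<lambda>(a, b). a + b) ` (sumset_power C k \<times> C)"

lemma finite_sumset_power: "finite C \<Longrightarrow> finite (sumset_power C k)"
  by (induction k) auto

text \<open>A saddle connection of holonomy v has constant speed at most R. Cutting its parameter
  interval into N equal pieces, with R / N at most every \<open>\<epsilon> x\<close>, keeps each
  piece within one disc, and N does not depend on the path. The difference of (k / N) v and the
  value of a primitive at time k / N starts at 0 and ends at v, because the primitives vanish at
  zeros.\<close>

lemma saddle_connection_holonomies_finite:
  assumes S: "translation_surface S"
  shows "finite {path_holonomy S \<gamma> | \<gamma>. saddle_connection S \<gamma> \<and> norm (path_holonomy S \<gamma>) \<le> R}"
proof -
  let ?X = "surf_top S"
  \<comment> \<open>The six data of a flat neighbourhood are packed into one tuple, so that a single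
    choice function selects them together.\<close>
  have "\<forall>x\<in>topspace ?X. \<exists>t. case t of (f, W, K, I, V, \<epsilon>) \<Rightarrow> flat_neighbourhood S x f W K I V \<epsilon>"
    using flat_neighbourhood_exists[OF S] by (simp add: split_paired_Ex)
  from bchoice[OF this] obtain t where t: "\<forall>x\<in>topspace ?X. case t x of (f, W, K, I, V, \<epsilon>) \<Rightarrow> flat_neighbourhood S x f W K I V \<epsilon>"
    by blast
  define f W K I V \<epsilon> where "f x = fst (t x)" and "W x = fst (snd (t x))" and "K x = fst (snd (snd (t x)))"
    and "I x = fst (snd (snd (snd (t x))))" and "V x = fst (snd (snd (snd (snd (t x)))))"
    and "\<epsilon> x = snd (snd (snd (snd (snd (t x)))))" for x
  have nb: "flat_neighbourhood S x (f x) (W x) (K x) (I x) (V x) (\<epsilon> x)" if "x \<in> topspace ?X" for x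
    using t that by (simp add: f_def W_def K_def I_def V_def \<epsilon>_def case_prod_beta)
  obtain \<F> where F: "finite \<F>" "\<F> \<subseteq> V ` topspace ?X" "topspace ?X \<subseteq> \<Union>\<F>"
  proof -
    have "topspace ?X \<subseteq> \<Union>(V ` topspace ?X)" "\<And>U. U \<in> V ` topspace ?X \<Longrightarrow> openin ?X U"
      using nb unfolding flat_neighbourhood_def by blast+
    then show ?thesis
      using compactinD[of ?X "topspace ?X" "V ` topspace ?X"] translation_surface_compact[OF S] that
      unfolding compact_space_def by blast
  qed
  obtain D where D: "finite D" "D \<subseteq> topspace ?X" "\<F> = V ` D"
    using finite_subset_image[OF F(1,2)] by blast
  have nbD: "flat_neighbourhood S x (f x) (W x) (K x) (I x) (V x) (\<epsilon> x)" if "x \<in> D" for x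
    using nb D(2) that by blast
  define C where "C = (\<Union>x\<in>D. \<Union>y\<in>D. (\<lambda>q. f x q - f y q) ` (K x \<inter> K y))"
  have "finite C"
    unfolding C_def
  proof (intro finite_UN_I D(1))
    fix x y assume xy: "x \<in> D" "y \<in> D"
    have x: "primitive_on S (W x) (f x)" "compactin ?X (K x)" "K x \<subseteq> W x"
      using nbD[OF xy(1)] unfolding flat_neighbourhood_def by blast+
    have y: "primitive_on S (W y) (f y)" "compactin ?X (K y)" "K y \<subseteq> W y"
      using nbD[OF xy(2)] unfolding flat_neighbourhood_def by blast+
    have "compactin ?X (K x \<inter> K y)"
      by (rule closed_Int_compactin[OF compactin_imp_closedin[OF translation_surface_Hausdorff[OF S] x(2)] y(2)])
    then show "finite ((\<lambda>q. f x q - f y q) ` (K x \<inter> K y))"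
      by (rule primitive_on_difference_finite[OF S x(1) y(1)]) (use x(3) y(3) in blast)+
  qed
  \<comment> \<open>The 1 keeps the minimum defined when D is empty.\<close>
  define m where "m = Min (insert 1 (\<epsilon> ` D))"
  have m: "0 < m" "\<And>x. x \<in> D \<Longrightarrow> m \<le> \<epsilon> x"
    using D(1) nbD unfolding m_def flat_neighbourhood_def by auto
  obtain n where n: "R / m < real n" using reals_Archimedean2 by blast
  \<comment> \<open>The successor keeps N positive, also for R \<le> 0.\<close>
  define N where "N = Suc n"
  have N: "0 < real N" "R / real N \<le> m"
  proof -
    show "0 < real N" by (simp add: N_def)
    have "R < real n * m" using n m(1) by (simp add: field_simps)
    also have "\<dots> \<le> real N * m" using m(1) by (simp add: N_def)
    finally show "R / real N \<le> m" using \<open>0 < real N\<close> by (simp add: field_simps)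
  qed
  \<comment> \<open>Passing from the disc of \<open>y\<close> to that of \<open>x\<close> changes the value only by \<open>f y - f x \<in> C\<close>.\<close>
  have claim: "(real k / real N) *\<^sub>R v - f x (\<gamma> (real k / real N)) \<in> sumset_power C k"
    if \<gamma>: "straight_path S \<gamma> v" and v: "norm v \<le> R" and z: "\<gamma> 0 \<in> zeros S"
      and k: "k \<le> N" and x: "x \<in> D" "\<gamma> (real k / real N) \<in> V x" for \<gamma> v k x
    using k x
  proof (induction k arbitrary: x)
    case 0
    then have "\<gamma> 0 \<in> K x \<inter> zeros S"
      using z nbD[of x] unfolding flat_neighbourhood_def by auto
    then have "f x (\<gamma> 0) = 0" using nbD[of x] 0 unfolding flat_neighbourhood_def by blast
    then show ?case by simp
  next
    case (Suc k)
    let ?a = "real k / real N" and ?b = "real (Suc k) / real N"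
    have ab: "0 \<le> ?a" "?a \<le> ?b" "?b \<le> 1" "?b - ?a = 1 / real N"
      using N(1) Suc.prems(1) by (auto simp: field_simps)
    have "\<gamma> ?a \<in> topspace ?X"
      using \<gamma> ab unfolding straight_path_def pathin_def continuous_map_def by auto
    then obtain y where y: "y \<in> D" "\<gamma> ?a \<in> V y" using F(3) D(3) by blast
    have "(?b - ?a) * norm v \<le> \<epsilon> y"
    proof -
      have "(?b - ?a) * norm v \<le> R / real N" using v N(1) unfolding ab(4) by (simp add: field_simps)
      also have "\<dots> \<le> \<epsilon> y" using N(2) m(2)[OF y(1)] by simp
      finally show ?thesis .
    qed
    then have stay: "\<gamma> ` {?a..?b} \<subseteq> K y"
      by (rule straight_path_stays[OF S \<gamma> nbD[OF y(1)] ab(1-3) y(2)])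
    have "primitive_on S (W y) (f y)" "K y \<subseteq> W y" "V x \<subseteq> K x"
      using nbD[OF y(1)] nbD[OF Suc.prems(2)] unfolding flat_neighbourhood_def by blast+
    then have inc: "f y (\<gamma> ?b) - f y (\<gamma> ?a) = (?b - ?a) *\<^sub>R v"
      using stay by (intro primitive_on_straight_path[OF S \<gamma> _ ab(1-3)]) blast+
    have "?a *\<^sub>R v - f y (\<gamma> ?a) \<in> sumset_power C k"
      using Suc.IH[OF _ y] Suc.prems(1) by simp
    moreover have "f y (\<gamma> ?b) - f x (\<gamma> ?b) \<in> C"
    proof -
      have "\<gamma> ?b \<in> K y \<inter> K x" using stay ab(2) Suc.prems(3) \<open>V x \<subseteq> K x\<close> by auto
      then show ?thesis unfolding C_def using y(1) Suc.prems(2) by blast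
    qed
    ultimately have "(?a *\<^sub>R v - f y (\<gamma> ?a)) + (f y (\<gamma> ?b) - f x (\<gamma> ?b)) \<in> sumset_power C (Suc k)"
      unfolding sumset_power.simps by (intro image_eqI[of _ _ "(_, _)"]) auto
    moreover have "(?a *\<^sub>R v - f y (\<gamma> ?a)) + (f y (\<gamma> ?b) - f x (\<gamma> ?b)) = ?b *\<^sub>R v - f x (\<gamma> ?b)"
    proof -
      have "f y (\<gamma> ?b) - f y (\<gamma> ?a) = ?b *\<^sub>R v - ?a *\<^sub>R v"
        using inc by (simp only: scaleR_left_diff_distrib)
      then show ?thesis by (simp only: algebra_simps)
    qed
    ultimately show ?case by (simp only:)
  qed
  have "{path_holonomy S \<gamma> | \<gamma>. saddle_connection S \<gamma> \<and> norm (path_holonomy S \<gamma>) \<le> R} \<subseteq> sumset_power C N"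
  proof
    fix v assume "v \<in> {path_holonomy S \<gamma> | \<gamma>. saddle_connection S \<gamma> \<and> norm (path_holonomy S \<gamma>) \<le> R}"
    then obtain \<gamma> where \<gamma>: "saddle_connection S \<gamma>" and v: "v = path_holonomy S \<gamma>" "norm v \<le> R" by blast
    have st: "straight_path S \<gamma> v" unfolding v(1) by (rule saddle_connection_straight[OF S \<gamma>])
    have z: "\<gamma> 0 \<in> zeros S" "\<gamma> 1 \<in> zeros S" using \<gamma> by (auto simp: saddle_connection_def)
    then have "\<gamma> 1 \<in> topspace ?X" using zeros_subset[OF S] by blast
    then obtain x where x: "x \<in> D" "\<gamma> 1 \<in> V x" using F(3) D(3) by blast
    then have "f x (\<gamma> 1) = 0" using nbD[OF x(1)] z(2) unfolding flat_neighbourhood_def by blast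
    moreover have "v - f x (\<gamma> 1) \<in> sumset_power C N"
      using claim[OF st v(2) z(1) order_refl x(1)] x(2) N(1) by simp
    ultimately show "v \<in> sumset_power C N" by simp
  qed
  then show ?thesis using finite_sumset_power[OF \<open>finite C\<close>] finite_subset by blast
qed

lemma surface_holonomies_locally_finite:
  assumes S: "translation_surface S"
  shows "finite (surface_holonomies S \<inter> cball 0 R)"
proof -
  have "surface_holonomies S \<inter> cball 0 R \<subseteq>
      to_R2 ` {path_holonomy S \<gamma> | \<gamma>. saddle_connection S \<gamma> \<and> norm (path_holonomy S \<gamma>) \<le> R}"
  proof
    fix h assume h: "h \<in> surface_holonomies S \<inter> cball 0 R"
    then obtain \<gamma> where "saddle_connection S \<gamma>" "h = to_R2 (path_holonomy S \<gamma>)"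
      unfolding surface_holonomies_def by blast
    moreover from this h have "norm (path_holonomy S \<gamma>) \<le> R" by (simp add: norm_to_R2)
    ultimately show "h \<in> to_R2 ` {path_holonomy S \<gamma> | \<gamma>. saddle_connection S \<gamma> \<and> norm (path_holonomy S \<gamma>) \<le> R}"
      by blast
  qed
  then show ?thesis using saddle_connection_holonomies_finite[OF S, of R] finite_subset by blast
qed

lemma zero_notin_surface_holonomies:
  assumes S: "translation_surface S"
  shows "0 \<notin> surface_holonomies S"
proof
  assume "0 \<in> surface_holonomies S"
  then obtain \<gamma> where \<gamma>: "saddle_connection S \<gamma>" and 0: "to_R2 (path_holonomy S \<gamma>) = 0"
    unfolding surface_holonomies_def by auto
  have "path_holonomy S \<gamma> = 0" using 0 norm_to_R2[of "path_holonomy S \<gamma>"] by simp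
  then show False using saddle_connection_nonzero[OF S \<gamma>] by blast
qed

theorem theorem1p2:
  fixes g :: nat and \<alpha> :: "nat multiset" and C \<H> :: "tsurf set set"
    and lam :: "tsurf set measure" and \<kappa> :: "(real^2^2) measure"
  assumes "0 \<notin># \<alpha>" and "sum_mset \<alpha> + 2 = 2 * g"
    and "C \<in> connected_components_of (stratum_topology g \<alpha>)"
    and "\<H> = area_one_locus C"
    and "sets lam = sets (borel_of (subtopology (stratum_topology g \<alpha>) \<H>))"
    and "SL2_invariant lam"
    and "\<And>f. f \<in> B\<^sub>c \<Longrightarrow> siegel_veech f \<in> borel_measurable lam \<and>
                     integrable lam (\<lambda>\<omega>. (siegel_veech f \<omega>)\<^sup>2)"
    and "is_haar_SL2 \<kappa>"
  shows "\<exists>(\<nu> :: real measure) (\<eta> :: real option measure).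
    sets \<nu> = sets (borel_of (top_of_set (- {0}))) \<and>
    sets \<eta> = sets (borel_of P1) \<and>
    (\<forall>h \<in> B\<^sub>c.
      integrable lam (siegel_veech2 h) \<and>
      (\<forall>t. t \<noteq> 0 \<longrightarrow> integrable \<kappa> (\<lambda>A. h (t *\<^sub>R column 1 A, column 2 A))) \<and>
      integrable \<nu> (\<lambda>t. LINT A|\<kappa>. h (t *\<^sub>R column 1 A, column 2 A)) \<and>
      (\<forall>s. integrable lborel (slope_slice h s)) \<and>
      integrable \<eta> (\<lambda>s. LINT x|lborel. slope_slice h s x) \<and>
      (LINT \<omega>|lam. siegel_veech2 h \<omega>) =
        (LINT t|\<nu>. (LINT A|\<kappa>. h (t *\<^sub>R column 1 A, column 2 A))) +
        (LINT s|\<eta>. (LINT x|lborel. slope_slice h s x)))"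
proof -
  have sp: "c \<in> stratum g \<alpha>" if "c \<in> space lam" for c
  proof -
    have "space lam = topspace (subtopology (stratum_topology g \<alpha>) \<H>)"
      using sets_eq_imp_space_eq[OF assms(5)] by (simp add: space_borel_of)
    with that have "c \<in> topspace (stratum_topology g \<alpha>)" by simp
    \<comment> \<open>The carrier of a topology introduced by \<open>topology\<close> is known only
      once its open sets are characterized; being open itself, it lies in the stratum.\<close>
    moreover have "topspace (stratum_topology g \<alpha>) \<subseteq> stratum g \<alpha>"
      using openin_stratum_topology[of g \<alpha> "topspace (stratum_topology g \<alpha>)"] by simp
    ultimately show ?thesis by blast
  qed
  have act: "SL2_act A \<in> lam \<rightarrow>\<^sub>M lam" "distr lam lam (SL2_act A) = lam" if "det A = 1" for A
    using assms(6) that unfolding SL2_invariant_def SL2_def by blast+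
  have fin: "finite (\<Lambda> c \<inter> cball 0 r)" and nz: "0 \<notin> \<Lambda> c" if c: "c \<in> space lam" for c r
  proof -
    obtain S where S: "S \<in> c" using sp[OF c] unfolding stratum_def by blast
    note L = Lambda_eq_surface_holonomies[OF sp[OF c] S]
    show "finite (\<Lambda> c \<inter> cball 0 r)" unfolding L(1) by (rule surface_holonomies_locally_finite[OF L(2)])
    show "0 \<notin> \<Lambda> c" unfolding L(1) by (rule zero_notin_surface_holonomies[OF L(2)])
  qed
  \<comment> \<open>Measurability of the action keeps the image class in the space of
    \<open>lam\<close>, hence in the stratum, and in particular nonempty.\<close>
  have equiv: "\<Lambda> (SL2_act A c) = (*v) A ` \<Lambda> c" if A: "det A = 1" and c: "c \<in> space lam" for A c
    by (rule Lambda_SL2_act[OF sp[OF c] sp[OF measurable_space[OF act(1)[OF A] c]] adj2_mult[OF A]])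
  have sv: "(\<lambda>c. infsum f (\<Lambda> c)) \<in> borel_measurable lam" "integrable lam (\<lambda>c. (infsum f (\<Lambda> c))\<^sup>2)"
    if "f \<in> B\<^sub>c" for f
    using assms(7)[OF that] unfolding siegel_veech_def[abs_def] by blast+
  have sv2: "siegel_veech2 h = (\<lambda>c. infsum h (\<Lambda> c \<times> \<Lambda> c))" for h
    by (simp add: siegel_veech2_def fun_eq_iff)
  show ?thesis
    unfolding sv2
    by (rule siegel_veech2_disintegration[OF fin nz act equiv sv assms(8)])
qed

end
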